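(* Let $n\in\mathbb{N}$, $0<\alpha<n$, $1<p<\infty$, $0<\rho<\infty$, and $\omega\in A_p^{\rm loc}$. There is a constant $C=C(n,\alpha,p,[\omega]_{A_{p;20\rho}^{\rm loc}})>0$, depending only on the indicated parameters, such that for every set $E\subseteq\mathbb{R}^n$, $$C^{-1}R_{\alpha,p;\rho}^{\omega}(E)\le\mathcal{R}_{\alpha,p;\rho}^{\omega}(E)\le C\,R_{\alpha,p;\rho}^{\omega}(E).$$
   Context: $|x|_\infty=\max_i|x_i|$; $\omega'=\omega^{-\frac{1}{p-1}}$. Cubes are open with sides parallel to the axes; $\ell(Q)$ is the side length. A weight is a locally integrable function $\omega\ge0$ on $\mathbb{R}^n$ with $\omega>0$ a.e. $[\omega]_{A_{p;\rho}^{\rm loc}}=\sup_{\ell(Q)\le\rho}\left(\frac{1}{|Q|}\int_Q\omega\right)\left(\frac{1}{|Q|}\int_Q\omega^{-\frac{1}{p-1}}\right)^{p-1}$ for $1<p<\infty$; the class of weights for which this is finite does not depend on $0<\rho<\infty$ and is denoted $A_p^{\rm loc}$. With $I_{\alpha,\rho}(x)=|x|_\infty^{\alpha-n}\chi_{\{|x|_\infty<\rho\}}$, the weighted local Riesz capacity is $R_{\alpha,p;\rho}^{\omega}(E)=\inf\left\{\int_{\mathbb{R}^n}f^p\omega\,dx:\ f\ge0\text{ measurable},\ f\in L^p(\omega),\ I_{\alpha,\rho}\ast f\ge1\text{ on }E\right\}$. The variant capacity is $\mathcal{R}_{\alpha,p;\rho}^{\omega}(E)=\inf\left\{\int_0^\rho\int_{\mathbb{R}^n}f(y,t)^p\,\omega'(y)\,dy\frac{dt}{t}\right\}$,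 the infimum over measurable $f\ge0$ on $\mathbb{R}^n\times(0,\rho)$ (with this integral finite) such that $\int_0^\rho\left(\int_{|x-y|_\infty<t}\frac{f(y,t)}{t^{n-\alpha}}\,\omega'(y)\,dy\right)\frac{dt}{t}\ge1$ for every $x\in E$ ($\inf\emptyset=\infty$). *)

theory Defs
  imports "HOL-Analysis.Analysis"
begin

definition is_weight :: "(real^'n \<Rightarrow> real) \<Rightarrow> bool" where
  "is_weight \<omega> \<longleftrightarrow>
     (\<forall>K. compact K \<longrightarrow> \<omega> absolutely_integrable_on K) \<and>
     (\<forall>x. 0 \<le> \<omega> x) \<and> (AE x in lebesgue. 0 < \<omega> x)"

text \<open>Since \<^term>\<open>0 powr a = 0\<close>, the dual weight vanishes, instead of being infinite, where
  \<open>\<omega>\<close> does; for a weight this is a null set.\<close>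

definition dual_weight :: "real \<Rightarrow> (real^'n \<Rightarrow> real) \<Rightarrow> real^'n \<Rightarrow> real" where
  "dual_weight p \<omega> x = \<omega> x powr (- (1 / (p - 1)))"

definition cube :: "real^'n \<Rightarrow> real \<Rightarrow> (real^'n) set" where
  "cube a l = box a (\<chi> i. a $ i + l)"

definition average :: "(real^'n) set \<Rightarrow> (real^'n \<Rightarrow> real) \<Rightarrow> ennreal" where
  "average Q g = (\<integral>\<^sup>+x\<in>Q. ennreal (g x) \<partial>lebesgue) / emeasure lebesgue Q"

text \<open>Real powers on \<open>[0, \<infinity>]\<close>, intended for exponents \<open>a > 0\<close>.\<close>

definition ennreal_powr :: "ennreal \<Rightarrow> real \<Rightarrow> ennreal" where
  "ennreal_powr x a = (if x = \<infinity> then \<infinity> else ennreal (enn2real x powr a))"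

definition Ap_loc_const :: "real \<Rightarrow> real \<Rightarrow> (real^'n \<Rightarrow> real) \<Rightarrow> ennreal" where
  "Ap_loc_const p \<rho> \<omega> =
     (SUP (a, l) \<in> UNIV \<times> {0<..\<rho>}.
        average (cube a l) \<omega> * ennreal_powr (average (cube a l) (dual_weight p \<omega>)) (p - 1))"

text \<open>The class does not depend on the scale at which finiteness is required, so it is enough
  to ask for finiteness at some scale.\<close>

definition Ap_loc :: "real \<Rightarrow> (real^'n \<Rightarrow> real) set" where
  "Ap_loc p = {\<omega>. is_weight \<omega> \<and> (\<exists>\<rho>>0. Ap_loc_const p \<rho> \<omega> < \<infinity>)}"

text \<open>\<^const>\<open>infnorm\<close> is the maximum norm. The value of the kernel at the origin is \<open>0\<close> instead of
  \<open>\<infinity>\<close>, which does not affect convolutions.\<close>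

definition riesz_kernel :: "real \<Rightarrow> real \<Rightarrow> real^'n \<Rightarrow> real" where
  "riesz_kernel \<alpha> \<rho> x =
     (if infnorm x < \<rho> then infnorm x powr (\<alpha> - real CARD('n)) else 0)"

definition riesz_potential :: "real \<Rightarrow> real \<Rightarrow> (real^'n \<Rightarrow> real) \<Rightarrow> real^'n \<Rightarrow> ennreal" where
  "riesz_potential \<alpha> \<rho> f x = (\<integral>\<^sup>+y. ennreal (riesz_kernel \<alpha> \<rho> (x - y) * f y) \<partial>lebesgue)"

definition Lp_energy :: "real \<Rightarrow> (real^'n \<Rightarrow> real) \<Rightarrow> (real^'n \<Rightarrow> real) \<Rightarrow> ennreal" where
  "Lp_energy p \<omega> f = (\<integral>\<^sup>+x. ennreal (f x powr p * \<omega> x) \<partial>lebesgue)"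

definition riesz_capacity ::
    "real \<Rightarrow> real \<Rightarrow> real \<Rightarrow> (real^'n \<Rightarrow> real) \<Rightarrow> (real^'n) set \<Rightarrow> ennreal" where
  "riesz_capacity \<alpha> p \<rho> \<omega> E =
     Inf {Lp_energy p \<omega> f | f.
       f \<in> borel_measurable lebesgue \<and> (\<forall>x. 0 \<le> f x) \<and> Lp_energy p \<omega> f < \<infinity> \<and>
       (\<forall>x\<in>E. 1 \<le> riesz_potential \<alpha> \<rho> f x)}"

definition layered_energy ::
    "real \<Rightarrow> real \<Rightarrow> (real^'n \<Rightarrow> real) \<Rightarrow> ((real^'n) \<times> real \<Rightarrow> real) \<Rightarrow> ennreal" where
  "layered_energy p \<rho> \<omega> f =
     (\<integral>\<^sup>+t\<in>{0<..<\<rho>}.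
        (\<integral>\<^sup>+y. ennreal (f (y, t) powr p * dual_weight p \<omega> y) \<partial>lebesgue) * ennreal (1 / t)
      \<partial>lebesgue)"

definition layered_potential ::
    "real \<Rightarrow> real \<Rightarrow> real \<Rightarrow> (real^'n \<Rightarrow> real) \<Rightarrow> ((real^'n) \<times> real \<Rightarrow> real) \<Rightarrow> real^'n \<Rightarrow> ennreal" where
  "layered_potential \<alpha> p \<rho> \<omega> f x =
     (\<integral>\<^sup>+t\<in>{0<..<\<rho>}.
        (\<integral>\<^sup>+y\<in>{y. infnorm (x - y) < t}.
           ennreal (f (y, t) / t powr (real CARD('n) - \<alpha>) * dual_weight p \<omega> y) \<partial>lebesgue)
        * ennreal (1 / t) \<partial>lebesgue)"

definition variant_capacity ::
    "real \<Rightarrow> real \<Rightarrow> real \<Rightarrow> (real^'n \<Rightarrow> real) \<Rightarrow> (real^'n) set \<Rightarrow> ennreal" where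
  "variant_capacity \<alpha> p \<rho> \<omega> E =
     Inf {layered_energy p \<rho> \<omega> f | f.
       f \<in> borel_measurable (lebesgue_on (UNIV \<times> {0<..<\<rho>})) \<and>
       (\<forall>y. \<forall>t\<in>{0<..<\<rho>}. 0 \<le> f (y, t)) \<and> layered_energy p \<rho> \<omega> f < \<infinity> \<and>
       (\<forall>x\<in>E. 1 \<le> layered_potential \<alpha> p \<rho> \<omega> f x)}"

end

theory Submission
  imports Defs
begin

text \<open>Both inequalities are proved on the primal side, by turning a competitor for one capacity into a
  competitor for the other.

  From layers \<open>f(\<cdot>, t)\<close> to a single function: at each dyadic scale \<open>r\<close> average the mass of the layers
  over balls of radius \<open>2 r\<close>, which is bounded from \<open>L\<^sup>p(\<omega>')\<close> to \<open>L\<^sup>p(\<omega>)\<close> by the \<open>A\<^sub>p\<close> condition, and take the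
  \<open>l\<^sup>p\<close>-sum \<open>g\<close> over the scales. On the shell of radius about \<open>r\<close> around \<open>x\<close>, \<open>g\<close> dominates the average at scale
  \<open>r\<close> around \<open>x\<close>, so the Riesz potential of \<open>g\<close> dominates the layered one.

  From a single function to layers: in each of \<open>2 ^ n\<close> shifted dyadic grids, use as layers the increments of
  the running maximum, over scales from coarse to fine, of the dyadic averages. The increments add up to
  the dyadic maximal function, so Muckenhoupt's theorem bounds the energy, and summation by parts shows
  that their potential dominates the sum of the averages weighted by \<open>r powr \<alpha>\<close>, which is the Riesz
  potential up to a constant.\<close>

section \<open>Real powers on the extended half-line\<close>

text \<open>The link between the two energies is the identity \<open>s ^ p * w = s\<close> for the
  dual weight \<open>s\<close>: multiplication by \<open>s\<close> is an isometry from L^p(s) to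
  L^p(w). The delicate direction is from a function to layers. Taking the averages themselves as
  layers would give an l^p-sum of averages over infinitely many scales as energy, while the maximal
  function controls only their supremum. Increments cure this: for p >= 1 the sum of the p-th powers
  of nonnegative numbers is at most the p-th power of their sum. Summation by parts against the
  ratio 2^(-\<alpha>) then loses only the factor 1 - 2^(-\<alpha>), and here \<alpha> > 0 enters. In
  the other direction the l^p-sum is harmless, because the Riesz potential meets every scale on an
  annulus of its own. The constant may depend only on the A_p constant at scale 20 \<rho>, while
  membership in the class gives finiteness at some unknown scale. Finiteness is therefore carried to
  all scales first, without control, and the constant at the required scale is inserted afterwards.
  The quantitative estimates use the A_p condition on balls of radius at most 4 \<rho>.\<close>

lemma ennreal_powr_ennreal [simp]: "0 \<le> r \<Longrightarrow> ennreal_powr (ennreal r) a = ennreal (r powr a)"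
  by (simp add: ennreal_powr_def)

lemma ennreal_powr_top [simp]: "ennreal_powr top a = top"
  by (simp add: ennreal_powr_def)

lemma ennreal_powr_0 [simp]: "ennreal_powr 0 a = 0"
  by (simp add: ennreal_powr_def)

lemma ennreal_powr_1 [simp]: "ennreal_powr 1 a = 1"
  by (simp add: ennreal_powr_def)

lemma ennreal_powr_one [simp]: "ennreal_powr x 1 = x"
  by (cases x) auto

lemma ennreal_powr_mono: "x \<le> y \<Longrightarrow> 0 \<le> a \<Longrightarrow> ennreal_powr x a \<le> ennreal_powr y a"
  by (cases x; cases y) (auto intro!: ennreal_leI powr_mono2 simp: top_unique)

lemma ennreal_powr_mult: "0 < a \<Longrightarrow> ennreal_powr (x * y) a = ennreal_powr x a * ennreal_powr y a"
proof (cases x; cases y)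
  fix r s assume "x = ennreal r" "0 \<le> r" "y = ennreal s" "0 \<le> s"
  then show ?thesis by (simp add: ennreal_mult[symmetric] powr_mult)
qed (auto simp: ennreal_top_mult ennreal_mult_top powr_eq_0_iff)

lemma ennreal_powr_powr: "0 < a \<Longrightarrow> ennreal_powr (ennreal_powr x a) b = ennreal_powr x (a * b)"
  by (cases x) (auto simp: powr_powr)

lemma ennreal_powr_add: "ennreal_powr x (a + b) = ennreal_powr x a * ennreal_powr x b"
  by (cases x) (auto simp: powr_add ennreal_mult)

lemma ennreal_powr_eq_0 [simp]: "ennreal_powr x a = 0 \<longleftrightarrow> x = 0"
  by (cases x) (auto simp: powr_eq_0_iff)

lemma ennreal_powr_eq_top [simp]: "ennreal_powr x a = top \<longleftrightarrow> x = top"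
  by (cases x) auto

lemma ennreal_powr_less_top [simp]: "ennreal_powr x a < top \<longleftrightarrow> x < top"
  by (cases x) auto

lemma measurable_ennreal_powr [measurable]:
  assumes [measurable]: "f \<in> borel_measurable M"
  shows "(\<lambda>x. ennreal_powr (f x) a) \<in> borel_measurable M"
  unfolding ennreal_powr_def infinity_ennreal_def by measurable

text \<open>The sum is at most its number of terms times the largest term \<open>a k\<close>, and
  the power of the largest term is one of the summands on the right.\<close>

lemma ennreal_powr_sum_le:
  assumes "finite I" "1 \<le> p"
  shows "ennreal_powr (\<Sum>i\<in>I. a i) p \<le> ennreal (real (card I) powr p) * (\<Sum>i\<in>I. ennreal_powr (a i) p)"
proof (cases "I = {}")
  case False
  then have "Max (a ` I) \<in> a ` I" using assms(1) by (intro Max_in) auto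
  then obtain k where k: "k \<in> I" "Max (a ` I) = a k" by blast
  then have k: "k \<in> I" "\<And>i. i \<in> I \<Longrightarrow> a i \<le> a k"
    using assms(1) Max_ge[of "a ` I"] by auto
  have "(\<Sum>i\<in>I. a i) \<le> of_nat (card I) * a k"
    using sum_bounded_above[of I a "a k"] k by auto
  then have "ennreal_powr (\<Sum>i\<in>I. a i) p \<le> ennreal_powr (of_nat (card I) * a k) p"
    using assms by (intro ennreal_powr_mono) auto
  also have "\<dots> = ennreal (real (card I) powr p) * ennreal_powr (a k) p"
    using assms by (simp add: ennreal_powr_mult ennreal_of_nat_eq_real_of_nat)
  also have "ennreal_powr (a k) p \<le> (\<Sum>i\<in>I. ennreal_powr (a i) p)"
    using assms k by (intro member_le_sum) auto
  finally show ?thesis by (simp add: mult_left_mono)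
qed simp

text \<open>Write x^p as x * x^(p-1) and enlarge the second factor to the power of the whole sum.
  This superadditivity is what keeps the energy of the increments below the maximal
  function.\<close>

lemma sum_ennreal_powr_le:
  assumes "finite I" "1 \<le> p"
  shows "(\<Sum>i\<in>I. ennreal_powr (a i) p) \<le> ennreal_powr (\<Sum>i\<in>I. a i) p"
proof -
  have eq: "ennreal_powr x p = x * ennreal_powr x (p - 1)" for x
    using ennreal_powr_add[of x 1 "p - 1"] by simp
  have "(\<Sum>i\<in>I. ennreal_powr (a i) p) \<le> (\<Sum>i\<in>I. a i * ennreal_powr (\<Sum>i\<in>I. a i) (p - 1))"
    unfolding eq using assms
    by (intro sum_mono mult_left_mono ennreal_powr_mono member_le_sum) auto
  also have "\<dots> = ennreal_powr (\<Sum>i\<in>I. a i) p"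
    by (simp add: eq sum_distrib_right)
  finally show ?thesis .
qed

text \<open>A convex power lies above its tangent at \<open>c\<close>; here this is Young's
  inequality. It yields both Hoelder's inequality and the one-step estimate for running
  maxima.\<close>

lemma powr_tangent:
  fixes g c p :: real
  assumes "0 \<le> g" "0 \<le> c" "1 < p"
  shows "p * c powr (p - 1) * g \<le> g powr p + (p - 1) * c powr p"
proof -
  define q where "q = p / (p - 1)"
  have q: "q > 1" "1 / p + 1 / q = 1" using assms by (auto simp: q_def field_simps)
  have "g * c powr (p - 1) \<le> g powr p / p + (c powr (p - 1)) powr q / q"
    using assms q by (intro Youngs_inequality) auto
  also have "(c powr (p - 1)) powr q = c powr p" using assms by (simp add: powr_powr q_def)
  finally have "p * (g * c powr (p - 1)) \<le> p * (g powr p / p + c powr p / q)"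
    using assms by (intro mult_left_mono) auto
  also have "\<dots> = g powr p + (p - 1) * c powr p"
    using assms by (simp add: q_def field_simps)
  finally show ?thesis by (simp add: mult_ac)
qed

text \<open>Integrating the tangent inequality against \<open>s\<close> and optimizing over the
  point of contact gives Hoelder's inequality. Since \<open>s\<close> is an arbitrary density, it
  can carry a weight, an indicator or a kernel.\<close>

lemma Holder_weighted:
  fixes g s :: "'a \<Rightarrow> ennreal"
  assumes [measurable]: "g \<in> borel_measurable M" "s \<in> borel_measurable M" and p: "1 < p"
  shows "ennreal_powr (\<integral>\<^sup>+x. g x * s x \<partial>M) p
    \<le> (\<integral>\<^sup>+x. ennreal_powr (g x) p * s x \<partial>M) * ennreal_powr (\<integral>\<^sup>+x. s x \<partial>M) (p - 1)"
    (is "ennreal_powr ?X p \<le> ?A * ennreal_powr ?S (p - 1)")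
proof (cases "?A = 0 \<or> ?S = 0")
  case True
  then have "AE x in M. g x * s x = 0"
    by (auto simp: nn_integral_0_iff_AE)
  then have "?X = 0" by (simp add: nn_integral_0_iff_AE)
  then show ?thesis by simp
next
  case nz: False
  show ?thesis
  proof (cases "?A = top \<or> ?S = top")
    case True
    then show ?thesis using nz by (auto simp: ennreal_top_mult ennreal_mult_top)
  next
    case False
    then obtain A S where A: "?A = ennreal A" "0 < A" and S: "?S = ennreal S" "0 < S"
      using nz by (cases ?A; cases ?S) (auto simp: order_less_le)
    have tangent: "ennreal (p * c powr (p - 1)) * x \<le> ennreal_powr x p + ennreal ((p - 1) * c powr p)"
      if "0 \<le> c" for c x
    proof (cases x)
      case (real r)
      then show ?thesis using powr_tangent[of r c p] that p
        by (simp add: ennreal_mult[symmetric] ennreal_plus[symmetric] del: ennreal_plus)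
    qed simp
    have int: "ennreal (p * c powr (p - 1)) * ?X \<le> ennreal (A + (p - 1) * c powr p * S)"
      if "0 \<le> c" for c
    proof -
      have "ennreal (p * c powr (p - 1)) * ?X = (\<integral>\<^sup>+x. ennreal (p * c powr (p - 1)) * g x * s x \<partial>M)"
        by (simp add: nn_integral_cmult mult.assoc)
      also have "\<dots> \<le> (\<integral>\<^sup>+x. ennreal_powr (g x) p * s x + ennreal ((p - 1) * c powr p) * s x \<partial>M)"
        using mult_right_mono[OF tangent[OF that]]
        by (intro nn_integral_mono) (auto simp: distrib_right)
      also have "\<dots> = ?A + ennreal ((p - 1) * c powr p) * ?S"
        by (simp add: nn_integral_add nn_integral_cmult)
      also have "\<dots> = ennreal (A + (p - 1) * c powr p * S)"
        using A S p by (simp add: ennreal_mult)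
      finally show ?thesis .
    qed
    \<comment> \<open>The point of contact c = 1 already bounds \<open>?X\<close> by A + (p - 1) S,
      up to the factor p.\<close>
    have "?X < top"
    proof -
      have "ennreal p * ?X < top"
        using int[of 1] by (simp) (metis ennreal_less_top order_le_less_trans)
      then show ?thesis using p by (auto simp: ennreal_mult_less_top)
    qed
    then obtain X where X: "?X = ennreal X" "0 \<le> X" by (cases ?X) auto
    \<comment> \<open>The optimal point of contact is the mean of \<open>g\<close> with respect to
      \<open>s\<close>: then (p - 1) c^p S cancels all but one of the p copies of c^(p-1) X.\<close>
    define c where "c = X / S"
    have c: "0 \<le> c" using X S by (simp add: c_def)
    have "ennreal (p * c powr (p - 1) * X) \<le> ennreal (A + (p - 1) * c powr p * S)"
      using int[OF c] X p by (simp add: ennreal_mult)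
    moreover have "0 \<le> A + (p - 1) * c powr p * S" using A S p by simp
    ultimately have le: "p * c powr (p - 1) * X \<le> A + (p - 1) * c powr p * S"
      by simp
    have cp: "c powr p = c powr (p - 1) * c"
      using powr_mult_base[of c "p - 1"] c by (simp add: mult.commute)
    have "c * S = X" using S by (simp add: c_def)
    then have "c powr p * S = c powr (p - 1) * X" by (simp add: cp)
    then have "(p - 1) * c powr p * S = p * c powr (p - 1) * X - c powr (p - 1) * X"
      by (simp add: mult.assoc left_diff_distrib)
    then have "c powr (p - 1) * X \<le> A" using le by linarith
    then have "c powr (p - 1) * X * S powr (p - 1) \<le> A * S powr (p - 1)"
      by (intro mult_right_mono) auto
    moreover have "c powr (p - 1) * S powr (p - 1) = X powr (p - 1)"
      using powr_mult[of c S "p - 1"] \<open>c * S = X\<close> by simp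
    moreover have "X powr (p - 1) * X = X powr p"
      using powr_mult_base[of X "p - 1"] X by (simp add: mult.commute)
    ultimately have "X powr p \<le> A * S powr (p - 1)" by (simp add: mult_ac)
    then show ?thesis
      using A S X by (simp add: ennreal_mult[symmetric])
  qed
qed

section \<open>The martingale maximal inequality\<close>

text \<open>The power is monotone with monotone inverse \<open>ennreal_powr _ (1 / q)\<close>, so it
  commutes with the supremum of any nonempty family.\<close>

lemma ennreal_powr_SUP:
  assumes "0 < q" "I \<noteq> {}"
  shows "ennreal_powr (SUP i\<in>I. a i) q = (SUP i\<in>I. ennreal_powr (a i) q)"
proof (rule antisym)
  define b where "b = (SUP i\<in>I. ennreal_powr (a i) q)"
  have "a i \<le> ennreal_powr b (1 / q)" if "i \<in> I" for i
  proof -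
    have "a i = ennreal_powr (ennreal_powr (a i) q) (1 / q)"
      using assms by (simp add: ennreal_powr_powr)
    also have "\<dots> \<le> ennreal_powr b (1 / q)"
      using that assms unfolding b_def by (intro ennreal_powr_mono SUP_upper) auto
    finally show ?thesis .
  qed
  then have "ennreal_powr (SUP i\<in>I. a i) q \<le> ennreal_powr (ennreal_powr b (1 / q)) q"
    using assms by (intro ennreal_powr_mono SUP_least) auto
  then show "ennreal_powr (SUP i\<in>I. a i) q \<le> (SUP i\<in>I. ennreal_powr (a i) q)"
    using assms by (simp add: b_def ennreal_powr_powr)
qed (use assms in \<open>auto intro!: SUP_least ennreal_powr_mono SUP_upper\<close>)

section \<open>Running maxima, their increments, and Doob's inequality for nested cells\<close>

primrec running_max :: "(nat \<Rightarrow> ennreal) \<Rightarrow> nat \<Rightarrow> ennreal" where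
  "running_max a 0 = a 0"
| "running_max a (Suc m) = max (running_max a m) (a (Suc m))"

lemma running_max_ge: "k \<le> m \<Longrightarrow> a k \<le> running_max a m"
  by (induction m) (auto simp: le_Suc_eq max.coboundedI1)

lemma running_max_mem: "\<exists>k\<le>m. running_max a m = a k"
proof (induction m)
  case (Suc m)
  then show ?case by (cases "running_max a m \<le> a (Suc m)") (auto simp: max_def intro: le_SucI)
qed auto

lemma running_max_less_top: "(\<And>k. a k < top) \<Longrightarrow> running_max a m < top"
  using running_max_mem[of m a] by auto

lemma running_max_cong: "(\<And>k. k \<le> m \<Longrightarrow> a k = b k) \<Longrightarrow> running_max a m = running_max b m"
  by (induction m) auto

lemma incseq_running_max: "incseq (running_max a)"
  by (rule incseq_SucI) simp

lemma SUP_running_max: "(SUP m. running_max a m) = (SUP m. a m)"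
proof (rule antisym)
  show "(SUP m. running_max a m) \<le> (SUP m. a m)"
    by (rule SUP_least) (metis UNIV_I SUP_upper running_max_mem)
  show "(SUP m. a m) \<le> (SUP m. running_max a m)"
    by (rule SUP_mono) (use running_max_ge in blast)
qed

lemma measurable_running_max [measurable (raw)]:
  assumes "\<And>k. (\<lambda>x. a x k) \<in> borel_measurable M"
  shows "(\<lambda>x. running_max (a x) m) \<in> borel_measurable M"
  using assms by (induction m) auto

definition increment :: "(nat \<Rightarrow> ennreal) \<Rightarrow> nat \<Rightarrow> ennreal" where
  "increment z m = (if m = 0 then z 0 else z m - z (m - 1))"

lemma increment_0 [simp]: "increment z 0 = z 0" and increment_Suc [simp]: "increment z (Suc m) = z (Suc m) - z m"
  by (simp_all add: increment_def)

lemma sum_increment: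
  assumes "incseq z" "\<And>k. z k < top"
  shows "(\<Sum>m\<le>N. increment z m) = z N"
proof (induction N)
  case (Suc N)
  have "z N \<le> z (Suc N)" using assms(1) by (simp add: incseq_def)
  then show ?case using Suc by (simp add: ennreal_ineq_diff_add[symmetric])
qed simp

text \<open>A pathwise form of Doob's inequality. When the maximum jumps from u to v =
  \<open>a (Suc N)\<close>, the tangent inequality gives v^q - u^q <= q/(q-1) * v * (v^(q-1) -
  u^(q-1)). The right-hand side pairs \<open>a m\<close> with a quantity that depends only on the
  terms up to \<open>m\<close>; after integration this allows an average to be replaced by the
  function itself.\<close>

lemma running_max_powr_le:
  assumes "1 < q" and fin: "\<And>k. a k < top"
  shows "ennreal_powr (running_max a N) q
    \<le> ennreal (q / (q - 1)) * (\<Sum>m\<le>N. a m * increment (\<lambda>k. ennreal_powr (running_max a k) (q - 1)) m)"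
proof (induction N)
  case 0
  have "ennreal_powr (a 0) q = a 0 * ennreal_powr (a 0) (q - 1)"
    using ennreal_powr_add[of "a 0" 1 "q - 1"] by simp
  moreover have "1 \<le> ennreal (q / (q - 1))"
    using assms by (simp add: field_simps)
  ultimately show ?case
    using mult_right_mono[of 1 "ennreal (q / (q - 1))" "ennreal_powr (a 0) q"] by simp
next
  case (Suc N)
  let ?c = "ennreal (q / (q - 1))"
  let ?Z = "\<lambda>k. ennreal_powr (running_max a k) (q - 1)"
  have step: "ennreal_powr (running_max a (Suc N)) q
      \<le> ennreal_powr (running_max a N) q + ?c * (a (Suc N) * (?Z (Suc N) - ?Z N))"
  proof (cases "a (Suc N) \<le> running_max a N")
    case True
    then show ?thesis by (simp add: max_absorb1)
  next
    case False
    then have eq: "running_max a (Suc N) = a (Suc N)" by (simp add: max_absorb2)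
    obtain u where u: "running_max a N = ennreal u" "0 \<le> u"
      using running_max_less_top[OF fin] by (meson less_top_ennreal)
    obtain v where v: "a (Suc N) = ennreal v" "0 \<le> v"
      using fin by (meson less_top_ennreal)
    have uv: "u \<le> v" using False u v by auto
    have "q * u powr (q - 1) * v \<le> v powr q + (q - 1) * u powr q"
      using assms u v by (intro powr_tangent) auto
    moreover have "v * v powr (q - 1) = v powr q"
      using powr_mult_base[of v "q - 1"] v by simp
    ultimately have "(q - 1) * v powr q \<le> (q - 1) * u powr q + q * (v * (v powr (q - 1) - u powr (q - 1)))"
      by (simp add: algebra_simps)
    then have "v powr q \<le> ((q - 1) * u powr q + q * (v * (v powr (q - 1) - u powr (q - 1)))) / (q - 1)"
      using assms by (simp add: field_simps)
    also have "\<dots> = u powr q + q / (q - 1) * (v * (v powr (q - 1) - u powr (q - 1)))"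
      using assms by (simp add: add_divide_distrib)
    finally have le: "v powr q \<le> u powr q + q / (q - 1) * (v * (v powr (q - 1) - u powr (q - 1)))" .
    have nn: "0 \<le> v powr (q - 1) - u powr (q - 1)"
      using assms u uv powr_mono2[of "q - 1" u v] by simp
    have "ennreal (v powr q) \<le> ennreal (u powr q + q / (q - 1) * (v * (v powr (q - 1) - u powr (q - 1))))"
      using le by (rule ennreal_leI)
    also have "\<dots> = ennreal (u powr q) + ?c * (ennreal v * ennreal (v powr (q - 1) - u powr (q - 1)))"
      using assms nn v
      by (subst ennreal_plus, simp, simp, subst ennreal_mult, simp, simp, subst ennreal_mult) auto
    finally show ?thesis
      using u v unfolding eq by (simp add: ennreal_minus)
  qed
  have "ennreal_powr (running_max a (Suc N)) q
      \<le> ?c * (\<Sum>m\<le>N. a m * increment ?Z m) + ?c * (a (Suc N) * (?Z (Suc N) - ?Z N))"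
    using step add_right_mono[OF Suc.IH] by (rule order_trans)
  then show ?case
    by (simp add: distrib_left)
qed

text \<open>Split at y = 2 c h. Below the threshold \<open>y\<close> is replaced by 2 c h, above it
  c h is at most y / 2. The factor 1/2 leaves room to absorb the last term into a left-hand
  side.\<close>

lemma powr_absorb:
  fixes h y :: ennreal
  assumes q: "1 < q" and c: "1 \<le> c"
  shows "ennreal c * (h * ennreal_powr y (q - 1))
    \<le> ennreal ((2 * c) powr q) * ennreal_powr h q + ennreal (1 / 2) * ennreal_powr y q"
proof -
  have split: "x * ennreal_powr x (q - 1) = ennreal_powr x q" for x
    using ennreal_powr_add[of x 1 "q - 1"] by simp
  have c2: "ennreal c \<le> ennreal (2 * c)" using c by (intro ennreal_leI) auto
  show ?thesis
  proof (cases "y \<le> ennreal (2 * c) * h")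
    case True
    have "ennreal c * (h * ennreal_powr y (q - 1)) \<le> ennreal (2 * c) * h * ennreal_powr (ennreal (2 * c) * h) (q - 1)"
      unfolding mult.assoc[symmetric]
      using True q c2 by (intro mult_mono ennreal_powr_mono) auto
    also have "\<dots> = ennreal_powr (ennreal (2 * c) * h) q" by (rule split)
    also have "\<dots> = ennreal ((2 * c) powr q) * ennreal_powr h q"
      using q c by (subst ennreal_powr_mult) auto
    finally show ?thesis by (metis add_increasing2 zero_le)
  next
    case False
    have "ennreal c * h = ennreal (1 / 2) * (ennreal (2 * c) * h)"
      using c by (simp add: ennreal_mult[symmetric] mult.assoc[symmetric] del: ennreal_half)
    also have "\<dots> \<le> ennreal (1 / 2) * y"
      using False by (intro mult_left_mono) auto
    finally have "ennreal c * h * ennreal_powr y (q - 1) \<le> ennreal (1 / 2) * y * ennreal_powr y (q - 1)"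
      by (intro mult_right_mono) auto
    then have "ennreal c * (h * ennreal_powr y (q - 1)) \<le> ennreal (1 / 2) * ennreal_powr y q"
      by (simp only: mult.assoc split)
    then show ?thesis by (metis add_increasing zero_le)
  qed
qed

text \<open>The cells of level \<open>m\<close> are the classes of the equivalence relation \<open>R m\<close>; this is a
  filtration without sigma-algebras.\<close>

locale nested_cells = sigma_finite_measure M for M :: "'a measure" +
  fixes R :: "nat \<Rightarrow> 'a \<Rightarrow> 'a \<Rightarrow> bool"
  assumes space_eq: "space M = UNIV"
    and R_refl: "R m x x"
    and R_sym: "R m x y \<Longrightarrow> R m y x"
    and R_trans: "R m x y \<Longrightarrow> R m y z \<Longrightarrow> R m x z"
    and R_nested: "R (Suc m) x y \<Longrightarrow> R m x y"
    and R_measurable: "{z. R m (fst z) (snd z)} \<in> sets (M \<Otimes>\<^sub>M M)"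
    and cell_nonnull: "emeasure M {y. R m x y} \<noteq> 0"
    and cell_finite: "emeasure M {y. R m x y} \<noteq> top"
begin

definition cell_avg :: "nat \<Rightarrow> ('a \<Rightarrow> ennreal) \<Rightarrow> 'a \<Rightarrow> ennreal" where
  "cell_avg m h x = (\<integral>\<^sup>+y. h y * indicator {y. R m x y} y \<partial>M) / emeasure M {y. R m x y}"

lemma R_mono: "k \<le> m \<Longrightarrow> R m x y \<Longrightarrow> R k x y"
  by (induction rule: inc_induct) (auto intro: R_nested)

lemma cell_eq: "R m x y \<Longrightarrow> {z. R m x z} = {z. R m y z}"
  by (auto intro: R_sym R_trans)

lemma cell_avg_cong: "R m x y \<Longrightarrow> cell_avg m h x = cell_avg m h y"
  by (simp add: cell_avg_def cell_eq)

lemma cell_sets [measurable]: "{y. R m x y} \<in> sets M"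
proof -
  have "Pair x -` {z. R m (fst z) (snd z)} \<in> sets M"
    using R_measurable by (rule sets_Pair1)
  then show ?thesis by (simp add: vimage_def)
qed

lemma indicator_measurable [measurable]:
  "(\<lambda>(x, y). indicator {y. R m x y} y :: ennreal) \<in> borel_measurable (M \<Otimes>\<^sub>M M)"
proof -
  have "(indicator {z. R m (fst z) (snd z)} :: _ \<Rightarrow> ennreal) \<in> borel_measurable (M \<Otimes>\<^sub>M M)"
    using R_measurable by simp
  moreover have "(indicator {z. R m (fst z) (snd z)} :: _ \<Rightarrow> ennreal) = (\<lambda>(x, y). indicator {y. R m x y} y)"
    by (auto simp: indicator_def fun_eq_iff)
  ultimately show ?thesis by simp
qed

lemma measurable_cell_emeasure [measurable]: "(\<lambda>x. emeasure M {y. R m x y}) \<in> borel_measurable M"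
proof -
  have "(\<lambda>x. \<integral>\<^sup>+y. indicator {y. R m x y} y \<partial>M) \<in> borel_measurable M" by measurable
  then show ?thesis by simp
qed

lemma measurable_cell_avg [measurable]:
  assumes [measurable]: "h \<in> borel_measurable M"
  shows "cell_avg m h \<in> borel_measurable M"
  unfolding cell_avg_def[abs_def] by measurable

text \<open>This is the defining property of a conditional expectation. In the double integral over
  equivalent pairs, the cell measure and \<open>Z\<close> may be read off at either point; after
  exchanging the order of integration the inner integral is the measure of the cell and
  cancels.\<close>

lemma nn_integral_cell_avg_mult:
  assumes [measurable]: "h \<in> borel_measurable M" "Z \<in> borel_measurable M"
    and Z: "\<And>x y. R m x y \<Longrightarrow> Z x = Z y"
  shows "(\<integral>\<^sup>+x. cell_avg m h x * Z x \<partial>M) = (\<integral>\<^sup>+x. h x * Z x \<partial>M)"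
proof -
  interpret pair_sigma_finite M M ..
  let ?\<mu> = "\<lambda>x. emeasure M {y. R m x y}"
  have "(\<integral>\<^sup>+x. cell_avg m h x * Z x \<partial>M)
      = (\<integral>\<^sup>+x. (\<integral>\<^sup>+y. h y * indicator {y. R m x y} y * (inverse (?\<mu> x) * Z x) \<partial>M) \<partial>M)"
    by (intro nn_integral_cong, subst nn_integral_multc)
      (auto simp: cell_avg_def divide_ennreal_def mult.assoc)
  also have "\<dots> = (\<integral>\<^sup>+x. (\<integral>\<^sup>+y. h y * indicator {x. R m y x} x * (inverse (?\<mu> y) * Z y) \<partial>M) \<partial>M)"
  proof (intro nn_integral_cong)
    fix x y
    show "h y * indicator {y. R m x y} y * (inverse (?\<mu> x) * Z x)
      = h y * indicator {x. R m y x} x * (inverse (?\<mu> y) * Z y)"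
    proof (cases "R m x y")
      case True
      then show ?thesis using Z[OF True] cell_eq[OF True] R_sym[OF True] by (simp add: R_refl)
    next
      case False
      then have "\<not> R m y x" using R_sym by blast
      then show ?thesis using False by simp
    qed
  qed
  also have "\<dots> = (\<integral>\<^sup>+y. (\<integral>\<^sup>+x. h y * indicator {x. R m y x} x * (inverse (?\<mu> y) * Z y) \<partial>M) \<partial>M)"
    by (rule Fubini'[symmetric]) measurable
  also have "\<dots> = (\<integral>\<^sup>+y. h y * ?\<mu> y * (inverse (?\<mu> y) * Z y) \<partial>M)"
    by (simp add: nn_integral_cmult nn_integral_multc)
  also have "\<dots> = (\<integral>\<^sup>+y. h y * Z y \<partial>M)"
  proof (intro nn_integral_cong)
    fix y
    have "?\<mu> y * inverse (?\<mu> y) = 1"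
      using cell_nonnull cell_finite by (metis ennreal_divide_self divide_ennreal_def top.not_eq_extremum)
    then show "h y * ?\<mu> y * (inverse (?\<mu> y) * Z y) = h y * Z y"
      by (metis mult.assoc mult.right_neutral)
  qed
  finally show ?thesis .
qed

text \<open>Jensen's inequality, obtained from \<open>Holder_weighted\<close> with the indicator of
  the cell as density.\<close>

lemma cell_avg_powr_le:
  assumes [measurable]: "h \<in> borel_measurable M" and q: "1 < q"
  shows "ennreal_powr (cell_avg m h x) q \<le> cell_avg m (\<lambda>y. ennreal_powr (h y) q) x"
proof -
  let ?\<mu> = "emeasure M {y. R m x y}"
  obtain r where r: "?\<mu> = ennreal r" "0 < r"
    using cell_nonnull[of m x] cell_finite[of m x] by (cases ?\<mu>) (auto simp: order_less_le)
  have "ennreal_powr (cell_avg m h x) q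
      = ennreal_powr (\<integral>\<^sup>+y. h y * indicator {y. R m x y} y \<partial>M) q * ennreal ((1 / r) powr q)"
    using q r by (simp add: cell_avg_def divide_ennreal_def ennreal_powr_mult inverse_ennreal inverse_eq_divide)
  also have "\<dots> \<le> (\<integral>\<^sup>+y. ennreal_powr (h y) q * indicator {y. R m x y} y \<partial>M)
      * ennreal_powr (\<integral>\<^sup>+y. indicator {y. R m x y} y \<partial>M) (q - 1) * ennreal ((1 / r) powr q)"
    using q by (intro mult_right_mono Holder_weighted) auto
  also have "\<dots> = (\<integral>\<^sup>+y. ennreal_powr (h y) q * indicator {y. R m x y} y \<partial>M)
      * ennreal (r powr (q - 1) * (1 / r) powr q)"
    using r by (simp add: mult.assoc ennreal_mult)
  also have "r powr (q - 1) * (1 / r) powr q = inverse r"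
    using r by (simp add: powr_diff powr_divide field_simps)
  finally show ?thesis
    using r by (simp add: cell_avg_def divide_ennreal_def inverse_ennreal)
qed

lemma nn_integral_cell_avg_powr_le:
  assumes [measurable]: "h \<in> borel_measurable M" and q: "1 < q"
  shows "(\<integral>\<^sup>+x. ennreal_powr (cell_avg m h x) q \<partial>M) \<le> (\<integral>\<^sup>+x. ennreal_powr (h x) q \<partial>M)"
proof -
  have "(\<integral>\<^sup>+x. ennreal_powr (cell_avg m h x) q \<partial>M)
      \<le> (\<integral>\<^sup>+x. cell_avg m (\<lambda>y. ennreal_powr (h y) q) x \<partial>M)"
    by (intro nn_integral_mono cell_avg_powr_le q) auto
  also have "\<dots> = (\<integral>\<^sup>+x. ennreal_powr (h x) q \<partial>M)"
    using nn_integral_cell_avg_mult[of "\<lambda>y. ennreal_powr (h y) q" "\<lambda>_. 1" m] by simp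
  finally show ?thesis .
qed

lemma cell_avg_less_top:
  assumes [measurable]: "h \<in> borel_measurable M" and q: "1 < q"
    and fin: "(\<integral>\<^sup>+x. ennreal_powr (h x) q \<partial>M) < top"
  shows "cell_avg m h x < top"
proof -
  have "(\<integral>\<^sup>+y. ennreal_powr (h y) q * indicator {y. R m x y} y \<partial>M) < top"
    by (rule order_le_less_trans[OF nn_integral_mono fin]) (auto simp: indicator_def)
  then have "cell_avg m (\<lambda>y. ennreal_powr (h y) q) x < top"
    using cell_nonnull[of m x] by (auto simp: cell_avg_def ennreal_divide_eq_top_iff less_top[symmetric])
  then show ?thesis
    using cell_avg_powr_le[of h q m x] q by (metis assms(1) ennreal_powr_less_top order_le_less_trans)
qed

text \<open>Doob's L^q inequality. Integrate the pathwise estimate up to a level \<open>N\<close>,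
  replace each average by \<open>h\<close>, let the increments telescope, absorb half of the
  left-hand side, and let \<open>N\<close> tend to infinity. The constant does not depend on the
  measure, which is what makes it usable for weights.\<close>

theorem maximal_inequality:
  assumes h [measurable]: "h \<in> borel_measurable M" and q: "1 < q"
  shows "(\<integral>\<^sup>+x. ennreal_powr (SUP m. cell_avg m h x) q \<partial>M)
    \<le> ennreal (2 * (2 * (q / (q - 1))) powr q) * (\<integral>\<^sup>+x. ennreal_powr (h x) q \<partial>M)"
    (is "_ \<le> ?C * ?H")
proof (cases "?H = top")
  case True
  have "?C \<noteq> 0" using q by simp
  then show ?thesis using True by (simp add: ennreal_mult_top)
next
  case False
  then have fin: "?H < top" by (simp add: less_top)
  let ?X = "\<lambda>x m. cell_avg m h x"
  let ?Y = "\<lambda>x. running_max (?X x)"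
  define c where "c = q / (q - 1)"
  have c: "1 \<le> c" using q by (simp add: c_def)
  have Xfin: "?X x m < top" for x m
    using cell_avg_less_top[OF h q fin] .
  have bound: "(\<integral>\<^sup>+x. ennreal_powr (?Y x N) q \<partial>M) \<le> ?C * ?H" for N
  proof -
    let ?Z = "\<lambda>x k. ennreal_powr (?Y x k) (q - 1)"
    let ?I = "\<integral>\<^sup>+x. ennreal_powr (?Y x N) q \<partial>M"
    have W [measurable]: "(\<lambda>x. increment (?Z x) m) \<in> borel_measurable M" for m
      by (cases m) auto
    \<comment> \<open>The increment at level \<open>m\<close> involves only averages of levels at
      most \<open>m\<close>, and these are constant on the cells of level \<open>m\<close> by
      nesting.\<close>
    have Wcong: "increment (?Z x) m = increment (?Z y) m" if "R m x y" for x y m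
    proof -
      have "running_max (?X x) k = running_max (?X y) k" if "k \<le> m" for k
        using \<open>R m x y\<close> that by (intro running_max_cong cell_avg_cong) (auto intro: R_mono)
      from this[of m] this[of "m - 1"] this[of 0] show ?thesis
        by (simp add: increment_def del: running_max.simps)
    qed
    have Wsum: "(\<Sum>m\<le>N. increment (?Z x) m) = ?Z x N" for x
    proof (rule sum_increment)
      show "incseq (?Z x)" using q incseq_running_max[of "?X x"]
        by (auto simp: incseq_def intro!: ennreal_powr_mono)
    qed (auto intro: running_max_less_top Xfin)
    have "?I \<le> (\<integral>\<^sup>+x. ennreal c * (\<Sum>m\<le>N. ?X x m * increment (?Z x) m) \<partial>M)"
      unfolding c_def by (intro nn_integral_mono running_max_powr_le q Xfin)
    also have "\<dots> = ennreal c * (\<Sum>m\<le>N. \<integral>\<^sup>+x. ?X x m * increment (?Z x) m \<partial>M)"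
      by (simp add: nn_integral_cmult nn_integral_sum)
    also have "\<dots> = ennreal c * (\<Sum>m\<le>N. \<integral>\<^sup>+x. h x * increment (?Z x) m \<partial>M)"
      by (subst nn_integral_cell_avg_mult) (auto intro: Wcong)
    also have "\<dots> = (\<integral>\<^sup>+x. ennreal c * (h x * (\<Sum>m\<le>N. increment (?Z x) m)) \<partial>M)"
      by (simp add: nn_integral_cmult nn_integral_sum sum_distrib_left)
    also have "\<dots> \<le> (\<integral>\<^sup>+x. ennreal ((2 * c) powr q) * ennreal_powr (h x) q
        + ennreal (1 / 2) * ennreal_powr (?Y x N) q \<partial>M)"
      unfolding Wsum by (intro nn_integral_mono powr_absorb q c)
    also have "\<dots> = ennreal ((2 * c) powr q) * ?H + ennreal (1 / 2) * ?I"
      by (simp add: nn_integral_add nn_integral_cmult del: ennreal_half)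
    finally have absorb: "?I \<le> ennreal ((2 * c) powr q) * ?H + ennreal (1 / 2) * ?I" .
    \<comment> \<open>Half of \<open>?I\<close> can be subtracted only once \<open>?I\<close> is
      known to be finite; up to level \<open>N\<close> the maximum is bounded by a finite sum of
      integrable powers.\<close>
    have "?I \<le> (\<integral>\<^sup>+x. (\<Sum>m\<le>N. ennreal_powr (?X x m) q) \<partial>M)"
    proof (intro nn_integral_mono)
      fix x
      obtain k where "k \<le> N" "?Y x N = ?X x k" using running_max_mem by blast
      then show "ennreal_powr (?Y x N) q \<le> (\<Sum>m\<le>N. ennreal_powr (?X x m) q)"
        by (auto intro!: member_le_sum)
    qed
    also have "\<dots> = (\<Sum>m\<le>N. \<integral>\<^sup>+x. ennreal_powr (?X x m) q \<partial>M)"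
      by (simp add: nn_integral_sum)
    also have "\<dots> \<le> (\<Sum>m\<le>N. ?H)"
      by (intro sum_mono nn_integral_cell_avg_powr_le h q)
    also have "\<dots> < top" using fin by (simp add: ennreal_mult_less_top of_nat_less_top)
    finally obtain i where i: "?I = ennreal i" "0 \<le> i" by (meson less_top_ennreal)
    obtain H where H: "?H = ennreal H" "0 \<le> H" using fin by (meson less_top_ennreal)
    have "ennreal i \<le> ennreal ((2 * c) powr q * H + 1 / 2 * i)"
      using absorb unfolding i(1) H(1)
      using i(2) H(2) ennreal_mult[of "(2 * c) powr q" H] ennreal_mult[of "1 / 2" i] by (subst ennreal_plus) auto
    then have "i \<le> (2 * c) powr q * H + 1 / 2 * i"
      using i(2) H(2) by (subst (asm) ennreal_le_iff) auto
    then have "i \<le> 2 * (2 * c) powr q * H" by simp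
    then have "ennreal i \<le> ennreal (2 * (2 * c) powr q) * ennreal H"
      using H(2) by (subst ennreal_mult[symmetric]) (auto intro!: ennreal_leI)
    then show ?thesis unfolding i(1) H(1) c_def .
  qed
  have "(\<integral>\<^sup>+x. ennreal_powr (SUP m. ?X x m) q \<partial>M) = (\<integral>\<^sup>+x. (SUP m. ennreal_powr (?Y x m) q) \<partial>M)"
    using q by (subst SUP_running_max[symmetric]) (simp add: ennreal_powr_SUP)
  also have "\<dots> = (SUP m. \<integral>\<^sup>+x. ennreal_powr (?Y x m) q \<partial>M)"
    using q by (intro nn_integral_monotone_convergence_SUP)
      (auto simp: incseq_def le_fun_def intro!: ennreal_powr_mono incseqD[OF incseq_running_max])
  also have "\<dots> \<le> ?C * ?H"
    by (intro SUP_least bound)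
  finally show ?thesis .
qed

end

section \<open>Weights on balls\<close>

lemma infnorm_less_iff: "infnorm (x :: real^'n) < r \<longleftrightarrow> (\<forall>i. \<bar>x $ i\<bar> < r)"
proof
  assume r: "\<forall>i. \<bar>x $ i\<bar> < r"
  have eq: "{\<bar>x $ i\<bar> |i. i \<in> UNIV} = range (\<lambda>i. \<bar>x $ i\<bar>)" by auto
  have "Max (range (\<lambda>i. \<bar>x $ i\<bar>)) < r" using r by (subst Max_less_iff) auto
  then show "infnorm x < r"
    unfolding infnorm_cart eq by (simp add: cSup_eq_Max)
qed (use component_le_infnorm_cart order_le_less_trans in blast)

text \<open>Indexing cubes by centre instead of corner makes membership symmetric in the two points,
  which every exchange of integrals below relies on.\<close>

definition iball :: "real^'n \<Rightarrow> real \<Rightarrow> (real^'n) set" where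
  "iball x r = {y. infnorm (x - y) < r}"

lemma mem_iball: "y \<in> iball x r \<longleftrightarrow> (\<forall>i. \<bar>x $ i - y $ i\<bar> < r)"
  by (simp add: iball_def infnorm_less_iff)

lemma iball_sym: "y \<in> iball x r \<longleftrightarrow> x \<in> iball y r"
  by (simp add: mem_iball abs_minus_commute)

lemma iball_triangle: "y \<in> iball x r \<Longrightarrow> z \<in> iball y t \<Longrightarrow> z \<in> iball x (r + t)"
  using infnorm_triangle[of "x - y" "y - z"] by (simp add: iball_def)

lemma iball_eq_cube: "iball x r = cube (\<chi> i. x $ i - r) (2 * r)"
  by (auto simp: mem_iball cube_def mem_box_cart abs_less_iff algebra_simps; smt (verit))

lemma open_iball: "open (iball x r)"
  unfolding iball_eq_cube cube_def by (rule open_box)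

lemma sets_iball [measurable]: "iball x r \<in> sets borel"
  using open_iball by (rule borel_open)

lemma emeasure_lborel_vec_box:
  fixes a :: "real^'n"
  assumes "0 \<le> l"
  shows "emeasure lborel (box a (\<chi> i. a $ i + l)) = ennreal (l ^ CARD('n))"
    and "emeasure lborel (cbox a (\<chi> i. a $ i + l)) = ennreal (l ^ CARD('n))"
proof -
  have le: "a \<bullet> b \<le> (\<chi> i. a $ i + l) \<bullet> b" and eq: "((\<chi> i. a $ i + l) - a) \<bullet> b = l"
    if "b \<in> Basis" for b
    using that assms by (auto simp: Basis_vec_def inner_axis)
  show "emeasure lborel (box a (\<chi> i. a $ i + l)) = ennreal (l ^ CARD('n))"
    using le eq by (subst emeasure_lborel_box) auto
  show "emeasure lborel (cbox a (\<chi> i. a $ i + l)) = ennreal (l ^ CARD('n))"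
    using le eq by (subst emeasure_lborel_cbox) auto
qed

lemma emeasure_cube: "0 \<le> l \<Longrightarrow> emeasure lborel (cube (a :: real^'n) l) = ennreal (l ^ CARD('n))"
  unfolding cube_def by (rule emeasure_lborel_vec_box)

lemma emeasure_iball: "0 \<le> r \<Longrightarrow> emeasure lborel (iball (x :: real^'n) r) = ennreal ((2 * r) ^ CARD('n))"
  by (simp add: iball_eq_cube emeasure_cube)

definition mass :: "(real^'n \<Rightarrow> ennreal) \<Rightarrow> (real^'n) set \<Rightarrow> ennreal" where
  "mass u A = (\<integral>\<^sup>+y. u y * indicator A y \<partial>lborel)"

lemma mass_mono: "A \<subseteq> B \<Longrightarrow> mass u A \<le> mass u B"
  unfolding mass_def by (intro nn_integral_mono mult_left_mono) (auto simp: indicator_def)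

lemma mass_cover:
  assumes "finite I" "A \<subseteq> (\<Union>i\<in>I. B i)"
    and [measurable]: "u \<in> borel_measurable borel" "\<And>i. B i \<in> sets borel"
  shows "mass u A \<le> (\<Sum>i\<in>I. mass u (B i))"
proof -
  have "mass u A \<le> (\<integral>\<^sup>+y. (\<Sum>i\<in>I. u y * indicator (B i) y) \<partial>lborel)"
    unfolding mass_def
  proof (intro nn_integral_mono)
    fix y
    have "indicator A y \<le> (\<Sum>i\<in>I. indicator (B i) y :: ennreal)"
    proof (cases "y \<in> A")
      case True
      then obtain i where "i \<in> I" "y \<in> B i" using assms by auto
      then show ?thesis
        using assms(1) True member_le_sum[of i I "\<lambda>i. indicator (B i) y :: ennreal"] by simp
    qed simp
    then show "u y * indicator A y \<le> (\<Sum>i\<in>I. u y * indicator (B i) y)"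
      by (simp add: sum_distrib_left[symmetric] mult_left_mono)
  qed
  also have "\<dots> = (\<Sum>i\<in>I. mass u (B i))"
    unfolding mass_def by (rule nn_integral_sum) measurable
  finally show ?thesis .
qed

lemma mass_pos:
  assumes "u \<in> borel_measurable borel" "\<And>y. u y \<noteq> 0" "A \<in> sets borel" "emeasure lborel A \<noteq> 0"
  shows "mass u A \<noteq> 0"
proof
  assume "mass u A = 0"
  then have "AE y in lborel. u y * indicator A y = 0"
    using assms(1,3) unfolding mass_def by (subst (asm) nn_integral_0_iff_AE) auto
  then have "AE y in lborel. y \<notin> A"
    by eventually_elim (use assms(2) in \<open>auto simp: indicator_def split: if_splits\<close>)
  then show False using assms(3,4) by (simp add: AE_iff_measurable[OF _ refl] )
qed

text \<open>The A_p condition with the volumes moved to the right: |Q|^p is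
  \<open>r powr (n * p)\<close> up to the factor 2^(n p), which goes into \<open>K\<close>.\<close>

definition Ap_balls :: "real \<Rightarrow> (real^'n \<Rightarrow> real) \<Rightarrow> real \<Rightarrow> real \<Rightarrow> bool" where
  "Ap_balls p v R K \<longleftrightarrow> (\<forall>x r. 0 < r \<and> r \<le> R \<longrightarrow>
     mass (\<lambda>y. ennreal (v y)) (iball x r)
       * ennreal_powr (mass (\<lambda>y. ennreal (dual_weight p v y)) (iball x r)) (p - 1)
     \<le> ennreal (K * r powr (real CARD('n) * p)))"

text \<open>A Borel weight that is positive everywhere, so that its dual weight is a genuine
  reciprocal power at every point and \<open>s\<close> can be divided by.\<close>

locale pos_weight =
  fixes p :: real and v :: "real^'n \<Rightarrow> real"
  assumes p: "1 < p" and v_measurable [measurable]: "v \<in> borel_measurable borel"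
    and v_pos: "0 < v x"
    and v_finite: "mass (\<lambda>y. ennreal (v y)) (iball x r) < top"
begin

definition "w x = ennreal (v x)"
definition "s x = ennreal (dual_weight p v x)"

lemma dual_measurable [measurable]: "dual_weight p v \<in> borel_measurable borel"
  unfolding dual_weight_def[abs_def] by measurable

lemma w_measurable [measurable]: "w \<in> borel_measurable borel"
  unfolding w_def[abs_def] by measurable

lemma s_measurable [measurable]: "s \<in> borel_measurable borel"
  unfolding s_def[abs_def] by measurable

lemma dual_pos: "0 < dual_weight p v x"
  using v_pos[of x] by (simp add: dual_weight_def)

lemma w_nz: "w x \<noteq> 0" and s_nz: "s x \<noteq> 0"
  using v_pos[of x] dual_pos[of x] by (simp_all add: w_def s_def)

text \<open>The exponents satisfy -p/(p-1) + 1 = -1/(p-1), that is, s^p w = s. This is the isometry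
  between L^p(s) and L^p(w).\<close>

lemma w_mult_powr: "0 \<le> t \<Longrightarrow> ennreal ((t * dual_weight p v x) powr p) * w x = ennreal (t powr p) * s x"
proof -
  assume t: "0 \<le> t"
  have "dual_weight p v x powr p * v x = v x powr (- (p / (p - 1)) + 1)"
    using v_pos[of x] by (subst powr_add) (simp add: dual_weight_def powr_powr)
  also have "- (p / (p - 1)) + 1 = - (1 / (p - 1))" using p by (simp add: field_simps)
  finally have "dual_weight p v x powr p * v x = dual_weight p v x" by (simp add: dual_weight_def)
  then show ?thesis
    using t v_pos[of x] dual_pos[of x]
    by (simp add: w_def s_def powr_mult ennreal_mult[symmetric] mult.assoc)
qed

lemma w_mult_ennreal_powr:
  fixes t :: ennreal
  shows "ennreal_powr (t * s x) p * w x = ennreal_powr t p * s x"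
proof (cases t)
  case (real r)
  then show ?thesis using w_mult_powr[of r x] dual_pos[of x]
    by (simp add: s_def ennreal_mult[symmetric])
qed (use w_nz s_nz in \<open>auto simp: ennreal_top_mult\<close>)

text \<open>Hoelder's inequality for 1 = (1/s) * s: the A_p product is never smaller than |Q|^p.
  Together with the A_p upper bound this makes the masses of comparable cubes comparable.\<close>

lemma ball_powr_le:
  assumes "0 \<le> r"
  shows "ennreal ((2 * r) powr (real CARD('n) * p)) \<le> mass w (iball x r) * ennreal_powr (mass s (iball x r)) (p - 1)"
proof -
  define g where "g y = ennreal (1 / dual_weight p v y)" for y
  have g [measurable]: "g \<in> borel_measurable borel" unfolding g_def[abs_def] by measurable
  have gs: "g y * s y = 1" for y
    using dual_pos[of y] by (simp add: g_def s_def ennreal_mult[symmetric])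
  have gps: "ennreal_powr (g y) p * s y = w y" for y
    using w_mult_ennreal_powr[of "g y" y] by (simp add: gs)
  have "ennreal_powr (\<integral>\<^sup>+y. g y * (s y * indicator (iball x r) y) \<partial>lborel) p
    \<le> (\<integral>\<^sup>+y. ennreal_powr (g y) p * (s y * indicator (iball x r) y) \<partial>lborel)
      * ennreal_powr (\<integral>\<^sup>+y. s y * indicator (iball x r) y \<partial>lborel) (p - 1)"
    using p by (intro Holder_weighted) auto
  then have "ennreal_powr (emeasure lborel (iball x r)) p
    \<le> mass w (iball x r) * ennreal_powr (mass s (iball x r)) (p - 1)"
    by (simp add: mult.assoc[symmetric] gs gps mass_def)
  moreover have "ennreal_powr (emeasure lborel (iball x r)) p = ennreal ((2 * r) powr (real CARD('n) * p))"
  proof (cases "r = 0")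
    case False
    have "((2 * r) ^ CARD('n)) powr p = ((2 * r) powr real CARD('n)) powr p"
      using False assms by (subst powr_realpow) auto
    then show ?thesis
      using assms by (simp only: emeasure_iball powr_powr ennreal_powr_ennreal zero_le_power)
  qed (use p in \<open>simp add: emeasure_iball\<close>)
  ultimately show ?thesis by simp
qed

text \<open>A ball of radius \<open>r\<close> is covered by the \<open>2 ^ n\<close> balls of radius \<open>3 r / 4\<close> centred at
  \<open>x + (r / 4) \<epsilon>\<close>, \<open>\<epsilon> \<in> {-1, 1} ^ n\<close>, which all contain the ball of radius \<open>r / 2\<close> about \<open>x\<close>.\<close>

lemma Ap_balls_enlarge:
  assumes Ap: "Ap_balls p v R K" and K: "0 \<le> K"
  shows "\<exists>K'\<ge>0. Ap_balls p v (4 / 3 * R) K'"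
proof -
  define c where "c S = (\<chi> i. if i \<in> S then 1 / 4 else - (1 / 4 :: real))" for S :: "'n set"
  define b where "b = real (card (UNIV :: 'n set set))"
  have b: "1 \<le> b" unfolding b_def by (simp add: Suc_le_eq card_gt_0_iff)
  \<comment> \<open>One factor for each of the comparisons \<open>wA\<close>, \<open>sA\<close> and
    \<open>upC\<close>. The balls of the covering have radius 3 r / 4, which is at most
    \<open>R\<close> as r <= 4 R / 3.\<close>
  define K' where "K' = b * K * (b powr (p - 1) * K) * K"
  have "Ap_balls p v (4 / 3 * R) K'"
    unfolding Ap_balls_def
  proof (intro allI impI)
    fix x :: "real^'n" and r :: real
    assume r: "0 < r \<and> r \<le> 4 / 3 * R"
    define A where "A = iball x r"
    define C where "C = iball x (r / 2)"
    define B where "B S = iball (x + r *\<^sub>R c S) (3 * r / 4)" for S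
    have cov: "A \<subseteq> (\<Union>S\<in>UNIV. B S)"
    proof
      fix y assume y: "y \<in> A"
      define S where "S = {i. x $ i \<le> y $ i}"
      have "\<bar>x $ i + r * c S $ i - y $ i\<bar> < 3 * r / 4" for i
      proof -
        have "\<bar>x $ i - y $ i\<bar> < r" using y by (auto simp: A_def mem_iball)
        moreover have "(x $ i \<le> y $ i \<and> r * c S $ i = r / 4) \<or> (y $ i < x $ i \<and> r * c S $ i = - (r / 4))"
          by (auto simp: S_def c_def)
        ultimately show ?thesis using r by arith
      qed
      then have "y \<in> B S" by (simp add: B_def mem_iball)
      then show "y \<in> (\<Union>S\<in>UNIV. B S)" by blast
    qed
    have sub: "C \<subseteq> B S" for S
    proof
      fix y assume y: "y \<in> C"
      have "\<bar>x $ i + r * c S $ i - y $ i\<bar> < 3 * r / 4" for i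
      proof -
        have "\<bar>x $ i - y $ i\<bar> < r / 2" using y by (auto simp: C_def mem_iball)
        moreover have "r * c S $ i = r / 4 \<or> r * c S $ i = - (r / 4)" by (simp add: c_def)
        ultimately show ?thesis using r by arith
      qed
      then show "y \<in> B S" by (simp add: B_def mem_iball)
    qed
    define e where "e = ennreal (r powr (real CARD('n) * p))"
    have e: "e \<noteq> 0" "e \<noteq> top" using r by (auto simp: e_def)
    let ?P = "\<lambda>A. ennreal_powr (mass s A) (p - 1)"
    have lowC: "e \<le> mass w C * ?P C"
      using ball_powr_le[of "r / 2" x] r by (simp add: e_def C_def)
    have upC: "mass w C * ?P C \<le> ennreal K * e"
    proof -
      have "mass w C * ?P C \<le> ennreal (K * (r / 2) powr (real CARD('n) * p))"
        using Ap r unfolding Ap_balls_def C_def w_def[abs_def] s_def[abs_def] by auto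
      also have "\<dots> \<le> ennreal (K * r powr (real CARD('n) * p))"
        using K r p by (intro ennreal_leI mult_left_mono powr_mono2) auto
      finally show ?thesis using K by (simp add: e_def ennreal_mult)
    qed
    have upB: "mass w (B S) * ?P (B S) \<le> ennreal K * e" for S
    proof -
      have "mass w (B S) * ?P (B S) \<le> ennreal (K * (3 * r / 4) powr (real CARD('n) * p))"
        using Ap r unfolding Ap_balls_def B_def w_def[abs_def] s_def[abs_def] by auto
      also have "\<dots> \<le> ennreal (K * r powr (real CARD('n) * p))"
        using K r p by (intro ennreal_leI mult_left_mono powr_mono2) auto
      finally show ?thesis using K by (simp add: e_def ennreal_mult)
    qed
    have cancel: "y \<le> ennreal K * z" if "e * y \<le> z * (ennreal K * e)" for y z
    proof -
      have "inverse e * (e * y) \<le> inverse e * (z * (ennreal K * e))"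
        using that by (rule mult_left_mono) simp
      moreover have "inverse e * e = 1"
        using e by (metis divide_ennreal_def ennreal_divide_self mult.commute top.not_eq_extremum)
      ultimately show ?thesis
        by (metis mult.assoc mult.commute mult_1)
    qed
    \<comment> \<open>Doubling without dividing by masses: bound \<open>e\<close> below the A_p
      product of \<open>C\<close>, enlarge \<open>s\<close> from \<open>C\<close> to
      \<open>B S\<close>, apply the A_p condition on \<open>B S\<close>, and cancel
      \<open>e\<close>.\<close>
    have wB: "mass w (B S) \<le> ennreal K * mass w C" for S
    proof (rule cancel)
      have "e * mass w (B S) \<le> mass w C * ?P C * mass w (B S)"
        using lowC by (rule mult_right_mono) simp
      also have "\<dots> \<le> mass w C * ?P (B S) * mass w (B S)"
        using p sub by (intro mult_right_mono mult_left_mono ennreal_powr_mono mass_mono) auto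
      also have "\<dots> \<le> mass w C * (ennreal K * e)"
        using upB[of S] by (simp add: mult.assoc mult.commute[of "?P (B S)"] mult_left_mono)
      finally show "e * mass w (B S) \<le> mass w C * (ennreal K * e)" .
    qed
    have sB: "?P (B S) \<le> ennreal K * ?P C" for S
    proof (rule cancel)
      have "e * ?P (B S) \<le> mass w C * ?P C * ?P (B S)"
        using lowC by (rule mult_right_mono) simp
      also have "\<dots> \<le> mass w (B S) * ?P C * ?P (B S)"
        using sub by (intro mult_right_mono mass_mono) auto
      also have "\<dots> = ?P C * (mass w (B S) * ?P (B S))" by (simp add: mult_ac)
      also have "\<dots> \<le> ?P C * (ennreal K * e)"
        by (intro mult_left_mono upB) simp
      finally show "e * ?P (B S) \<le> ?P C * (ennreal K * e)" .
    qed
    have wA: "mass w A \<le> ennreal (b * K) * mass w C"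
    proof -
      have "mass w A \<le> (\<Sum>S\<in>UNIV. mass w (B S))"
        using cov by (intro mass_cover) (auto simp: B_def)
      also have "\<dots> \<le> (\<Sum>S\<in>(UNIV :: 'n set set). ennreal K * mass w C)"
        by (intro sum_mono wB)
      also have "\<dots> = ennreal (b * K) * mass w C"
        using K by (simp add: b_def ennreal_mult ennreal_of_nat_eq_real_of_nat mult.assoc)
      finally show ?thesis .
    qed
    have sA: "?P A \<le> ennreal (b powr (p - 1) * K) * ?P C"
    proof -
      \<comment> \<open>The exponent p - 1 may be less than 1, so the sum over the covering is
        bounded through its largest term before the power is taken.\<close>
      define T where "T = Max (range (\<lambda>S. mass s (B S)))"
      have "T \<in> range (\<lambda>S. mass s (B S))" unfolding T_def by (intro Max_in) auto
      then obtain S where S: "T = mass s (B S)" by auto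
      have "mass s A \<le> (\<Sum>S\<in>UNIV. mass s (B S))"
        using cov by (intro mass_cover) (auto simp: B_def)
      also have "\<dots> \<le> (\<Sum>S\<in>(UNIV :: 'n set set). T)"
        by (intro sum_mono) (auto simp: T_def)
      also have "\<dots> = ennreal b * T"
        by (simp add: b_def ennreal_of_nat_eq_real_of_nat)
      finally have "?P A \<le> ennreal_powr (ennreal b * T) (p - 1)"
        using p by (intro ennreal_powr_mono) auto
      also have "\<dots> = ennreal (b powr (p - 1)) * ?P (B S)"
        using p b by (simp add: ennreal_powr_mult S)
      also have "\<dots> \<le> ennreal (b powr (p - 1)) * (ennreal K * ?P C)"
        by (intro mult_left_mono sB) simp
      also have "\<dots> = ennreal (b powr (p - 1) * K) * ?P C"
        using K by (simp add: ennreal_mult mult.assoc)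
      finally show ?thesis .
    qed
    have "mass w A * ?P A \<le> (ennreal (b * K) * mass w C) * (ennreal (b powr (p - 1) * K) * ?P C)"
      by (intro mult_mono wA sA) auto
    also have "\<dots> = ennreal (b * K) * ennreal (b powr (p - 1) * K) * (mass w C * ?P C)"
      by (simp add: mult_ac)
    also have "\<dots> \<le> ennreal (b * K) * ennreal (b powr (p - 1) * K) * (ennreal K * e)"
      by (intro mult_left_mono upC) simp
    also have "\<dots> = ennreal (K' * r powr (real CARD('n) * p))"
      using K b unfolding K'_def e_def by (simp add: ennreal_mult mult.assoc)
    finally show "mass (\<lambda>y. ennreal (v y)) (iball x r)
       * ennreal_powr (mass (\<lambda>y. ennreal (dual_weight p v y)) (iball x r)) (p - 1)
     \<le> ennreal (K' * r powr (real CARD('n) * p))"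
      by (simp add: A_def w_def[abs_def] s_def[abs_def])
  qed
  moreover have "0 \<le> K'" using K b by (simp add: K'_def)
  ultimately show ?thesis by blast
qed

text \<open>Iterating the enlargement reaches any scale, with a constant that depends on R' / R. It
  serves only to prove finiteness and does not enter the final constant.\<close>

lemma Ap_balls_scale:
  assumes "Ap_balls p v R K" "0 \<le> K" "0 < R"
  shows "\<exists>K'\<ge>0. Ap_balls p v R' K'"
proof -
  have iter: "\<exists>K'\<ge>0. Ap_balls p v ((4 / 3) ^ k * R) K'" for k
  proof (induction k)
    case (Suc k)
    then show ?case using Ap_balls_enlarge by (fastforce simp: mult.assoc)
  qed (use assms in auto)
  obtain k where "R' / R < (4 / 3) ^ k" using real_arch_pow[of "4 / 3"] by force
  then have "R' \<le> (4 / 3) ^ k * R" using assms by (simp add: field_simps)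
  moreover obtain K' where "K' \<ge> 0" "Ap_balls p v ((4 / 3) ^ k * R) K'" using iter by blast
  ultimately show ?thesis unfolding Ap_balls_def by (meson order_trans)
qed

end

text \<open>A weight is a pointwise limit of its truncations to balls, hence Lebesgue measurable. On
  the null set where a Borel representative fails to be positive it is given the value 1.\<close>

lemma weight_borel_version:
  fixes \<omega> :: "real^'n \<Rightarrow> real"
  assumes "is_weight \<omega>"
  obtains v where "v \<in> borel_measurable borel" "\<And>x. 0 < v x" "AE x in lborel. \<omega> x = v x"
proof -
  have "(\<lambda>x. indicator (cball 0 (real k)) x *\<^sub>R \<omega> x) \<in> borel_measurable lebesgue" for k :: nat
  proof -
    have "\<omega> absolutely_integrable_on cball 0 (real k)"
      using assms by (simp add: is_weight_def)
    then show ?thesis unfolding set_integrable_def by (rule borel_measurable_integrable)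
  qed
  moreover have "(\<lambda>k. indicator (cball 0 (real k)) x *\<^sub>R \<omega> x) \<longlonglongrightarrow> \<omega> x" for x
  proof (rule tendsto_eventually)
    obtain k0 where "norm x \<le> real k0" using real_arch_simple by blast
    then show "\<forall>\<^sub>F k in sequentially. indicator (cball 0 (real k)) x *\<^sub>R \<omega> x = \<omega> x"
      by (intro eventually_sequentiallyI[of k0]) (auto simp: indicator_def)
  qed
  ultimately have "\<omega> \<in> borel_measurable lebesgue"
    by (rule borel_measurable_LIMSEQ_metric)
  then obtain u where u: "u \<in> borel_measurable lborel" "AE x in lborel. \<omega> x = u x"
    using completion_ex_borel_measurable_real by blast
  have [measurable]: "u \<in> borel_measurable borel" using u(1) by simp
  have pos: "AE x in lborel. 0 < \<omega> x"
    using assms by (simp add: is_weight_def AE_completion_iff)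
  have "(\<lambda>x. if 0 < u x then u x else 1) \<in> borel_measurable borel" by measurable
  moreover have "AE x in lborel. \<omega> x = (if 0 < u x then u x else 1)"
    using pos u(2) by eventually_elim auto
  ultimately show thesis by (intro that[of "\<lambda>x. if 0 < u x then u x else 1"]) auto
qed

lemma average_cube:
  fixes g :: "real^'n \<Rightarrow> real"
  assumes "0 < l" "AE x in lborel. g x = u x"
  shows "average (cube a l) g = mass (\<lambda>y. ennreal (u y)) (cube a l) * ennreal (l powr - real CARD('n))"
proof -
  have m: "cube a l \<in> sets lborel" by (simp add: cube_def)
  have "(\<integral>\<^sup>+x\<in>cube a l. ennreal (g x) \<partial>lborel) = mass (\<lambda>y. ennreal (u y)) (cube a l)"
    unfolding mass_def using assms(2) by (intro nn_integral_cong_AE) auto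
  then show ?thesis
    using assms(1) m
    by (simp add: average_def nn_integral_completion emeasure_completion emeasure_cube
        divide_ennreal_def inverse_ennreal powr_minus powr_realpow)
qed

lemma Ap_loc_const_product:
  fixes \<omega> v :: "real^'n \<Rightarrow> real"
  assumes r: "0 < r" and eq: "AE x in lborel. \<omega> x = v x" and p: "1 < p"
  shows "average (iball x r) \<omega> * ennreal_powr (average (iball x r) (dual_weight p \<omega>)) (p - 1)
    = mass (\<lambda>y. ennreal (v y)) (iball x r)
       * ennreal_powr (mass (\<lambda>y. ennreal (dual_weight p v y)) (iball x r)) (p - 1)
       * ennreal ((2 * r) powr - (real CARD('n) * p))"
proof -
  have eq': "AE x in lborel. dual_weight p \<omega> x = dual_weight p v x"
    using eq by eventually_elim (simp add: dual_weight_def)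
  let ?N = "real CARD('n)"
  have "(2 * r) powr - ?N * ((2 * r) powr - ?N) powr (p - 1) = (2 * r) powr (- ?N + - ?N * (p - 1))"
    by (subst powr_add) (simp add: powr_powr)
  also have "- ?N + - ?N * (p - 1) = - (?N * p)" by (simp add: algebra_simps)
  finally have pw: "ennreal ((2 * r) powr - ?N) * ennreal (((2 * r) powr - ?N) powr (p - 1))
      = ennreal ((2 * r) powr - (?N * p))"
    by (simp add: ennreal_mult[symmetric])
  have P: "ennreal_powr (x * ennreal ((2 * r) powr - ?N)) (p - 1)
      = ennreal_powr x (p - 1) * ennreal (((2 * r) powr - ?N) powr (p - 1))" for x
    using p by (simp add: ennreal_powr_mult)
  have r2: "0 < 2 * r" using r by simp
  show ?thesis
    unfolding iball_eq_cube average_cube[OF r2 eq] average_cube[OF r2 eq'] P pw[symmetric]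
    by (simp only: mult_ac)
qed

lemma Ap_loc_const_eq_balls:
  fixes \<omega> :: "real^'n \<Rightarrow> real"
  shows "Ap_loc_const p R \<omega> = (SUP (x, r) \<in> UNIV \<times> {0<..R / 2}.
     average (iball x r) \<omega> * ennreal_powr (average (iball x r) (dual_weight p \<omega>)) (p - 1))"
proof -
  define F :: "(real^'n) \<times> real \<Rightarrow> (real^'n) \<times> real"
    where "F z = (\<chi> i. fst z $ i - snd z, 2 * snd z)" for z
  have range: "F ` (UNIV \<times> {0<..R / 2}) = UNIV \<times> {0<..R}"
  proof (intro equalityI subsetI)
    fix z :: "(real^'n) \<times> real" assume z: "z \<in> UNIV \<times> {0<..R}"
    have "z = F (\<chi> i. fst z $ i + snd z / 2, snd z / 2)"
      by (simp add: F_def vec_eq_iff prod_eq_iff)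
    then show "z \<in> F ` (UNIV \<times> {0<..R / 2})"
      by (rule image_eqI) (use z in auto)
  qed (auto simp: F_def)
  then show ?thesis
    unfolding Ap_loc_const_def
    by (simp add: image_image case_prod_unfold iball_eq_cube F_def flip: range)
qed

text \<open>A ball of radius r is a cube of side 2 r and volume (2 r)^n, hence the scale
  \<open>R / 2\<close> and the factor 2^(n p).\<close>

lemma Ap_balls_iff:
  fixes \<omega> v :: "real^'n \<Rightarrow> real"
  assumes eq: "AE x in lborel. \<omega> x = v x" and p: "1 < p" and K: "0 \<le> K"
  shows "Ap_loc_const p R \<omega> \<le> ennreal K \<longleftrightarrow> Ap_balls p v (R / 2) (K * 2 powr (real CARD('n) * p))"
proof -
  let ?N = "real CARD('n)"
  have "a * ennreal ((2 * r) powr - (?N * p)) \<le> ennreal K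
      \<longleftrightarrow> a \<le> ennreal (K * 2 powr (?N * p) * r powr (?N * p))" if r: "0 < r" for a r
  proof (cases a)
    case (real t)
    have "t * (2 * r) powr - (?N * p) \<le> K \<longleftrightarrow> t \<le> K * 2 powr (?N * p) * r powr (?N * p)"
      using r by (simp add: powr_minus powr_mult field_simps)
    then show ?thesis using real K by (simp add: ennreal_mult[symmetric])
  next
    case top
    then show ?thesis using r by (simp add: ennreal_top_mult top_unique)
  qed
  then show ?thesis
    unfolding Ap_loc_const_eq_balls Ap_balls_def
    by (auto simp: SUP_le_iff Ap_loc_const_product[OF _ eq p])
qed

text \<open>Finiteness of the supremum at scale \<open>R\<close> comes from
  \<open>Ap_balls_scale\<close> with an uncontrolled constant. Once it is finite, the supremum
  itself serves as the constant at that scale, so the scale at which membership was witnessed leaves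
  no trace.\<close>

theorem Ap_loc_regularize:
  fixes \<omega> :: "real^'n \<Rightarrow> real"
  assumes \<omega>: "\<omega> \<in> Ap_loc p" and p: "1 < p"
  obtains v where "pos_weight p v" "AE x in lborel. \<omega> x = v x" "Ap_loc_const p R \<omega> < top"
    "Ap_balls p v (R / 2) (enn2real (Ap_loc_const p R \<omega>) * 2 powr (real CARD('n) * p))"
proof -
  have wt: "is_weight \<omega>" using \<omega> by (simp add: Ap_loc_def)
  then obtain v where v: "v \<in> borel_measurable borel" "\<And>x. 0 < v x" "AE x in lborel. \<omega> x = v x"
    using weight_borel_version by blast
  have fin: "mass (\<lambda>y. ennreal (v y)) (iball x r) < top" for x r
  proof -
    let ?K = "cbox (\<chi> i. x $ i - r) (\<chi> i. x $ i + r)"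
    have "\<omega> absolutely_integrable_on ?K" using wt by (simp add: is_weight_def)
    then have "(\<integral>\<^sup>+y. ennreal (norm (indicator ?K y *\<^sub>R \<omega> y)) \<partial>lebesgue) < top"
      by (simp add: set_integrable_def integrable_iff_bounded)
    then have "(\<integral>\<^sup>+y. ennreal (norm (indicator ?K y *\<^sub>R \<omega> y)) \<partial>lborel) < top"
      by (simp add: nn_integral_completion)
    moreover have "mass (\<lambda>y. ennreal (v y)) (iball x r) \<le> (\<integral>\<^sup>+y. ennreal (norm (indicator ?K y *\<^sub>R \<omega> y)) \<partial>lborel)"
      unfolding mass_def
    proof (intro nn_integral_mono_AE, use v(3) in eventually_elim)
      fix y assume "\<omega> y = v y"
      moreover have "y \<in> ?K" if "y \<in> iball x r"
        using that by (auto simp: mem_iball mem_box_cart abs_less_iff algebra_simps; smt (verit))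
      ultimately show "ennreal (v y) * indicator (iball x r) y \<le> ennreal (norm (indicator ?K y *\<^sub>R \<omega> y))"
        using v(2)[of y] by (auto simp: indicator_def)
    qed
    ultimately show ?thesis by (rule order_le_less_trans[rotated])
  qed
  interpret pos_weight p v
    using v fin p by unfold_locales auto
  obtain R0 where R0: "0 < R0" "Ap_loc_const p R0 \<omega> < top"
    using \<omega> by (auto simp: Ap_loc_def)
  then have "Ap_loc_const p R0 \<omega> \<le> ennreal (enn2real (Ap_loc_const p R0 \<omega>))" by simp
  then have "Ap_balls p v (R0 / 2) (enn2real (Ap_loc_const p R0 \<omega>) * 2 powr (real CARD('n) * p))"
    by (subst (asm) Ap_balls_iff[OF v(3) p]) auto
  then obtain K where K: "0 \<le> K" "Ap_balls p v (R / 2) K"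
    using Ap_balls_scale[of "R0 / 2" _ "R / 2"] R0 by force
  \<comment> \<open>The constant is rewritten into the shape that \<open>Ap_balls_iff\<close>
    expects.\<close>
  then have "Ap_balls p v (R / 2) (K * 2 powr - (real CARD('n) * p) * 2 powr (real CARD('n) * p))"
    by (simp add: mult.assoc flip: powr_add)
  then have "Ap_loc_const p R \<omega> \<le> ennreal (K * 2 powr - (real CARD('n) * p))"
    using K Ap_balls_iff[OF v(3) p, of "K * 2 powr - (real CARD('n) * p)"] by auto
  then have top: "Ap_loc_const p R \<omega> < top" by (rule order_le_less_trans) simp
  then have "Ap_loc_const p R \<omega> \<le> ennreal (enn2real (Ap_loc_const p R \<omega>))" by simp
  then have "Ap_balls p v (R / 2) (enn2real (Ap_loc_const p R \<omega>) * 2 powr (real CARD('n) * p))"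
    by (subst (asm) Ap_balls_iff[OF v(3) p]) auto
  then show thesis using that top v(3) pos_weight_axioms by blast
qed

section \<open>Dyadic grids and the maximal theorem for weights\<close>

lemma measurable_indicator_iball [measurable]:
  "(\<lambda>(y, z). indicator (iball y r) z :: ennreal) \<in> borel_measurable (borel \<Otimes>\<^sub>M borel)"
proof -
  have inf [measurable]: "(infnorm :: real^'n \<Rightarrow> real) \<in> borel_measurable borel"
    by (intro borel_measurable_continuous_onI continuous_on_infnorm continuous_on_id)
  have "{z \<in> space (borel \<Otimes>\<^sub>M borel). infnorm (fst z - snd z :: real^'n) < r} \<in> sets (borel \<Otimes>\<^sub>M borel)"
    by measurable
  then have "indicator {z :: (real^'n) \<times> (real^'n). infnorm (fst z - snd z) < r}
      \<in> (borel_measurable (borel \<Otimes>\<^sub>M borel) :: (_ \<Rightarrow> ennreal) set)"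
    by (simp add: space_pair_measure)
  also have "indicator {z :: (real^'n) \<times> (real^'n). infnorm (fst z - snd z) < r}
      = (\<lambda>(y, z). indicator (iball y r) z :: ennreal)"
    by (auto simp: indicator_def iball_def fun_eq_iff)
  finally show ?thesis .
qed

lemma measurable_mass_iball [measurable]:
  assumes [measurable]: "u \<in> borel_measurable borel"
  shows "(\<lambda>y. mass u (iball y r)) \<in> borel_measurable borel"
  unfolding mass_def by measurable

lemma measurable_vec_nth [measurable (raw)]:
  assumes "f \<in> borel_measurable M"
  shows "(\<lambda>x. (f x :: real^'n) $ i) \<in> borel_measurable M"
  using assms by (rule measurable_compose)
    (auto intro!: borel_measurable_continuous_onI continuous_intros)

text \<open>The half-open cubes of the lattice with origin \<open>c\<close> and mesh
  \<open>l\<close>, given as an equivalence relation as \<open>nested_cells\<close>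
  requires.\<close>

definition same_cell :: "real^'n \<Rightarrow> real \<Rightarrow> real^'n \<Rightarrow> real^'n \<Rightarrow> bool" where
  "same_cell c l x y \<longleftrightarrow> (\<forall>i. \<lfloor>(x $ i - c $ i) / l\<rfloor> = \<lfloor>(y $ i - c $ i) / l\<rfloor>)"

lemma same_cell_refl: "same_cell c l x x"
  and same_cell_sym: "same_cell c l x y \<Longrightarrow> same_cell c l y x"
  and same_cell_trans: "same_cell c l x y \<Longrightarrow> same_cell c l y z \<Longrightarrow> same_cell c l x z"
  by (auto simp: same_cell_def)

lemma same_cell_double: "same_cell c (l / 2) x y \<Longrightarrow> same_cell c l x y"
proof -
  have "\<lfloor>t\<rfloor> \<le> \<lfloor>u\<rfloor>" if "\<lfloor>2 * u\<rfloor> = \<lfloor>2 * t\<rfloor>" for u t :: real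
  proof -
    have "2 * \<lfloor>t\<rfloor> \<le> \<lfloor>2 * t\<rfloor>" by (simp add: le_floor_iff)
    then have "2 * \<lfloor>t\<rfloor> \<le> \<lfloor>2 * u\<rfloor>" using that by simp
    then show ?thesis by (simp add: le_floor_iff)
  qed
  then have "\<lfloor>u\<rfloor> = \<lfloor>t\<rfloor>" if "\<lfloor>2 * u\<rfloor> = \<lfloor>2 * t\<rfloor>" for u t :: real
    using that by (metis order_antisym)
  moreover have "u / (l / 2) = 2 * (u / l)" for u by simp
  ultimately show "same_cell c (l / 2) x y \<Longrightarrow> same_cell c l x y"
    unfolding same_cell_def by metis
qed

lemma measurable_same_cell:
  "{z. same_cell (c :: real^'n) l (fst z) (snd z)} \<in> sets (borel \<Otimes>\<^sub>M borel)"
proof -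
  have "{z \<in> space (borel \<Otimes>\<^sub>M borel). \<forall>i. \<lfloor>(fst z $ i - c $ i) / l\<rfloor> = \<lfloor>(snd z $ i - c $ i) / l\<rfloor>}
      \<in> sets (borel \<Otimes>\<^sub>M borel)"
    by measurable
  then show ?thesis by (simp add: same_cell_def space_pair_measure)
qed

lemma same_cell_subset_iball: "0 < l \<Longrightarrow> {y. same_cell c l x y} \<subseteq> iball x l"
proof
  fix y assume l: "0 < l" and "y \<in> {y. same_cell c l x y}"
  then have eq: "\<lfloor>(x $ i - c $ i) / l\<rfloor> = \<lfloor>(y $ i - c $ i) / l\<rfloor>" for i
    by (simp add: same_cell_def)
  have "\<bar>x $ i - y $ i\<bar> < l" for i
  proof -
    have "\<bar>(x $ i - c $ i) / l - (y $ i - c $ i) / l\<bar> < 1" using eq[of i] by linarith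
    moreover have "(x $ i - c $ i) / l - (y $ i - c $ i) / l = (x $ i - y $ i) / l"
      by (simp add: diff_divide_distrib)
    ultimately show ?thesis using l by (simp add: abs_divide)
  qed
  then show "y \<in> iball x l" by (simp add: mem_iball)
qed

lemma sets_cell [measurable]: "{y. same_cell (c :: real^'n) l x y} \<in> sets borel"
proof -
  have "Pair x -` {z. same_cell c l (fst z) (snd z)} \<in> sets borel"
    using measurable_same_cell by (rule sets_Pair1)
  then show ?thesis by (simp add: vimage_def)
qed

lemma emeasure_cell:
  fixes c :: "real^'n"
  assumes l: "0 < l"
  shows "emeasure lborel {y. same_cell c l x y} = ennreal (l ^ CARD('n))"
proof (rule antisym)
  define a where "a = (\<chi> i. c $ i + l * of_int \<lfloor>(x $ i - c $ i) / l\<rfloor>)"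
  have iff: "same_cell c l x y \<longleftrightarrow> (\<forall>i. a $ i \<le> y $ i \<and> y $ i < a $ i + l)" for y
  proof -
    have "\<lfloor>(x $ i - c $ i) / l\<rfloor> = \<lfloor>(y $ i - c $ i) / l\<rfloor> \<longleftrightarrow> a $ i \<le> y $ i \<and> y $ i < a $ i + l" for i
    proof -
      have "\<lfloor>(x $ i - c $ i) / l\<rfloor> = \<lfloor>(y $ i - c $ i) / l\<rfloor>
        \<longleftrightarrow> of_int \<lfloor>(x $ i - c $ i) / l\<rfloor> \<le> (y $ i - c $ i) / l \<and> (y $ i - c $ i) / l < of_int \<lfloor>(x $ i - c $ i) / l\<rfloor> + 1"
        by linarith
      then show ?thesis using l by (simp add: a_def field_simps)
    qed
    then show ?thesis by (simp add: same_cell_def)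
  qed
  have "emeasure lborel {y. same_cell c l x y} \<le> emeasure lborel (cbox a (\<chi> i. a $ i + l))"
    by (intro emeasure_mono) (auto simp: iff mem_box_cart less_imp_le)
  then show "emeasure lborel {y. same_cell c l x y} \<le> ennreal (l ^ CARD('n))"
    using l by (simp add: emeasure_lborel_vec_box)
  have "emeasure lborel (box a (\<chi> i. a $ i + l)) \<le> emeasure lborel {y. same_cell c l x y}"
    by (intro emeasure_mono) (auto simp: iff mem_box_cart less_imp_le)
  then show "ennreal (l ^ CARD('n)) \<le> emeasure lborel {y. same_cell c l x y}"
    using l by (simp add: emeasure_lborel_vec_box)
qed

text \<open>Used for both measures s dx and w dx. Finiteness is asked only up to radius
  \<open>L\<close>, because the dual weight is known to be integrable only up to the scale of the
  A_p condition.\<close>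

lemma nested_cells_grid:
  fixes u :: "real^'n \<Rightarrow> ennreal"
  assumes [measurable]: "u \<in> borel_measurable borel" and u: "\<And>x. u x \<noteq> 0" "\<And>x. u x \<noteq> top"
    and L: "0 < L" and fin: "\<And>x r. r \<le> L \<Longrightarrow> mass u (iball x r) < top"
  shows "nested_cells (density lborel u) (\<lambda>m. same_cell c (L / 2 ^ m))"
proof -
  interpret sigma_finite_measure "density lborel u"
    using u(2) by (subst sigma_finite_measure.sigma_finite_iff_density_finite[OF sigma_finite_lborel]) auto
  have em: "emeasure (density lborel u) {y. same_cell c l x y} = mass u {y. same_cell c l x y}" for l x
    by (simp add: emeasure_density mass_def)
  show ?thesis
  proof
    fix m x y z
    show "space (density lborel u) = UNIV" by simp
    show "same_cell c (L / 2 ^ m) x x" by (rule same_cell_refl)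
    show "same_cell c (L / 2 ^ m) x y \<Longrightarrow> same_cell c (L / 2 ^ m) y x" by (rule same_cell_sym)
    show "same_cell c (L / 2 ^ m) x y \<Longrightarrow> same_cell c (L / 2 ^ m) y z \<Longrightarrow> same_cell c (L / 2 ^ m) x z"
      by (rule same_cell_trans)
    show "same_cell c (L / 2 ^ Suc m) x y \<Longrightarrow> same_cell c (L / 2 ^ m) x y"
      using same_cell_double[of c "L / 2 ^ m" x y] by (simp add: mult.commute)
    have "sets (density lborel u \<Otimes>\<^sub>M density lborel u) = sets (borel \<Otimes>\<^sub>M borel)"
      by (intro sets_pair_measure_cong) simp_all
    then show "{z. same_cell c (L / 2 ^ m) (fst z) (snd z)} \<in> sets (density lborel u \<Otimes>\<^sub>M density lborel u)"
      using measurable_same_cell by blast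
    show "emeasure (density lborel u) {y. same_cell c (L / 2 ^ m) x y} \<noteq> 0"
      unfolding em using L u by (intro mass_pos) (auto simp: emeasure_cell)
    have "mass u {y. same_cell c (L / 2 ^ m) x y} \<le> mass u (iball x (L / 2 ^ m))"
      using L by (intro mass_mono same_cell_subset_iball) simp
    also have "\<dots> < top"
      using L by (intro fin) (simp add: field_simps)
    finally show "emeasure (density lborel u) {y. same_cell c (L / 2 ^ m) x y} \<noteq> top"
      unfolding em by simp
  qed
qed

text \<open>The average with respect to Lebesgue measure, to be contrasted with
  \<open>cell_avg\<close>, which is taken with respect to s dx or w dx.\<close>

definition cell_mean :: "real^'n \<Rightarrow> real \<Rightarrow> (real^'n \<Rightarrow> ennreal) \<Rightarrow> real^'n \<Rightarrow> ennreal" where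
  "cell_mean c l g x = (\<integral>\<^sup>+y. g y * indicator {y. same_cell c l x y} y \<partial>lborel) / ennreal (l ^ CARD('n))"

lemma same_cell_eq: "same_cell c l x y \<Longrightarrow> {z. same_cell c l x z} = {z. same_cell c l y z}"
  by (auto simp: same_cell_def)

lemma cell_mean_cong: "same_cell c l x y \<Longrightarrow> cell_mean c l g x = cell_mean c l g y"
  by (simp add: cell_mean_def same_cell_eq)

lemma measurable_cell_mean [measurable]:
  fixes c :: "real^'n"
  assumes [measurable]: "g \<in> borel_measurable borel"
  shows "cell_mean c l g \<in> borel_measurable borel"
proof -
  have "indicator {z. same_cell c l (fst z) (snd z)} \<in> (borel_measurable (borel \<Otimes>\<^sub>M borel) :: (_ \<Rightarrow> ennreal) set)"
    by (rule borel_measurable_indicator[OF measurable_same_cell])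
  also have "indicator {z. same_cell c l (fst z) (snd z)} = (\<lambda>(x, y). indicator {y. same_cell c l x y} y :: ennreal)"
    by (auto simp: indicator_def fun_eq_iff)
  finally have [measurable]:
    "(\<lambda>(x, y). indicator {y. same_cell c l x y} y :: ennreal) \<in> borel_measurable (borel \<Otimes>\<^sub>M borel)" .
  show ?thesis unfolding cell_mean_def[abs_def] by measurable
qed

definition doob_const :: "real \<Rightarrow> real" where
  "doob_const q = 2 * (2 * (q / (q - 1))) powr q"

lemma doob_const_nonneg [simp]: "0 \<le> doob_const q"
  by (simp add: doob_const_def)

text \<open>Put q = p/(p-1). The power K^q arises from raising a bound of order p - 1 to the power
  q; the two Doob constants belong to w dx with exponent q and to s dx with exponent p.\<close>

definition muckenhoupt_const :: "real \<Rightarrow> real \<Rightarrow> real" where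
  "muckenhoupt_const p K = K powr (p / (p - 1)) * (doob_const (p / (p - 1)) * doob_const p)"

lemma muckenhoupt_const_nonneg [simp]: "0 \<le> muckenhoupt_const p K"
  by (simp add: muckenhoupt_const_def)

locale Ap_weight = pos_weight p v for p :: real and v :: "real^'n \<Rightarrow> real" +
  fixes R K :: real
  assumes R: "0 < R" and K: "0 \<le> K" and Ap: "Ap_balls p v R K"
begin

section \<open>Weighted bounds for averages at one scale and for the dyadic maximal function\<close>

lemma Ap_le:
  assumes "0 < r" "r \<le> R"
  shows "mass w (iball x r) * ennreal_powr (mass s (iball x r)) (p - 1) \<le> ennreal (K * r powr (real CARD('n) * p))"
  using Ap assms unfolding Ap_balls_def w_def[abs_def] s_def[abs_def] by auto

lemma mass_w_nz: "0 < r \<Longrightarrow> mass w (iball x r) \<noteq> 0"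
  by (intro mass_pos w_measurable sets_iball w_nz) (simp_all add: emeasure_iball)

text \<open>Local integrability of the dual weight is a consequence of the A_p condition: the
  product on a ball is finite and its factor for \<open>w\<close> is not zero.\<close>

lemma s_finite: "r \<le> R \<Longrightarrow> mass s (iball x r) < top"
proof -
  assume r: "r \<le> R"
  have "mass w (iball x R) * ennreal_powr (mass s (iball x R)) (p - 1) < top"
    using Ap_le[OF R order_refl, of x] by (rule order_le_less_trans) simp
  then have "mass s (iball x R) < top"
    using mass_w_nz[OF R, of x] by (auto simp: ennreal_mult_less_top)
  moreover have "mass s (iball x r) \<le> mass s (iball x R)"
    using r by (intro mass_mono) (auto simp: iball_def)
  ultimately show ?thesis by simp
qed

lemma w_finite: "mass w (iball x r) < top"
  using v_finite by (simp add: w_def[abs_def])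

text \<open>By Hoelder's inequality and Tonelli's theorem: no covering argument is needed at a single scale.\<close>

lemma ball_average_bound:
  assumes [measurable]: "h \<in> borel_measurable borel" and r: "0 < r" "2 * r \<le> R"
  shows "(\<integral>\<^sup>+y. ennreal_powr (\<integral>\<^sup>+z. h z * s z * indicator (iball y r) z \<partial>lborel) p * w y \<partial>lborel)
    \<le> ennreal (K * (2 * r) powr (real CARD('n) * p)) * (\<integral>\<^sup>+z. ennreal_powr (h z) p * s z \<partial>lborel)"
proof -
  let ?P = "\<lambda>y r. ennreal_powr (mass s (iball y r)) (p - 1)"
  have "(\<integral>\<^sup>+y. ennreal_powr (\<integral>\<^sup>+z. h z * s z * indicator (iball y r) z \<partial>lborel) p * w y \<partial>lborel)
    \<le> (\<integral>\<^sup>+y. (\<integral>\<^sup>+z. ennreal_powr (h z) p * s z * indicator (iball y r) z \<partial>lborel) * (?P y r * w y) \<partial>lborel)"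
  proof (intro nn_integral_mono)
    fix y
    have "ennreal_powr (\<integral>\<^sup>+z. h z * (s z * indicator (iball y r) z) \<partial>lborel) p
      \<le> (\<integral>\<^sup>+z. ennreal_powr (h z) p * (s z * indicator (iball y r) z) \<partial>lborel)
        * ennreal_powr (\<integral>\<^sup>+z. s z * indicator (iball y r) z \<partial>lborel) (p - 1)"
      using p by (intro Holder_weighted) auto
    then show "ennreal_powr (\<integral>\<^sup>+z. h z * s z * indicator (iball y r) z \<partial>lborel) p * w y
      \<le> (\<integral>\<^sup>+z. ennreal_powr (h z) p * s z * indicator (iball y r) z \<partial>lborel) * (?P y r * w y)"
      by (simp only: mult.assoc[symmetric] mass_def) (rule mult_right_mono, simp_all)
  qed
  also have "\<dots> = (\<integral>\<^sup>+y. (\<integral>\<^sup>+z. ennreal_powr (h z) p * s z * indicator (iball y r) z * (?P y r * w y) \<partial>lborel) \<partial>lborel)"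
    by (simp add: nn_integral_multc)
  also have "\<dots> = (\<integral>\<^sup>+z. (\<integral>\<^sup>+y. ennreal_powr (h z) p * s z * indicator (iball y r) z * (?P y r * w y) \<partial>lborel) \<partial>lborel)"
    by (rule lborel_pair.Fubini') measurable
  also have "\<dots> \<le> (\<integral>\<^sup>+z. ennreal_powr (h z) p * s z * ennreal (K * (2 * r) powr (real CARD('n) * p)) \<partial>lborel)"
  proof (intro nn_integral_mono)
    fix z
    have "(\<integral>\<^sup>+y. ennreal_powr (h z) p * s z * indicator (iball y r) z * (?P y r * w y) \<partial>lborel)
      \<le> (\<integral>\<^sup>+y. ennreal_powr (h z) p * s z * (w y * indicator (iball z (2 * r)) y * ?P z (2 * r)) \<partial>lborel)"
    proof (intro nn_integral_mono)
      fix y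
      show "ennreal_powr (h z) p * s z * indicator (iball y r) z * (?P y r * w y)
        \<le> ennreal_powr (h z) p * s z * (w y * indicator (iball z (2 * r)) y * ?P z (2 * r))"
      proof (cases "z \<in> iball y r")
        case True
        then have y: "y \<in> iball z r" by (simp add: iball_sym)
        \<comment> \<open>Enlarging to a ball about \<open>z\<close> frees the mass of
          \<open>s\<close> from \<open>y\<close>; what remains is the mass of \<open>w\<close> on
          the same ball, so the A_p condition applies at radius 2 r.\<close>
        then have "iball y r \<subseteq> iball z (2 * r)" using iball_triangle[OF y, of _ r] by auto
        then have "?P y r \<le> ?P z (2 * r)" using p by (intro ennreal_powr_mono mass_mono) auto
        moreover have "y \<in> iball z (2 * r)" using y r by (auto simp: iball_def)
        ultimately show ?thesis using True
          mult_left_mono[of "?P y r" "?P z (2 * r)" "ennreal_powr (h z) p * s z * w y"]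
          by (simp add: mult_ac)
      qed simp
    qed
    also have "\<dots> = ennreal_powr (h z) p * s z * (mass w (iball z (2 * r)) * ?P z (2 * r))"
      by (simp add: nn_integral_cmult nn_integral_multc mass_def)
    also have "\<dots> \<le> ennreal_powr (h z) p * s z * ennreal (K * (2 * r) powr (real CARD('n) * p))"
      using r by (intro mult_left_mono Ap_le) auto
    finally show "(\<integral>\<^sup>+y. ennreal_powr (h z) p * s z * indicator (iball y r) z * (?P y r * w y) \<partial>lborel)
      \<le> ennreal_powr (h z) p * s z * ennreal (K * (2 * r) powr (real CARD('n) * p))" .
  qed
  also have "\<dots> = ennreal (K * (2 * r) powr (real CARD('n) * p)) * (\<integral>\<^sup>+z. ennreal_powr (h z) p * s z \<partial>lborel)"
    by (simp add: nn_integral_multc mult.commute)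
  finally show ?thesis .
qed

text \<open>Lerner's argument: the unweighted dyadic maximal function is dominated by a composition of
  the maximal functions with respect to the measures \<open>s dx\<close> and \<open>w dx\<close>, each of which is bounded
  regardless of the weight.\<close>

theorem dyadic_maximal_bound:
  assumes [measurable]: "h \<in> borel_measurable borel" and L: "0 < L" "L \<le> R"
  shows "(\<integral>\<^sup>+x. ennreal_powr (SUP m. cell_mean c (L / 2 ^ m) (\<lambda>y. h y * s y) x) p * w x \<partial>lborel)
    \<le> ennreal (muckenhoupt_const p K) * (\<integral>\<^sup>+x. ennreal_powr (h x) p * s x \<partial>lborel)"
proof -
  let ?l = "\<lambda>m. L / 2 ^ m"
  let ?Q = "\<lambda>m x. {y. same_cell c (?l m) x y}"
  let ?F = "\<lambda>m x. cell_mean c (?l m) (\<lambda>y. h y * s y) x"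
  define q where "q = p / (p - 1)"
  have q: "1 < q" "(p - 1) * q = p" using p by (auto simp: q_def)
  interpret S: nested_cells "density lborel s" "\<lambda>m. same_cell c (?l m)"
    using s_nz L by (intro nested_cells_grid s_finite) (auto simp: s_def)
  interpret W: nested_cells "density lborel w" "\<lambda>m. same_cell c (?l m)"
    using w_nz L by (intro nested_cells_grid w_finite) (auto simp: w_def)
  have hS [measurable]: "h \<in> borel_measurable (density lborel s)" by simp
  define X where "X x = (SUP m. S.cell_avg m h x)" for x
  have cavg: "S.cell_avg m h \<in> borel_measurable borel" for m
    using S.measurable_cell_avg[OF hS] by simp
  have X [measurable]: "X \<in> borel_measurable borel"
    unfolding X_def[abs_def] using cavg by measurable
  \<comment> \<open>Dividing by the weight turns averages of \<open>U\<close> with respect to w dx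
    into Lebesgue integrals of X^(p-1).\<close>
  define U where "U x = ennreal_powr (X x) (p - 1) * ennreal (1 / v x)" for x
  have U [measurable]: "U \<in> borel_measurable borel" unfolding U_def[abs_def] by measurable
  have UW: "w x * U x = ennreal_powr (X x) (p - 1)" for x
  proof -
    have "ennreal (v x) * ennreal (1 / v x) = 1"
      using v_pos[of x] by (simp add: ennreal_mult[symmetric])
    then show ?thesis unfolding U_def w_def by (metis mult.left_commute mult.right_neutral)
  qed
  \<comment> \<open>For a cell Q on which \<open>h\<close> has s-average e, the Lebesgue average is
    e s(Q)/|Q|. By A_p, (s(Q)/|Q|)^(p-1) <= K |Q|/w(Q), and e^(p-1) |Q| is at most the integral of
    X^(p-1) over Q because X >= e there.\<close>
  have step: "ennreal_powr (?F m x) (p - 1) \<le> ennreal K * W.cell_avg m U x" for m x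
  proof -
    define l where "l = ?l m"
    have l: "0 < l" "l \<le> R"
    proof -
      show "0 < l" using L by (simp add: l_def)
      have "l \<le> L" using L by (simp add: l_def field_simps)
      then show "l \<le> R" using L by simp
    qed
    define Q where "Q = ?Q m x"
    define a where "a = l ^ CARD('n)"
    have a: "0 < a" using l by (simp add: a_def)
    have Qm [measurable]: "Q \<in> sets borel" by (simp add: Q_def)
    have eQ: "emeasure lborel Q = ennreal a"
      using l(1) unfolding Q_def a_def l_def by (rule emeasure_cell)
    have emS: "emeasure (density lborel s) Q = mass s Q" and emW: "emeasure (density lborel w) Q = mass w Q"
      by (simp_all add: emeasure_density mass_def)
    have sQ: "mass s Q \<noteq> 0" "mass s Q \<noteq> top"
      using S.cell_nonnull[of m x] S.cell_finite[of m x] emS by (simp_all add: Q_def)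
    obtain b where b: "mass w Q = ennreal b" "0 < b"
      using W.cell_nonnull[of m x] W.cell_finite[of m x] emW unfolding Q_def
      by (cases "mass w (?Q m x)") (auto simp: order_less_le)
    obtain t where t: "mass s Q = ennreal t" "0 < t"
      using sQ by (cases "mass s Q") (auto simp: order_less_le)
    define e where "e = S.cell_avg m h x"
    have F: "?F m x = e * ennreal (t / a)"
    proof -
      have "(\<integral>\<^sup>+y. h y * s y * indicator Q y \<partial>lborel) = e * mass s Q"
      proof -
        have "(\<integral>\<^sup>+y. h y * indicator Q y \<partial>density lborel s) = (\<integral>\<^sup>+y. h y * s y * indicator Q y \<partial>lborel)"
          by (subst nn_integral_density) (auto simp: mult_ac)
        then have "e = (\<integral>\<^sup>+y. h y * s y * indicator Q y \<partial>lborel) / mass s Q"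
          by (simp add: e_def S.cell_avg_def Q_def[symmetric] emS)
        then have "e * mass s Q = (\<integral>\<^sup>+y. h y * s y * indicator Q y \<partial>lborel) * (mass s Q / mass s Q)"
          by (simp only: ennreal_divide_times)
        then show ?thesis using sQ by (simp add: ennreal_divide_self less_top)
      qed
      then have "?F m x = e * ennreal t / ennreal a"
        unfolding cell_mean_def a_def Q_def t(1)[unfolded Q_def] by (simp add: l_def)
      also have "\<dots> = e * (ennreal t / ennreal a)" by (simp only: ennreal_times_divide)
      also have "ennreal t / ennreal a = ennreal (t / a)" using a t(2) by (simp add: divide_ennreal)
      finally show ?thesis .
    qed
    have up: "ennreal_powr e (p - 1) * ennreal a \<le> (\<integral>\<^sup>+y. U y * indicator Q y \<partial>density lborel w)"
    proof -
      have "ennreal_powr e (p - 1) * ennreal a = (\<integral>\<^sup>+y. ennreal_powr e (p - 1) * indicator Q y \<partial>lborel)"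
        by (simp add: nn_integral_cmult eQ)
      also have "\<dots> \<le> (\<integral>\<^sup>+y. ennreal_powr (X y) (p - 1) * indicator Q y \<partial>lborel)"
      proof (intro nn_integral_mono)
        fix y
        have "ennreal_powr e (p - 1) \<le> ennreal_powr (X y) (p - 1)" if "y \<in> Q"
        proof -
          have "e = S.cell_avg m h y" unfolding e_def using that by (intro S.cell_avg_cong) (simp add: Q_def)
          then show ?thesis unfolding X_def using p by (intro ennreal_powr_mono) (auto intro: SUP_upper)
        qed
        then show "ennreal_powr e (p - 1) * indicator Q y \<le> ennreal_powr (X y) (p - 1) * indicator Q y"
          by (auto simp: indicator_def)
      qed
      also have "\<dots> = (\<integral>\<^sup>+y. U y * indicator Q y \<partial>density lborel w)"
        by (subst nn_integral_density) (auto simp: UW mult.assoc[symmetric])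
      finally show ?thesis .
    qed
    \<comment> \<open>The cell lies in the ball of radius \<open>l\<close> about any of its points,
      and l^(n p) is |Q|^p, so A_p passes from balls to cells with the same
      \<open>K\<close>.\<close>
    have "b * t powr (p - 1) \<le> K * a powr p"
    proof -
      have sub: "Q \<subseteq> iball x l" unfolding Q_def l_def[symmetric] using l by (intro same_cell_subset_iball)
      have "ennreal (b * t powr (p - 1)) = mass w Q * ennreal_powr (mass s Q) (p - 1)"
        using b t by (simp add: ennreal_mult)
      also have "\<dots> \<le> mass w (iball x l) * ennreal_powr (mass s (iball x l)) (p - 1)"
        using sub p by (intro mult_mono ennreal_powr_mono mass_mono) auto
      also have "\<dots> \<le> ennreal (K * l powr (real CARD('n) * p))" using l by (intro Ap_le)
      also have "l powr (real CARD('n) * p) = a powr p"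
        using l by (simp add: a_def powr_powr[symmetric] powr_realpow)
      finally show ?thesis using K by (subst (asm) ennreal_le_iff) auto
    qed
    moreover have "a powr p = a * a powr (p - 1)"
      using a powr_mult_base[of a "p - 1"] by simp
    ultimately have "(t / a) powr (p - 1) * b \<le> K * a"
      using a t(2) by (simp add: powr_divide field_simps)
    then have "(t / a) powr (p - 1) \<le> K * (a / b)"
      using b by (simp add: field_simps)
    then have "ennreal_powr (?F m x) (p - 1) \<le> ennreal_powr e (p - 1) * ennreal (K * (a / b))"
      unfolding F using p a t by (simp add: ennreal_powr_mult mult_left_mono ennreal_leI)
    also have "\<dots> = ennreal K * (ennreal_powr e (p - 1) * ennreal a / ennreal b)"
    proof -
      have "ennreal (K * (a / b)) = ennreal K * (ennreal a / ennreal b)"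
        using K a b(2) ennreal_mult[of K "a / b"] by (simp add: divide_ennreal)
      then have "ennreal_powr e (p - 1) * ennreal (K * (a / b))
          = ennreal K * (ennreal_powr e (p - 1) * (ennreal a / ennreal b))"
        by (simp only: mult.left_commute)
      then show ?thesis by (simp only: ennreal_times_divide)
    qed
    also have "\<dots> \<le> ennreal K * W.cell_avg m U x"
      unfolding W.cell_avg_def Q_def[symmetric] emW b(1)
      by (intro mult_left_mono divide_right_mono_ennreal up) simp
    finally show ?thesis .
  qed
  have "(\<integral>\<^sup>+x. ennreal_powr (SUP m. ?F m x) p * w x \<partial>lborel)
    \<le> (\<integral>\<^sup>+x. ennreal (K powr q) * (w x * ennreal_powr (SUP m. W.cell_avg m U x) q) \<partial>lborel)"
  proof (intro nn_integral_mono)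
    fix x
    have "ennreal_powr (SUP m. ?F m x) (p - 1) \<le> ennreal K * (SUP m. W.cell_avg m U x)"
      using p step by (simp add: ennreal_powr_SUP SUP_mult_left_ennreal) (intro SUP_mono, blast)
    then have "ennreal_powr (ennreal_powr (SUP m. ?F m x) (p - 1)) q
        \<le> ennreal_powr (ennreal K * (SUP m. W.cell_avg m U x)) q"
      using q by (intro ennreal_powr_mono) auto
    then have "ennreal_powr (SUP m. ?F m x) p \<le> ennreal (K powr q) * ennreal_powr (SUP m. W.cell_avg m U x) q"
      using p q K by (simp add: ennreal_powr_powr ennreal_powr_mult)
    then have "ennreal_powr (SUP m. ?F m x) p * w x
      \<le> ennreal (K powr q) * ennreal_powr (SUP m. W.cell_avg m U x) q * w x"
      by (rule mult_right_mono) simp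
    then show "ennreal_powr (SUP m. ?F m x) p * w x
      \<le> ennreal (K powr q) * (w x * ennreal_powr (SUP m. W.cell_avg m U x) q)"
      by (simp only: mult_ac)
  qed
  also have "\<dots> = ennreal (K powr q) * (\<integral>\<^sup>+x. ennreal_powr (SUP m. W.cell_avg m U x) q \<partial>density lborel w)"
  proof -
    have [measurable]: "W.cell_avg m U \<in> borel_measurable borel" for m
      using W.measurable_cell_avg[of U m] by simp
    show ?thesis by (subst nn_integral_density, measurable) (simp add: nn_integral_cmult)
  qed
  also have "\<dots> \<le> ennreal (K powr q) * (ennreal (doob_const q) * (\<integral>\<^sup>+x. ennreal_powr (U x) q \<partial>density lborel w))"
    unfolding doob_const_def using q by (intro mult_left_mono W.maximal_inequality) auto
  also have "(\<integral>\<^sup>+x. ennreal_powr (U x) q \<partial>density lborel w) = (\<integral>\<^sup>+x. ennreal_powr (X x) p \<partial>density lborel s)"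
  proof -
    \<comment> \<open>As (p-1) q = p and w^(1-q) = s, the exponent q for \<open>U\<close> in w dx
      becomes the exponent p for \<open>X\<close> in s dx, where the second maximal inequality
      applies.\<close>
    have "w x * ennreal_powr (U x) q = s x * ennreal_powr (X x) p" for x
    proof -
      have "v x * (1 / v x) powr q = v x powr (1 + - q)"
        using v_pos[of x] by (subst powr_add) (simp add: powr_divide powr_minus_divide)
      also have "1 + - q = - (1 / (p - 1))" using p by (simp add: q_def field_simps)
      finally have "v x * (1 / v x) powr q = dual_weight p v x" by (simp add: dual_weight_def)
      then have "w x * ennreal ((1 / v x) powr q) = s x"
        using v_pos[of x] by (simp add: w_def s_def ennreal_mult[symmetric])
      moreover have "ennreal_powr (U x) q = ennreal_powr (X x) p * ennreal ((1 / v x) powr q)"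
        using p q v_pos[of x] by (simp add: U_def ennreal_powr_mult ennreal_powr_powr less_imp_le)
      ultimately show ?thesis by (metis mult.commute mult.left_commute)
    qed
    then show ?thesis by (subst (1 2) nn_integral_density) auto
  qed
  also have "\<dots> \<le> ennreal (doob_const p) * (\<integral>\<^sup>+x. ennreal_powr (h x) p \<partial>density lborel s)"
    unfolding doob_const_def X_def using p by (intro S.maximal_inequality) auto
  also have "(\<integral>\<^sup>+x. ennreal_powr (h x) p \<partial>density lborel s) = (\<integral>\<^sup>+x. ennreal_powr (h x) p * s x \<partial>lborel)"
    by (subst nn_integral_density) (auto simp: mult.commute)
  finally show ?thesis
    by (simp add: muckenhoupt_const_def q_def[symmetric] ennreal_mult mult.assoc mult_left_mono)
qed

end

section \<open>From layers to a Riesz potential\<close>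

definition shell :: "real \<Rightarrow> nat \<Rightarrow> real set" where
  "shell \<rho> m = {\<rho> / 2 ^ Suc m..<\<rho> / 2 ^ m}"

lemma sets_shell [measurable]: "shell \<rho> m \<in> sets borel"
  by (simp add: shell_def)

lemma shell_pos: "0 < \<rho> \<Longrightarrow> t \<in> shell \<rho> m \<Longrightarrow> 0 < t"
  unfolding shell_def by (auto intro: less_le_trans[rotated])

lemma disjoint_shell:
  assumes "0 < \<rho>"
  shows "disjoint_family (shell \<rho>)"
proof -
  have "shell \<rho> k \<inter> shell \<rho> m = {}" if "k < m" for k m
  proof -
    have "(2 :: real) ^ Suc k \<le> 2 ^ m" using that by (intro power_increasing) auto
    then have "\<rho> / 2 ^ m \<le> \<rho> / 2 ^ Suc k" using assms by (intro divide_left_mono) auto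
    then show ?thesis unfolding shell_def by auto
  qed
  then show ?thesis unfolding disjoint_family_on_def by (metis inf_commute linorder_neqE_nat)
qed

lemma UN_shell:
  assumes "0 < \<rho>"
  shows "(\<Union>m. shell \<rho> m) = {0<..<\<rho>}"
proof (intro equalityI subsetI)
  fix t assume t: "t \<in> {0<..<\<rho>}"
  obtain k where "(1 / 2) ^ k < t / \<rho>" using real_arch_pow_inv[of "t / \<rho>" "1 / 2"] t assms by auto
  then have ex: "\<rho> / 2 ^ k \<le> t" using assms by (simp add: field_simps power_one_over)
  define m where "m = (LEAST k. \<rho> / 2 ^ k \<le> t)"
  have m: "\<rho> / 2 ^ m \<le> t" unfolding m_def using ex by (rule LeastI)
  have "m \<noteq> 0" using m t by (cases m) auto
  then obtain j where j: "m = Suc j" by (cases m) auto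
  have "\<not> \<rho> / 2 ^ j \<le> t" using not_less_Least[of j "\<lambda>k. \<rho> / 2 ^ k \<le> t"] j by (simp add: m_def)
  then have "t \<in> shell \<rho> j" using m j by (simp add: shell_def)
  then show "t \<in> (\<Union>m. shell \<rho> m)" by blast
next
  fix t assume "t \<in> (\<Union>m. shell \<rho> m)"
  then obtain m where m: "t \<in> shell \<rho> m" by blast
  have "\<rho> / 2 ^ m \<le> \<rho>" using assms by (simp add: field_simps)
  then show "t \<in> {0<..<\<rho>}" using shell_pos[OF assms m] m by (simp add: shell_def)
qed

lemma nn_integral_shells:
  assumes [measurable]: "F \<in> borel_measurable borel" and "0 < \<rho>"
  shows "(\<integral>\<^sup>+t. F t * indicator {0<..<\<rho>} t \<partial>lborel) = (\<Sum>m. \<integral>\<^sup>+t. F t * indicator (shell \<rho> m) t \<partial>lborel)"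
proof -
  have "(\<integral>\<^sup>+t. F t * indicator {0<..<\<rho>} t \<partial>lborel) = (\<integral>\<^sup>+t. (\<Sum>m. F t * indicator (shell \<rho> m) t) \<partial>lborel)"
    using assms by (simp add: suminf_indicator disjoint_shell UN_shell)
  also have "\<dots> = (\<Sum>m. \<integral>\<^sup>+t. F t * indicator (shell \<rho> m) t \<partial>lborel)"
    by (rule nn_integral_suminf) measurable
  finally show ?thesis .
qed

text \<open>The exact value is log 2. With mass at most 1, Hoelder's inequality for dt/t on a shell
  costs no constant.\<close>

lemma nn_integral_inverse_shell:
  assumes "0 < \<rho>"
  shows "(\<integral>\<^sup>+t. ennreal (1 / t) * indicator (shell \<rho> m) t \<partial>lborel) \<le> 1"
proof -
  define r where "r = \<rho> / 2 ^ Suc m"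
  have r: "0 < r" using assms by (simp add: r_def)
  have J: "shell \<rho> m = {r..<2 * r}" by (simp add: shell_def r_def)
  have "(\<integral>\<^sup>+t. ennreal (1 / t) * indicator (shell \<rho> m) t \<partial>lborel)
    \<le> (\<integral>\<^sup>+t. ennreal (1 / r) * indicator {r..<2 * r} t \<partial>lborel)"
    unfolding J using r by (intro nn_integral_mono) (auto simp: indicator_def intro!: ennreal_leI divide_left_mono)
  also have "\<dots> = ennreal (1 / r) * ennreal r" using r by (simp add: nn_integral_cmult)
  also have "\<dots> = 1" using r by (simp add: ennreal_mult[symmetric])
  finally show ?thesis .
qed

lemma suminf_disjoint_le:
  fixes c :: "nat \<Rightarrow> ennreal"
  assumes "disjoint_family A" "\<And>m. y \<in> A m \<Longrightarrow> c m \<le> b"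
  shows "(\<Sum>m. c m * indicator (A m) y) \<le> b"
proof (cases "\<exists>k. y \<in> A k")
  case True
  then obtain k where k: "y \<in> A k" by blast
  have "c m * indicator (A m) y = 0" if "m \<notin> {k}" for m
  proof -
    have "y \<notin> A m" using assms(1) k that unfolding disjoint_family_on_def by blast
    then show ?thesis by simp
  qed
  then have "(\<Sum>m. c m * indicator (A m) y) = (\<Sum>m\<in>{k}. c m * indicator (A m) y)"
    by (intro suminf_finite) auto
  then show ?thesis using k assms(2) by simp
qed simp

text \<open>Counterparts of \<open>layered_energy\<close> and \<open>layered_potential\<close> for
  Borel layers with values in [0, \<infinity>], so that Tonelli's theorem applies directly.\<close>

definition borel_energy :: "real \<Rightarrow> real \<Rightarrow> (real^'n \<Rightarrow> ennreal) \<Rightarrow> ((real^'n) \<times> real \<Rightarrow> ennreal) \<Rightarrow> ennreal" where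
  "borel_energy p \<rho> s f = (\<integral>\<^sup>+t. (\<integral>\<^sup>+y. ennreal_powr (f (y, t)) p * s y \<partial>lborel) * ennreal (1 / t)
     * indicator {0<..<\<rho>} t \<partial>lborel)"

definition borel_potential ::
    "real \<Rightarrow> real \<Rightarrow> (real^'n \<Rightarrow> ennreal) \<Rightarrow> ((real^'n) \<times> real \<Rightarrow> ennreal) \<Rightarrow> real^'n \<Rightarrow> ennreal" where
  "borel_potential \<alpha> \<rho> s f x = (\<integral>\<^sup>+t. (\<integral>\<^sup>+y. f (y, t) * s y * indicator (iball x t) y \<partial>lborel)
     * ennreal (t powr (\<alpha> - real CARD('n)) * (1 / t)) * indicator {0<..<\<rho>} t \<partial>lborel)"

lemma measurable_indicator_iball_radius:
  fixes x :: "real^'n"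
  shows "(\<lambda>(t, y). indicator (iball x t) y :: ennreal) \<in> borel_measurable (borel \<Otimes>\<^sub>M borel)"
proof -
  have inf [measurable]: "(infnorm :: real^'n \<Rightarrow> real) \<in> borel_measurable borel"
    by (intro borel_measurable_continuous_onI continuous_on_infnorm continuous_on_id)
  have "{z \<in> space (borel \<Otimes>\<^sub>M borel). infnorm (x - snd z) < fst z} \<in> sets (borel \<Otimes>\<^sub>M borel)"
    by measurable
  then have "indicator {z. infnorm (x - snd z) < fst z} \<in> (borel_measurable (borel \<Otimes>\<^sub>M borel) :: (_ \<Rightarrow> ennreal) set)"
    by (simp add: space_pair_measure)
  also have "indicator {z. infnorm (x - snd z) < fst z} = (\<lambda>(t, y). indicator (iball x t) y :: ennreal)"
    by (auto simp: indicator_def iball_def fun_eq_iff)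
  finally show ?thesis .
qed

context Ap_weight
begin

text \<open>On a shell, t^(\<alpha>-n) is largest at the lower end and the ball is largest at the
  upper end; after both replacements only the dt/t integral of the layers remains.\<close>

lemma layered_potential_discretize:
  assumes f [measurable]: "f \<in> borel_measurable (borel \<Otimes>\<^sub>M borel)"
    and \<rho>: "0 < \<rho>" and \<alpha>: "\<alpha> < real CARD('n)"
  shows "borel_potential \<alpha> \<rho> s f x
    \<le> (\<Sum>m. ennreal ((\<rho> / 2 ^ Suc m) powr (\<alpha> - real CARD('n)))
        * (\<integral>\<^sup>+y. (\<integral>\<^sup>+t. f (y, t) * (ennreal (1 / t) * indicator (shell \<rho> m) t) \<partial>lborel) * s y
            * indicator (iball x (\<rho> / 2 ^ m)) y \<partial>lborel))"
proof -
  let ?c = "\<lambda>m. ennreal ((\<rho> / 2 ^ Suc m) powr (\<alpha> - real CARD('n)))"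
  let ?B = "\<lambda>m. iball x (\<rho> / 2 ^ m)"
  note measurable_indicator_iball_radius [measurable]
  have "borel_potential \<alpha> \<rho> s f x
    = (\<Sum>m. \<integral>\<^sup>+t. (\<integral>\<^sup>+y. f (y, t) * s y * indicator (iball x t) y \<partial>lborel)
        * ennreal (t powr (\<alpha> - real CARD('n)) * (1 / t)) * indicator (shell \<rho> m) t \<partial>lborel)"
    unfolding borel_potential_def by (intro nn_integral_shells \<rho>) measurable
  also have "\<dots> \<le> (\<Sum>m. ?c m * (\<integral>\<^sup>+y. (\<integral>\<^sup>+t. f (y, t) * (ennreal (1 / t) * indicator (shell \<rho> m) t) \<partial>lborel) * s y
            * indicator (?B m) y \<partial>lborel))"
  proof (intro suminf_le allI summableI)
    fix m
    have "(\<integral>\<^sup>+t. (\<integral>\<^sup>+y. f (y, t) * s y * indicator (iball x t) y \<partial>lborel)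
        * ennreal (t powr (\<alpha> - real CARD('n)) * (1 / t)) * indicator (shell \<rho> m) t \<partial>lborel)
      \<le> (\<integral>\<^sup>+t. (\<integral>\<^sup>+y. f (y, t) * s y * indicator (?B m) y \<partial>lborel)
        * (?c m * (ennreal (1 / t) * indicator (shell \<rho> m) t)) \<partial>lborel)"
    proof (intro nn_integral_mono)
      fix t
      show "(\<integral>\<^sup>+y. f (y, t) * s y * indicator (iball x t) y \<partial>lborel)
          * ennreal (t powr (\<alpha> - real CARD('n)) * (1 / t)) * indicator (shell \<rho> m) t
        \<le> (\<integral>\<^sup>+y. f (y, t) * s y * indicator (?B m) y \<partial>lborel)
          * (?c m * (ennreal (1 / t) * indicator (shell \<rho> m) t))"
      proof (cases "t \<in> shell \<rho> m")
        case True
        then have t: "0 < t" "\<rho> / 2 ^ Suc m \<le> t" "t \<le> \<rho> / 2 ^ m"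
          using shell_pos[OF \<rho> True] by (auto simp: shell_def)
        have "t powr (\<alpha> - real CARD('n)) \<le> (\<rho> / 2 ^ Suc m) powr (\<alpha> - real CARD('n))"
          using t \<alpha> \<rho> by (intro powr_mono2') auto
        then have "ennreal (t powr (\<alpha> - real CARD('n)) * (1 / t)) \<le> ?c m * ennreal (1 / t)"
          using t by (subst ennreal_mult) (auto intro!: mult_right_mono ennreal_leI)
        moreover have "(\<integral>\<^sup>+y. f (y, t) * s y * indicator (iball x t) y \<partial>lborel)
            \<le> (\<integral>\<^sup>+y. f (y, t) * s y * indicator (?B m) y \<partial>lborel)"
          using t by (intro nn_integral_mono mult_left_mono) (auto simp: indicator_def iball_def)
        ultimately show ?thesis using True by (auto intro!: mult_mono)
      qed simp
    qed
    also have "\<dots> = (\<integral>\<^sup>+t. (\<integral>\<^sup>+y. f (y, t) * s y * indicator (?B m) y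
        * (?c m * (ennreal (1 / t) * indicator (shell \<rho> m) t)) \<partial>lborel) \<partial>lborel)"
      by (simp add: nn_integral_multc)
    also have "\<dots> = (\<integral>\<^sup>+y. (\<integral>\<^sup>+t. f (y, t) * s y * indicator (?B m) y
        * (?c m * (ennreal (1 / t) * indicator (shell \<rho> m) t)) \<partial>lborel) \<partial>lborel)"
      by (rule lborel_pair.Fubini') measurable
    also have "\<dots> = (\<integral>\<^sup>+y. (\<integral>\<^sup>+t. ?c m * (s y * indicator (?B m) y)
        * (f (y, t) * (ennreal (1 / t) * indicator (shell \<rho> m) t)) \<partial>lborel) \<partial>lborel)"
      by (simp only: mult_ac)
    also have "\<dots> = (\<integral>\<^sup>+y. ?c m * ((\<integral>\<^sup>+t. f (y, t) * (ennreal (1 / t) * indicator (shell \<rho> m) t) \<partial>lborel) * s y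
            * indicator (?B m) y) \<partial>lborel)"
      by (intro nn_integral_cong, subst nn_integral_cmult, measurable) (simp only: mult_ac)
    also have "\<dots> = ?c m * (\<integral>\<^sup>+y. (\<integral>\<^sup>+t. f (y, t) * (ennreal (1 / t) * indicator (shell \<rho> m) t) \<partial>lborel) * s y
            * indicator (?B m) y \<partial>lborel)"
      by (rule nn_integral_cmult) measurable
    finally show "(\<integral>\<^sup>+t. (\<integral>\<^sup>+y. f (y, t) * s y * indicator (iball x t) y \<partial>lborel)
        * ennreal (t powr (\<alpha> - real CARD('n)) * (1 / t)) * indicator (shell \<rho> m) t \<partial>lborel)
      \<le> ?c m * (\<integral>\<^sup>+y. (\<integral>\<^sup>+t. f (y, t) * (ennreal (1 / t) * indicator (shell \<rho> m) t) \<partial>lborel) * s y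
            * indicator (?B m) y \<partial>lborel)" .
  qed
  finally show ?thesis .
qed

text \<open>Hoelder's inequality in the scale variable on each shell.\<close>

lemma layered_energy_discretize:
  assumes f [measurable]: "f \<in> borel_measurable (borel \<Otimes>\<^sub>M borel)" and \<rho>: "0 < \<rho>"
  shows "(\<Sum>m. \<integral>\<^sup>+y. ennreal_powr (\<integral>\<^sup>+t. f (y, t) * (ennreal (1 / t) * indicator (shell \<rho> m) t) \<partial>lborel) p * s y \<partial>lborel)
    \<le> borel_energy p \<rho> s f"
proof -
  have "borel_energy p \<rho> s f
    = (\<Sum>m. \<integral>\<^sup>+t. (\<integral>\<^sup>+y. ennreal_powr (f (y, t)) p * s y \<partial>lborel) * ennreal (1 / t) * indicator (shell \<rho> m) t \<partial>lborel)"
    unfolding borel_energy_def by (intro nn_integral_shells \<rho>) measurable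
  also have "\<dots> = (\<Sum>m. \<integral>\<^sup>+y. (\<integral>\<^sup>+t. ennreal_powr (f (y, t)) p * (ennreal (1 / t) * indicator (shell \<rho> m) t) \<partial>lborel) * s y \<partial>lborel)"
  proof (intro suminf_cong)
    fix m
    have "(\<integral>\<^sup>+t. (\<integral>\<^sup>+y. ennreal_powr (f (y, t)) p * s y \<partial>lborel) * ennreal (1 / t) * indicator (shell \<rho> m) t \<partial>lborel)
      = (\<integral>\<^sup>+t. (\<integral>\<^sup>+y. ennreal_powr (f (y, t)) p * s y * (ennreal (1 / t) * indicator (shell \<rho> m) t) \<partial>lborel) \<partial>lborel)"
      by (intro nn_integral_cong, subst nn_integral_multc) (auto simp: mult.assoc)
    also have "\<dots> = (\<integral>\<^sup>+y. (\<integral>\<^sup>+t. ennreal_powr (f (y, t)) p * s y * (ennreal (1 / t) * indicator (shell \<rho> m) t) \<partial>lborel) \<partial>lborel)"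
      by (rule lborel_pair.Fubini') measurable
    also have "\<dots> = (\<integral>\<^sup>+y. (\<integral>\<^sup>+t. ennreal_powr (f (y, t)) p * (ennreal (1 / t) * indicator (shell \<rho> m) t) * s y \<partial>lborel) \<partial>lborel)"
      by (simp only: mult_ac)
    also have "\<dots> = (\<integral>\<^sup>+y. (\<integral>\<^sup>+t. ennreal_powr (f (y, t)) p * (ennreal (1 / t) * indicator (shell \<rho> m) t) \<partial>lborel) * s y \<partial>lborel)"
      by (simp add: nn_integral_multc)
    finally show "(\<integral>\<^sup>+t. (\<integral>\<^sup>+y. ennreal_powr (f (y, t)) p * s y \<partial>lborel) * ennreal (1 / t) * indicator (shell \<rho> m) t \<partial>lborel)
      = (\<integral>\<^sup>+y. (\<integral>\<^sup>+t. ennreal_powr (f (y, t)) p * (ennreal (1 / t) * indicator (shell \<rho> m) t) \<partial>lborel) * s y \<partial>lborel)" .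
  qed
  finally have eq: "borel_energy p \<rho> s f
    = (\<Sum>m. \<integral>\<^sup>+y. (\<integral>\<^sup>+t. ennreal_powr (f (y, t)) p * (ennreal (1 / t) * indicator (shell \<rho> m) t) \<partial>lborel) * s y \<partial>lborel)" .
  show ?thesis unfolding eq
  proof (intro suminf_le allI summableI nn_integral_mono mult_right_mono)
    fix m y
    let ?u = "\<lambda>t. ennreal (1 / t) * indicator (shell \<rho> m) t :: ennreal"
    have "ennreal_powr (\<integral>\<^sup>+t. f (y, t) * ?u t \<partial>lborel) p
      \<le> (\<integral>\<^sup>+t. ennreal_powr (f (y, t)) p * ?u t \<partial>lborel) * ennreal_powr (\<integral>\<^sup>+t. ?u t \<partial>lborel) (p - 1)"
      using p by (intro Holder_weighted) auto
    also have "\<dots> \<le> (\<integral>\<^sup>+t. ennreal_powr (f (y, t)) p * ?u t \<partial>lborel) * ennreal_powr 1 (p - 1)"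
      using p \<rho> by (intro mult_left_mono ennreal_powr_mono nn_integral_inverse_shell) auto
    finally show "ennreal_powr (\<integral>\<^sup>+t. f (y, t) * ?u t \<partial>lborel) p
      \<le> (\<integral>\<^sup>+t. ennreal_powr (f (y, t)) p * ?u t \<partial>lborel)" by simp
  qed simp
qed

text \<open>If \<open>y\<close> lies in the shell of radius about \<open>r\<close> around \<open>x\<close>, then the \<open>2 r\<close>-ball about \<open>y\<close> contains
  the \<open>r\<close>-ball about \<open>x\<close>. Hence the \<open>l\<^sup>p\<close>-sum over the dyadic scales of the averages of the layers is a
  function whose Riesz potential dominates the layered potential.\<close>

theorem riesz_dominates_layered:
  assumes f [measurable]: "f \<in> borel_measurable (borel \<Otimes>\<^sub>M borel)"
    and \<rho>: "0 < \<rho>" "4 * \<rho> \<le> R" and \<alpha>: "\<alpha> < real CARD('n)"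
  obtains g where "g \<in> borel_measurable borel"
    "(\<integral>\<^sup>+y. ennreal_powr (g y) p * w y \<partial>lborel)
      \<le> ennreal (2 powr ((real CARD('n) - \<alpha>) * p) * K * 4 powr (real CARD('n) * p)) * borel_energy p \<rho> s f"
    "\<And>x. borel_potential \<alpha> \<rho> s f x \<le> (\<integral>\<^sup>+y. ennreal (riesz_kernel \<alpha> \<rho> (x - y)) * g y \<partial>lborel)"
proof -
  let ?N = "real CARD('n)"
  define r where "r m = \<rho> / 2 ^ m" for m :: nat
  have r: "0 < r m" "r m \<le> \<rho>" for m using \<rho> by (auto simp: r_def field_simps)
  have rS: "r (Suc m) = r m / 2" for m by (simp add: r_def)
  define G where "G m y = (\<integral>\<^sup>+t. f (y, t) * (ennreal (1 / t) * indicator (shell \<rho> m) t) \<partial>lborel)" for m y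
  have G [measurable]: "G m \<in> borel_measurable borel" for m unfolding G_def[abs_def] by measurable
  define T where "T m y = (\<integral>\<^sup>+z. G m z * s z * indicator (iball y (2 * r m)) z \<partial>lborel)" for m y
  have T [measurable]: "T m \<in> borel_measurable borel" for m unfolding T_def[abs_def] by measurable
  \<comment> \<open>The ratio of t^(\<alpha>-n) at the lower end of a shell to its value at the
    upper end.\<close>
  define c where "c = 2 powr (?N - \<alpha>)"
  have c: "0 < c" by (simp add: c_def)
  \<comment> \<open>With p-th powers the energy splits into single scales, while any one summand is
    a lower bound for the whole. The factor normalizes the ball average inside the power.\<close>
  define Z where "Z y = (\<Sum>m. ennreal (r m powr - (?N * p)) * ennreal_powr (T m y) p)" for y
  have Z [measurable]: "Z \<in> borel_measurable borel" unfolding Z_def[abs_def] by measurable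
  define g where "g y = ennreal c * ennreal_powr (Z y) (1 / p)" for y
  have g [measurable]: "g \<in> borel_measurable borel" unfolding g_def[abs_def] by measurable
  have "ennreal_powr (g y) p = ennreal (c powr p) * Z y" for y
    using p c by (simp add: g_def ennreal_powr_mult ennreal_powr_powr)
  then have "(\<integral>\<^sup>+y. ennreal_powr (g y) p * w y \<partial>lborel) = ennreal (c powr p) * (\<integral>\<^sup>+y. Z y * w y \<partial>lborel)"
    by (simp add: nn_integral_cmult mult.assoc)
  also have "(\<integral>\<^sup>+y. Z y * w y \<partial>lborel) = (\<integral>\<^sup>+y. (\<Sum>m. ennreal (r m powr - (?N * p)) * (ennreal_powr (T m y) p * w y)) \<partial>lborel)"
    by (simp add: Z_def mult.assoc flip: ennreal_suminf_multc)
  also have "\<dots> = (\<Sum>m. ennreal (r m powr - (?N * p)) * (\<integral>\<^sup>+y. ennreal_powr (T m y) p * w y \<partial>lborel))"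
    by (subst nn_integral_suminf) (simp_all add: nn_integral_cmult)
  also have "\<dots> \<le> (\<Sum>m. ennreal (K * 4 powr (?N * p)) * (\<integral>\<^sup>+y. ennreal_powr (G m y) p * s y \<partial>lborel))"
  proof (intro suminf_le allI summableI)
    \<comment> \<open>The averages run over balls of radius 2 r, and
      \<open>ball_average_bound\<close> doubles the radius again; this is the origin of 4 \<rho> <=
      R and of 4^(n p).\<close>
    fix m
    have "(\<integral>\<^sup>+y. ennreal_powr (T m y) p * w y \<partial>lborel)
      \<le> ennreal (K * (2 * (2 * r m)) powr (?N * p)) * (\<integral>\<^sup>+y. ennreal_powr (G m y) p * s y \<partial>lborel)"
      unfolding T_def using r[of m] \<rho> by (intro ball_average_bound) auto
    then have "ennreal (r m powr - (?N * p)) * (\<integral>\<^sup>+y. ennreal_powr (T m y) p * w y \<partial>lborel)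
      \<le> ennreal (r m powr - (?N * p)) * (ennreal (K * (2 * (2 * r m)) powr (?N * p)) * (\<integral>\<^sup>+y. ennreal_powr (G m y) p * s y \<partial>lborel))"
      by (rule mult_left_mono) simp
    also have "\<dots> = ennreal (r m powr - (?N * p) * (K * (2 * (2 * r m)) powr (?N * p))) * (\<integral>\<^sup>+y. ennreal_powr (G m y) p * s y \<partial>lborel)"
      using K by (simp add: ennreal_mult mult.assoc)
    also have "r m powr - (?N * p) * (K * (2 * (2 * r m)) powr (?N * p)) = K * 4 powr (?N * p)"
      using r(1)[of m] powr_mult[of 4 "r m" "?N * p"] by (simp add: powr_minus field_simps)
    finally show "ennreal (r m powr - (?N * p)) * (\<integral>\<^sup>+y. ennreal_powr (T m y) p * w y \<partial>lborel)
      \<le> ennreal (K * 4 powr (?N * p)) * (\<integral>\<^sup>+y. ennreal_powr (G m y) p * s y \<partial>lborel)" .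
  qed
  also have "\<dots> = ennreal (K * 4 powr (?N * p)) * (\<Sum>m. \<integral>\<^sup>+y. ennreal_powr (G m y) p * s y \<partial>lborel)"
    by simp
  also have "\<dots> \<le> ennreal (K * 4 powr (?N * p)) * borel_energy p \<rho> s f"
    unfolding G_def using \<rho> by (intro mult_left_mono layered_energy_discretize f) auto
  finally have energy: "(\<integral>\<^sup>+y. ennreal_powr (g y) p * w y \<partial>lborel)
      \<le> ennreal (2 powr ((?N - \<alpha>) * p) * K * 4 powr (?N * p)) * borel_energy p \<rho> s f"
    using K by (simp add: c_def powr_powr ennreal_mult mult.assoc mult_left_mono)
  have pot: "borel_potential \<alpha> \<rho> s f x \<le> (\<integral>\<^sup>+y. ennreal (riesz_kernel \<alpha> \<rho> (x - y)) * g y \<partial>lborel)" for x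
  proof -
    define A where "A m = (\<lambda>y. infnorm (x - y)) -` shell \<rho> m" for m
    have disj: "disjoint_family A"
      using disjoint_shell[OF \<rho>(1)] unfolding A_def disjoint_family_on_def by blast
    have A_eq: "A m = iball x (r m) - iball x (r (Suc m))" for m
      by (auto simp: A_def shell_def iball_def r_def)
    have A [measurable]: "A m \<in> sets borel" for m by (simp add: A_eq)
    \<comment> \<open>The exact volume of the annulus is (2^n - 1) r^n.\<close>
    have eA: "ennreal (r m ^ CARD('n)) \<le> emeasure lborel (A m)" for m
    proof -
      have sub: "iball x (r (Suc m)) \<subseteq> iball x (r m)" using r[of m] by (auto simp: iball_def rS)
      have "emeasure lborel (A m) = emeasure lborel (iball x (r m)) - emeasure lborel (iball x (r (Suc m)))"
        unfolding A_eq using sub r(1)[of "Suc m"]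
        by (intro emeasure_Diff) (auto simp: emeasure_iball less_imp_le)
      also have "\<dots> = ennreal ((2 * r m) ^ CARD('n) - r m ^ CARD('n))"
        using r(1)[of m] by (simp add: emeasure_iball rS ennreal_minus less_imp_le)
      finally have eq: "emeasure lborel (A m) = ennreal ((2 * r m) ^ CARD('n) - r m ^ CARD('n))" .
      have "(2 :: real) ^ 1 \<le> 2 ^ CARD('n)" by (intro power_increasing) (auto simp: Suc_le_eq)
      then have "2 * r m ^ CARD('n) \<le> 2 ^ CARD('n) * r m ^ CARD('n)"
        using r(1)[of m] by (intro mult_right_mono) auto
      then show ?thesis unfolding eq by (intro ennreal_leI) (simp add: power_mult_distrib)
    qed
    let ?V = "\<lambda>m. \<integral>\<^sup>+y. G m y * s y * indicator (iball x (r m)) y \<partial>lborel"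
    have g_ge: "ennreal (c * r m powr - ?N) * ?V m \<le> g y" if y: "y \<in> A m" for y m
    proof -
      have "x \<in> iball y (r m)" using y by (simp add: A_eq iball_sym[of y])
      then have "iball x (r m) \<subseteq> iball y (2 * r m)"
        using iball_triangle[of x y "r m" _ "r m"] by auto
      then have VT: "?V m \<le> T m y"
        unfolding T_def by (intro nn_integral_mono mult_left_mono) (auto simp: indicator_def)
      have "ennreal (r m powr - (?N * p)) * ennreal_powr (T m y) p \<le> Z y"
        unfolding Z_def using sum_le_suminf[of "\<lambda>m. ennreal (r m powr - (?N * p)) * ennreal_powr (T m y) p" "{m}"]
        by simp
      then have "ennreal_powr (ennreal (r m powr - (?N * p)) * ennreal_powr (T m y) p) (1 / p) \<le> ennreal_powr (Z y) (1 / p)"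
        using p by (intro ennreal_powr_mono) auto
      also have "ennreal_powr (ennreal (r m powr - (?N * p)) * ennreal_powr (T m y) p) (1 / p) = ennreal (r m powr - ?N) * T m y"
        using p by (simp add: ennreal_powr_mult ennreal_powr_powr powr_powr)
      finally have "ennreal (r m powr - ?N) * ?V m \<le> ennreal_powr (Z y) (1 / p)"
        using mult_left_mono[OF VT, of "ennreal (r m powr - ?N)"] by simp
      then show ?thesis
        unfolding g_def using c by (simp add: ennreal_mult mult.assoc mult_left_mono)
    qed
    have "borel_potential \<alpha> \<rho> s f x \<le> (\<Sum>m. ennreal (r (Suc m) powr (\<alpha> - ?N)) * ?V m)"
      unfolding G_def r_def using \<rho> \<alpha> by (intro layered_potential_discretize f)
    also have "\<dots> \<le> (\<Sum>m. \<integral>\<^sup>+y. ennreal (r m powr (\<alpha> - ?N)) * indicator (A m) y * g y \<partial>lborel)"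
    proof (intro suminf_le allI summableI)
      fix m
      \<comment> \<open>The factor r^(-n) r^n is inserted: r^(-n) normalizes the average that
        \<open>g\<close> dominates, and r^n is paid for by the volume of the annulus.\<close>
      have "r (Suc m) powr (\<alpha> - ?N) = r m powr (\<alpha> - ?N) * c"
        using r(1)[of m] by (simp add: rS c_def powr_divide powr_diff field_simps)
      also have "\<dots> = r m powr (\<alpha> - ?N) * (c * r m powr - ?N) * r m ^ CARD('n)"
        using r(1)[of m] by (simp add: powr_minus powr_realpow)
      finally have "ennreal (r (Suc m) powr (\<alpha> - ?N)) * ?V m
        = ennreal (r m powr (\<alpha> - ?N)) * (ennreal (c * r m powr - ?N) * ?V m) * ennreal (r m ^ CARD('n))"
        using c r(1)[of m] by (simp add: ennreal_mult) (simp only: mult_ac)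
      also have "\<dots> \<le> ennreal (r m powr (\<alpha> - ?N)) * (ennreal (c * r m powr - ?N) * ?V m) * emeasure lborel (A m)"
        by (intro mult_left_mono eA) simp
      also have "\<dots> = (\<integral>\<^sup>+y. ennreal (r m powr (\<alpha> - ?N)) * (ennreal (c * r m powr - ?N) * ?V m) * indicator (A m) y \<partial>lborel)"
        by (subst nn_integral_cmult_indicator) auto
      also have "\<dots> \<le> (\<integral>\<^sup>+y. ennreal (r m powr (\<alpha> - ?N)) * indicator (A m) y * g y \<partial>lborel)"
        using g_ge[of _ m] by (intro nn_integral_mono) (auto simp: indicator_def intro!: mult_left_mono)
      finally show "ennreal (r (Suc m) powr (\<alpha> - ?N)) * ?V m
        \<le> (\<integral>\<^sup>+y. ennreal (r m powr (\<alpha> - ?N)) * indicator (A m) y * g y \<partial>lborel)" .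
    qed
    also have "\<dots> = (\<integral>\<^sup>+y. (\<Sum>m. ennreal (r m powr (\<alpha> - ?N)) * indicator (A m) y * g y) \<partial>lborel)"
      by (rule nn_integral_suminf[symmetric]) measurable
    also have "\<dots> = (\<integral>\<^sup>+y. (\<Sum>m. ennreal (r m powr (\<alpha> - ?N)) * indicator (A m) y) * g y \<partial>lborel)"
      by simp
    also have "\<dots> \<le> (\<integral>\<^sup>+y. ennreal (riesz_kernel \<alpha> \<rho> (x - y)) * g y \<partial>lborel)"
    proof (intro nn_integral_mono mult_right_mono suminf_disjoint_le disj ennreal_leI)
      fix y m assume y: "y \<in> A m"
      then have inf: "r (Suc m) \<le> infnorm (x - y)" "infnorm (x - y) < r m"
        by (auto simp: A_eq iball_def)
      have "r m powr (\<alpha> - ?N) \<le> infnorm (x - y) powr (\<alpha> - ?N)"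
        using inf r(1)[of "Suc m"] \<alpha> by (intro powr_mono2') auto
      then show "r m powr (\<alpha> - ?N) \<le> riesz_kernel \<alpha> \<rho> (x - y)"
        using inf r(2)[of m] by (simp add: riesz_kernel_def)
    qed simp
    finally show ?thesis .
  qed
  show thesis using that[OF g energy pot] .
qed

end

section \<open>From a Riesz potential to layers\<close>

lemma three_mult_neq_power_two: "3 * i \<noteq> (2 :: int) ^ m"
proof (induction m arbitrary: i)
  case (Suc m)
  show ?case
  proof
    assume "3 * i = 2 ^ Suc m"
    then have "3 * i = 2 * 2 ^ m" by simp
    moreover from this have "even (3 * i)" by simp
    then obtain j where "i = 2 * j" by (auto elim: evenE)
    ultimately have "3 * j = 2 ^ m" by simp
    then show False using Suc by blast
  qed
next
  case 0
  have "3 * i \<noteq> 1" by presburger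
  then show ?case by simp
qed

text \<open>The one-third trick: the lattices \<open>\<int>\<close> and \<open>\<int> + 2 ^ m / 3\<close> have distance \<open>1 / 3\<close>, so an interval
  of length less than \<open>1 / 3\<close> cannot meet both.\<close>

lemma floor_eq_or_third_shift:
  fixes u t :: real
  assumes "\<bar>u - t\<bar> < 1 / 3"
  shows "\<lfloor>u\<rfloor> = \<lfloor>t\<rfloor> \<or> \<lfloor>u - 2 ^ m / 3\<rfloor> = \<lfloor>t - 2 ^ m / 3\<rfloor>"
proof -
  have *: "\<lfloor>u\<rfloor> = \<lfloor>t\<rfloor> \<or> \<lfloor>u - 2 ^ m / 3\<rfloor> = \<lfloor>t - 2 ^ m / 3\<rfloor>"
    if "u \<le> t" "t - u < 1 / 3" for u t :: real
  proof (rule ccontr)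
    assume "\<not> ?thesis"
    moreover have "\<lfloor>u\<rfloor> \<le> \<lfloor>t\<rfloor>" "\<lfloor>u - 2 ^ m / 3\<rfloor> \<le> \<lfloor>t - 2 ^ m / 3\<rfloor>"
      using that by (auto intro!: floor_mono)
    ultimately have less: "\<lfloor>u\<rfloor> < \<lfloor>t\<rfloor>" "\<lfloor>u - 2 ^ m / 3\<rfloor> < \<lfloor>t - 2 ^ m / 3\<rfloor>" by auto
    define j where "j = \<lfloor>t\<rfloor>"
    define k where "k = \<lfloor>t - 2 ^ m / 3\<rfloor>"
    have "u < of_int j" "of_int j \<le> t" using less by (simp_all add: j_def floor_less_iff)
    moreover have "u - 2 ^ m / 3 < of_int k" "of_int k \<le> t - 2 ^ m / 3"
      using less by (simp_all add: k_def floor_less_iff)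
    \<comment> \<open>Both j and k + 2^m/3 lie in the interval from u to t, of length less than 1/3;
      three times their difference is an integer of modulus less than 1.\<close>
    ultimately have "\<bar>of_int (3 * (j - k) - 2 ^ m) :: real\<bar> < 1" using that by auto
    then have "\<bar>3 * (j - k) - 2 ^ m\<bar> < 1" by linarith
    then have "3 * (j - k) = 2 ^ m" by simp
    then show False using three_mult_neq_power_two by blast
  qed
  show ?thesis
    using *[of u t] *[of t u] assms by (cases "u \<le> t") auto
qed

text \<open>The same translation serves all levels, which keeps each grid nested. In units of the
  mesh \<open>L / 2 ^ m\<close> it is 2^m/3, never within 1/3 of the unshifted lattice.\<close>

definition third_shift :: "real \<Rightarrow> 'n set \<Rightarrow> real^'n" where
  "third_shift L S = (\<chi> i. if i \<in> S then L / 3 else 0)"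

text \<open>The dichotomy for floors is applied to each coordinate; \<open>S\<close> collects the
  coordinates in which the unshifted grid separates the points.\<close>

lemma same_cell_third_shift:
  fixes x y :: "real^'n"
  assumes L: "0 < L" and less: "infnorm (x - y) < L / 3 / 2 ^ m"
  shows "\<exists>S. same_cell (third_shift L S) (L / 2 ^ m) x y"
proof
  define l where "l = L / 2 ^ m"
  have l: "0 < l" using L by (simp add: l_def)
  let ?S = "{i. \<lfloor>x $ i / l\<rfloor> \<noteq> \<lfloor>y $ i / l\<rfloor>}"
  have "\<lfloor>(x $ i - third_shift L ?S $ i) / l\<rfloor> = \<lfloor>(y $ i - third_shift L ?S $ i) / l\<rfloor>" for i
  proof (cases "i \<in> ?S")
    case True
    have "infnorm (x - y) < l / 3" using less by (simp add: l_def mult.commute)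
    then have "\<bar>x $ i - y $ i\<bar> < l / 3"
      using component_le_infnorm_cart[of "x - y" i] by simp
    then have "\<bar>x $ i / l - y $ i / l\<bar> < 1 / 3"
      using l by (simp add: diff_divide_distrib[symmetric] abs_divide field_simps)
    then have "\<lfloor>x $ i / l - 2 ^ m / 3\<rfloor> = \<lfloor>y $ i / l - 2 ^ m / 3\<rfloor>"
      using floor_eq_or_third_shift True by blast
    moreover have "third_shift L ?S $ i / l = 2 ^ m / 3" using True L by (simp add: third_shift_def l_def)
    ultimately show ?thesis by (simp only: diff_divide_distrib)
  qed (simp add: third_shift_def)
  then show "same_cell (third_shift L ?S) (L / 2 ^ m) x y"
    by (simp add: same_cell_def l_def)
qed

text \<open>Abel summation, with the nonnegative boundary term r^(N+1) z_N discarded. In a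
  geometrically weighted sum, passing to increments costs only the factor 1 - r.\<close>

lemma suminf_increment_ge:
  fixes r :: real
  assumes r: "0 < r" "r < 1" and z: "incseq z" "\<And>k. z k < top"
  shows "ennreal (1 - r) * (\<Sum>m. ennreal (r ^ m) * z m) \<le> (\<Sum>m. ennreal (r ^ m) * increment z m)"
proof -
  have abel: "ennreal (1 - r) * (\<Sum>m\<le>N. ennreal (r ^ m) * z m) + ennreal (r ^ Suc N) * z N
      = (\<Sum>m\<le>N. ennreal (r ^ m) * increment z m)" for N
  proof (induction N)
    case 0
    have "ennreal (1 - r) + ennreal r = 1" using r by (simp flip: ennreal_plus)
    then show ?case by (simp flip: distrib_right)
  next
    case (Suc N)
    have zS: "z (Suc N) = z N + increment z (Suc N)"
      using z(1) by (simp add: ennreal_ineq_diff_add[symmetric] incseqD)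
    have "ennreal (1 - r) * ennreal (r ^ Suc N) + ennreal (r ^ Suc (Suc N)) = ennreal (r ^ Suc N)"
      using r by (simp add: algebra_simps flip: ennreal_mult ennreal_plus)
    then have eq: "ennreal (1 - r) * (ennreal (r ^ Suc N) * z (Suc N)) + ennreal (r ^ Suc (Suc N)) * z (Suc N)
        = ennreal (r ^ Suc N) * z (Suc N)"
      by (metis distrib_right mult.assoc)
    have "ennreal (1 - r) * (\<Sum>m\<le>Suc N. ennreal (r ^ m) * z m) + ennreal (r ^ Suc (Suc N)) * z (Suc N)
        = ennreal (1 - r) * (\<Sum>m\<le>N. ennreal (r ^ m) * z m) + ennreal (r ^ Suc N) * z (Suc N)"
      using eq by (simp only: sum.atMost_Suc distrib_left add.assoc)
    also have "\<dots> = (\<Sum>m\<le>N. ennreal (r ^ m) * increment z m) + ennreal (r ^ Suc N) * increment z (Suc N)"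
      unfolding zS distrib_left Suc.IH[symmetric] by (simp only: add.assoc)
    finally show ?case by simp
  qed
  have "(\<Sum>m. ennreal (1 - r) * (ennreal (r ^ m) * z m)) \<le> (\<Sum>m. ennreal (r ^ m) * increment z m)"
  proof (rule suminf_le_const[OF summableI])
    fix n
    have "(\<Sum>m<n. ennreal (1 - r) * (ennreal (r ^ m) * z m)) \<le> ennreal (1 - r) * (\<Sum>m\<le>n. ennreal (r ^ m) * z m)"
      unfolding sum_distrib_left[symmetric] by (intro mult_left_mono sum_mono2) auto
    also have "\<dots> \<le> (\<Sum>m\<le>n. ennreal (r ^ m) * increment z m)"
      unfolding abel[symmetric] by (rule add_increasing2) simp_all
    also have "\<dots> \<le> (\<Sum>m. ennreal (r ^ m) * increment z m)"
      by (intro sum_le_suminf summableI) auto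
    finally show "(\<Sum>m<n. ennreal (1 - r) * (ennreal (r ^ m) * z m)) \<le> (\<Sum>m. ennreal (r ^ m) * increment z m)" .
  qed
  then show ?thesis by simp
qed

text \<open>The factor 6^(n-\<alpha>) comes from comparing the kernel with dyadic scales. In the
  denominator, 1/2 is the relative length of a shell, 2^(\<alpha>-n) arises because its upper end is
  twice the mesh, and the last factor is the loss in Abel summation.\<close>

definition layer_const :: "real \<Rightarrow> real \<Rightarrow> real" where
  "layer_const n \<alpha> = 6 powr (n - \<alpha>) / (1 / 2 * 2 powr (\<alpha> - n) * (1 - 2 powr - \<alpha>))"

context pos_weight
begin

text \<open>Constant in \<open>t\<close> on each shell. Division by \<open>s\<close> makes the
  potential see \<open>H m\<close> itself, and the energy see the integral of H^p w, by s^p w =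
  s.\<close>

definition layer :: "real \<Rightarrow> (nat \<Rightarrow> real^'n \<Rightarrow> ennreal) \<Rightarrow> (real^'n) \<times> real \<Rightarrow> ennreal" where
  "layer \<rho> H = (\<lambda>(y, t). (\<Sum>m. H m y * indicator (shell \<rho> m) t) * inverse (s y))"

lemma layer_eq:
  assumes "0 < \<rho>" "t \<in> shell \<rho> m"
  shows "layer \<rho> H (y, t) = H m y * inverse (s y)"
proof -
  have "H k y * indicator (shell \<rho> k) t = 0" if "k \<notin> {m}" for k
  proof -
    have "t \<notin> shell \<rho> k" using disjoint_shell[OF assms(1)] assms(2) that unfolding disjoint_family_on_def by blast
    then show ?thesis by simp
  qed
  then have "(\<Sum>k. H k y * indicator (shell \<rho> k) t) = (\<Sum>k\<in>{m}. H k y * indicator (shell \<rho> k) t)"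
    by (intro suminf_finite) auto
  then show ?thesis using assms(2) by (simp add: layer_def)
qed

lemma s_not_top: "s y \<noteq> top"
  by (simp add: s_def)

lemma inverse_s_mult: "inverse (s y) * s y = 1"
  using s_nz s_not_top by (metis divide_ennreal_def ennreal_divide_self mult.commute top.not_eq_extremum)

lemma measurable_layer [measurable]:
  assumes [measurable]: "\<And>m. H m \<in> borel_measurable borel"
  shows "layer \<rho> H \<in> borel_measurable (borel \<Otimes>\<^sub>M borel)"
  unfolding layer_def by measurable

lemma layer_energy_le:
  assumes [measurable]: "\<And>m. H m \<in> borel_measurable borel" and \<rho>: "0 < \<rho>"
  shows "borel_energy p \<rho> s (layer \<rho> H) \<le> (\<Sum>m. \<integral>\<^sup>+y. ennreal_powr (H m y) p * w y \<partial>lborel)"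
proof -
  have "borel_energy p \<rho> s (layer \<rho> H)
    = (\<Sum>m. \<integral>\<^sup>+t. (\<integral>\<^sup>+y. ennreal_powr (layer \<rho> H (y, t)) p * s y \<partial>lborel) * ennreal (1 / t) * indicator (shell \<rho> m) t \<partial>lborel)"
    unfolding borel_energy_def by (intro nn_integral_shells \<rho>) measurable
  also have "\<dots> \<le> (\<Sum>m. \<integral>\<^sup>+y. ennreal_powr (H m y) p * w y \<partial>lborel)"
  proof (intro suminf_le allI summableI)
    fix m
    let ?I = "\<integral>\<^sup>+y. ennreal_powr (H m y) p * w y \<partial>lborel"
    have "ennreal_powr (layer \<rho> H (y, t)) p * s y = ennreal_powr (H m y) p * w y" if "t \<in> shell \<rho> m" for y t
      using w_mult_ennreal_powr[of "layer \<rho> H (y, t)" y] layer_eq[OF \<rho> that]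
      by (simp add: mult.assoc inverse_s_mult)
    then have "(\<integral>\<^sup>+t. (\<integral>\<^sup>+y. ennreal_powr (layer \<rho> H (y, t)) p * s y \<partial>lborel) * ennreal (1 / t) * indicator (shell \<rho> m) t \<partial>lborel)
      = (\<integral>\<^sup>+t. ?I * (ennreal (1 / t) * indicator (shell \<rho> m) t) \<partial>lborel)"
      by (intro nn_integral_cong) (auto simp: indicator_def)
    also have "\<dots> = ?I * (\<integral>\<^sup>+t. ennreal (1 / t) * indicator (shell \<rho> m) t \<partial>lborel)"
      by (simp add: nn_integral_cmult)
    also have "\<dots> \<le> ?I * 1"
      by (intro mult_left_mono nn_integral_inverse_shell \<rho>) simp
    finally show "(\<integral>\<^sup>+t. (\<integral>\<^sup>+y. ennreal_powr (layer \<rho> H (y, t)) p * s y \<partial>lborel) * ennreal (1 / t) * indicator (shell \<rho> m) t \<partial>lborel)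
      \<le> ?I" by simp
  qed
  finally show ?thesis .
qed

text \<open>On the shell from r/2 to r the factor t^(\<alpha>-n-1) is at least r^(\<alpha>-n-1), the
  length is r/2, and every ball contains the one of radius r/2.\<close>

lemma layer_potential_ge:
  assumes [measurable]: "\<And>m. H m \<in> borel_measurable borel" and \<rho>: "0 < \<rho>" and \<alpha>: "\<alpha> < real CARD('n)"
  shows "(\<Sum>m. ennreal (1 / 2 * (\<rho> / 2 ^ m) powr (\<alpha> - real CARD('n)))
      * (\<integral>\<^sup>+y. H m y * indicator (iball x (\<rho> / 2 ^ Suc m)) y \<partial>lborel))
    \<le> borel_potential \<alpha> \<rho> s (layer \<rho> H) x"
proof -
  note measurable_indicator_iball_radius [measurable]
  have "borel_potential \<alpha> \<rho> s (layer \<rho> H) x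
    = (\<Sum>m. \<integral>\<^sup>+t. (\<integral>\<^sup>+y. layer \<rho> H (y, t) * s y * indicator (iball x t) y \<partial>lborel)
        * ennreal (t powr (\<alpha> - real CARD('n)) * (1 / t)) * indicator (shell \<rho> m) t \<partial>lborel)"
    unfolding borel_potential_def by (intro nn_integral_shells \<rho>) measurable
  moreover have "ennreal (1 / 2 * (\<rho> / 2 ^ m) powr (\<alpha> - real CARD('n)))
      * (\<integral>\<^sup>+y. H m y * indicator (iball x (\<rho> / 2 ^ Suc m)) y \<partial>lborel)
    \<le> (\<integral>\<^sup>+t. (\<integral>\<^sup>+y. layer \<rho> H (y, t) * s y * indicator (iball x t) y \<partial>lborel)
        * ennreal (t powr (\<alpha> - real CARD('n)) * (1 / t)) * indicator (shell \<rho> m) t \<partial>lborel)" for m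
  proof -
    define r where "r = \<rho> / 2 ^ m"
    have r: "0 < r" "\<rho> / 2 ^ Suc m = r / 2" using \<rho> by (simp_all add: r_def)
    have J: "shell \<rho> m = {r / 2..<r}" by (simp add: shell_def r_def mult.commute)
    let ?X = "\<integral>\<^sup>+y. H m y * indicator (iball x (r / 2)) y \<partial>lborel"
    let ?c = "ennreal (r powr (\<alpha> - real CARD('n)) * (1 / r))"
    have "ennreal (1 / 2 * r powr (\<alpha> - real CARD('n))) = ?c * ennreal (r / 2)"
      using r(1) by (simp flip: ennreal_mult)
    moreover have "(\<integral>\<^sup>+t. ?X * ?c * indicator (shell \<rho> m) t \<partial>lborel) = ?X * ?c * ennreal (r / 2)"
      using r(1) by (subst nn_integral_cmult_indicator) (auto simp: J)
    ultimately have "ennreal (1 / 2 * r powr (\<alpha> - real CARD('n))) * ?X = (\<integral>\<^sup>+t. ?X * ?c * indicator (shell \<rho> m) t \<partial>lborel)"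
      by (simp only: mult_ac)
    also have "\<dots> \<le> (\<integral>\<^sup>+t. (\<integral>\<^sup>+y. layer \<rho> H (y, t) * s y * indicator (iball x t) y \<partial>lborel)
        * ennreal (t powr (\<alpha> - real CARD('n)) * (1 / t)) * indicator (shell \<rho> m) t \<partial>lborel)"
    proof (intro nn_integral_mono)
      fix t
      show "?X * ?c * indicator (shell \<rho> m) t \<le> (\<integral>\<^sup>+y. layer \<rho> H (y, t) * s y * indicator (iball x t) y \<partial>lborel)
        * ennreal (t powr (\<alpha> - real CARD('n)) * (1 / t)) * indicator (shell \<rho> m) t"
      proof (cases "t \<in> shell \<rho> m")
        case True
        then have t: "r / 2 \<le> t" "t < r" "0 < t" using shell_pos[OF \<rho> True] by (auto simp: J)
        have "layer \<rho> H (y, t) * s y = H m y" for y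
          by (simp add: layer_eq[OF \<rho> True] mult.assoc inverse_s_mult)
        then have "?X \<le> (\<integral>\<^sup>+y. layer \<rho> H (y, t) * s y * indicator (iball x t) y \<partial>lborel)"
          using t by (intro nn_integral_mono) (auto simp: indicator_def iball_def)
        moreover have "r powr (\<alpha> - real CARD('n)) * (1 / r) \<le> t powr (\<alpha> - real CARD('n)) * (1 / t)"
          using t \<alpha> by (intro mult_mono powr_mono2' divide_left_mono) auto
        ultimately show ?thesis using True by (auto intro!: mult_mono ennreal_leI)
      qed simp
    qed
    finally show ?thesis unfolding r(2) r_def[symmetric] .
  qed
  ultimately show ?thesis by (simp add: suminf_le)
qed

end

context Ap_weight
begin

text \<open>Finite averages are needed for the subtraction that forms the increments.\<close>

lemma integral_iball_finite:
  assumes [measurable]: "h \<in> borel_measurable borel"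
    and fin: "(\<integral>\<^sup>+x. ennreal_powr (h x) p * s x \<partial>lborel) < top" and r: "r \<le> R"
  shows "(\<integral>\<^sup>+y. h y * s y * indicator (iball x r) y \<partial>lborel) < top"
proof -
  have "ennreal_powr (\<integral>\<^sup>+y. h y * (s y * indicator (iball x r) y) \<partial>lborel) p
    \<le> (\<integral>\<^sup>+y. ennreal_powr (h y) p * (s y * indicator (iball x r) y) \<partial>lborel)
      * ennreal_powr (\<integral>\<^sup>+y. s y * indicator (iball x r) y \<partial>lborel) (p - 1)"
    using p by (intro Holder_weighted) auto
  also have "\<dots> \<le> (\<integral>\<^sup>+y. ennreal_powr (h y) p * s y \<partial>lborel) * ennreal_powr (mass s (iball x r)) (p - 1)"
    unfolding mass_def by (intro mult_right_mono nn_integral_mono) (auto simp: indicator_def)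
  also have "\<dots> < top"
    using fin s_finite[OF r] by (simp add: ennreal_mult_less_top)
  finally show ?thesis by (simp add: mult.assoc)
qed

text \<open>The layers are the increments of the running maxima of the dyadic averages. Along each point the
  increments sum to the maximal function, which bounds the energy, and summation by parts recovers
  the geometrically weighted sum of the averages, which dominates the Riesz potential. The scale of
  the kernel next to \<open>\<rho>\<close> is not seen by the grids and is accounted for by one further average.\<close>

theorem layered_dominates_riesz:
  assumes h [measurable]: "h \<in> borel_measurable borel"
    and fin: "(\<integral>\<^sup>+x. ennreal_powr (h x) p * s x \<partial>lborel) < top"
    and \<rho>: "0 < \<rho>" "4 * \<rho> \<le> R" and \<alpha>: "0 < \<alpha>" "\<alpha> < real CARD('n)"
  obtains F where "F \<in> borel_measurable (borel \<Otimes>\<^sub>M borel)" "\<And>z. F z < top"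
    "borel_energy p \<rho> s F \<le> ennreal (layer_const (real CARD('n)) \<alpha> powr p
        * (real (card (UNIV :: 'n set option set)) powr p
          * (K * 4 powr (real CARD('n) * p) + real (card (UNIV :: 'n set set)) * muckenhoupt_const p K)))
      * (\<integral>\<^sup>+x. ennreal_powr (h x) p * s x \<partial>lborel)"
    "\<And>x. (\<integral>\<^sup>+y. ennreal (riesz_kernel \<alpha> \<rho> (x - y)) * (h y * s y) \<partial>lborel) \<le> borel_potential \<alpha> \<rho> s F x"
proof -
  let ?N = "real CARD('n)"
  let ?E = "\<integral>\<^sup>+x. ennreal_powr (h x) p * s x \<partial>lborel"
  \<comment> \<open>With this choice the mesh \<open>l m\<close> is the lower end of shell
    \<open>m\<close>, so a cell of level \<open>m\<close> about \<open>x\<close> lies in every ball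
    \<open>iball x t\<close> with \<open>t\<close> in that shell.\<close>
  define L where "L = \<rho> / 2"
  have L: "0 < L" "L \<le> R" using \<rho> by (auto simp: L_def)
  define l where "l m = L / 2 ^ m" for m :: nat
  have l: "0 < l m" "l m \<le> L" for m using L by (auto simp: l_def field_simps)
  have l_shell: "\<rho> / 2 ^ Suc m = l m" "\<rho> / 2 ^ m = 2 * l m" for m by (simp_all add: l_def L_def)
  define c where "c S = third_shift L S" for S :: "'n set"
  define M where "M S m x = cell_mean (c S) (l m) (\<lambda>y. h y * s y) x" for S m x
  have M [measurable]: "M S m \<in> borel_measurable borel" for S m
    unfolding M_def[abs_def] by measurable
  define A where "A S m x = (\<integral>\<^sup>+y. h y * s y * indicator {y. same_cell (c S) (l m) x y} y \<partial>lborel)" for S m x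
  have A_le: "A S m x \<le> (\<integral>\<^sup>+y. h y * s y * indicator (iball x L) y \<partial>lborel)" for S m x
  proof -
    have "{y. same_cell (c S) (l m) x y} \<subseteq> iball x (l m)" using l by (intro same_cell_subset_iball)
    also have "\<dots> \<subseteq> iball x L" using l(2)[of m] by (auto simp: iball_def)
    finally show ?thesis unfolding A_def
      by (intro nn_integral_mono mult_left_mono) (auto simp: indicator_def)
  qed
  have A_M: "A S m x = ennreal (l m powr ?N) * M S m x" for S m x
  proof -
    have "ennreal (l m ^ CARD('n)) * (A S m x / ennreal (l m ^ CARD('n))) = A S m x"
      using l(1)[of m] by (subst mult.commute) (simp add: ennreal_divide_times divide_ennreal)
    then show ?thesis using l(1)[of m] by (simp add: M_def A_def cell_mean_def powr_realpow)
  qed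
  have M_fin: "M S m x < top" for S m x
  proof -
    have "A S m x < top"
      using A_le integral_iball_finite[OF h fin L(2)] by (rule order_le_less_trans)
    then show ?thesis unfolding A_M using l(1)[of m] by (auto simp: ennreal_mult_less_top)
  qed
  define Y where "Y S x m = running_max (\<lambda>k. M S k x) m" for S x m
  have Y_inc: "incseq (Y S x)" for S x unfolding Y_def[abs_def] by (rule incseq_running_max)
  have Y_fin: "Y S x m < top" for S x m unfolding Y_def by (rule running_max_less_top) (rule M_fin)
  define D where "D S m x = increment (Y S x) m" for S m x
  have D [measurable]: "D S m \<in> borel_measurable borel" for S m
    unfolding D_def[abs_def] Y_def by (cases m) auto
  have D_fin: "D S m x < top" for S m x
    using Y_fin by (cases m) (auto simp: D_def diff_less_top_ennreal)
  \<comment> \<open>The average for the outer range of the kernel, over a doubled ball so that it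
    dominates the average over \<open>iball x \<rho>\<close> for all nearby
    \<open>x\<close>.\<close>
  define T where "T y = ennreal (\<rho> powr - ?N) * (\<integral>\<^sup>+z. h z * s z * indicator (iball y (2 * \<rho>)) z \<partial>lborel)" for y
  have T [measurable]: "T \<in> borel_measurable borel" unfolding T_def[abs_def] by measurable
  have T_fin: "T y < top" for y
    using integral_iball_finite[OF h fin, of "2 * \<rho>" y] \<rho> by (simp add: T_def ennreal_mult_less_top)
  \<comment> \<open>The index \<open>None\<close> is the extra average, placed in the outermost
    layer only; \<open>Some S\<close> stands for the grid shifted in the coordinates
    \<open>S\<close>.\<close>
  define B where "B k m y = (case k of None \<Rightarrow> if m = 0 then T y else 0 | Some S \<Rightarrow> D S m y)" for k m y
  have B [measurable]: "B k m \<in> borel_measurable borel" for k m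
    unfolding B_def[abs_def] by (cases k) auto
  define C where "C = layer_const ?N \<alpha>"
  \<comment> \<open>The part of the layered potential that each piece is sure to recover;
    \<open>C\<close> is chosen so that C \<kappa> = 6^(n-\<alpha>). As \<kappa> <= 1/2, the same
    constant covers the extra average.\<close>
  define \<kappa> where "\<kappa> = 1 / 2 * 2 powr (\<alpha> - ?N) * (1 - 2 powr - \<alpha>)"
  have two: "2 powr - \<alpha> < 1" using \<alpha> powr_less_mono[of "- \<alpha>" 0 2] by simp
  have \<kappa>: "0 < \<kappa>" using two by (simp add: \<kappa>_def)
  have \<kappa>_le: "\<kappa> \<le> 1 / 2"
  proof -
    have "2 powr (\<alpha> - ?N) \<le> 1" using \<alpha> powr_mono[of "\<alpha> - ?N" 0 2] by simp
    then have "2 powr (\<alpha> - ?N) * (1 - 2 powr - \<alpha>) \<le> 1 * 1" using two by (intro mult_mono) auto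
    then show ?thesis by (simp add: \<kappa>_def)
  qed
  have C: "C = 6 powr (?N - \<alpha>) / \<kappa>" by (simp add: C_def layer_const_def \<kappa>_def)
  have C_pos: "0 < C" unfolding C using \<kappa> by simp
  define H where "H m y = ennreal C * (\<Sum>k\<in>UNIV. B k m y)" for m y
  have H [measurable]: "H m \<in> borel_measurable borel" for m unfolding H_def[abs_def] by measurable
  have H_fin: "H m y < top" for m y
  proof -
    have "B k m y < top" for k using T_fin D_fin by (simp add: B_def split: option.split)
    then show ?thesis by (simp add: H_def ennreal_mult_less_top)
  qed
  define b where "b = real (card (UNIV :: 'n set option set))"
  have "borel_energy p \<rho> s (layer \<rho> H) \<le> (\<Sum>m. \<integral>\<^sup>+y. ennreal_powr (H m y) p * w y \<partial>lborel)"
    by (rule layer_energy_le[OF H \<rho>(1)])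
  also have "\<dots> = (\<integral>\<^sup>+y. (\<Sum>m. ennreal_powr (H m y) p * w y) \<partial>lborel)"
    by (rule nn_integral_suminf[symmetric]) measurable
  also have "\<dots> \<le> (\<integral>\<^sup>+y. ennreal (C powr p * b powr p)
      * (ennreal_powr (T y) p * w y + (\<Sum>S\<in>UNIV. ennreal_powr (SUP m. M S m y) p * w y)) \<partial>lborel)"
  proof (intro nn_integral_mono)
    fix y
    have D_sum: "(\<Sum>m. ennreal_powr (D S m y) p) \<le> ennreal_powr (SUP m. M S m y) p" for S
    proof (rule suminf_le_const[OF summableI])
      fix n
      have "(\<Sum>m<n. ennreal_powr (D S m y) p) \<le> (\<Sum>m\<le>n. ennreal_powr (D S m y) p)"
        by (intro sum_mono2) auto
      also have "\<dots> \<le> ennreal_powr (\<Sum>m\<le>n. D S m y) p"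
        using p by (intro sum_ennreal_powr_le) auto
      also have "(\<Sum>m\<le>n. D S m y) = Y S y n"
        unfolding D_def by (rule sum_increment[OF Y_inc Y_fin])
      also have "ennreal_powr (Y S y n) p \<le> ennreal_powr (SUP m. M S m y) p"
        unfolding Y_def using p
        by (subst SUP_running_max[symmetric]) (intro ennreal_powr_mono SUP_upper, auto)
      finally show "(\<Sum>m<n. ennreal_powr (D S m y) p) \<le> ennreal_powr (SUP m. M S m y) p" .
    qed
    have T_sum: "(\<Sum>m. ennreal_powr (if m = 0 then T y else 0) p) = ennreal_powr (T y) p"
      by (subst suminf_finite[of "{0 :: nat}"]) auto
    have "(\<Sum>m. ennreal_powr (H m y) p) \<le> (\<Sum>m. ennreal (C powr p * b powr p) * (\<Sum>k\<in>UNIV. ennreal_powr (B k m y) p))"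
    proof (intro suminf_le allI summableI)
      fix m
      have "ennreal_powr (H m y) p = ennreal (C powr p) * ennreal_powr (\<Sum>k\<in>UNIV. B k m y) p"
        using p C_pos by (simp add: H_def ennreal_powr_mult)
      also have "\<dots> \<le> ennreal (C powr p) * (ennreal (b powr p) * (\<Sum>k\<in>UNIV. ennreal_powr (B k m y) p))"
        unfolding b_def using p by (intro mult_left_mono ennreal_powr_sum_le) auto
      finally show "ennreal_powr (H m y) p \<le> ennreal (C powr p * b powr p) * (\<Sum>k\<in>UNIV. ennreal_powr (B k m y) p)"
        by (simp add: ennreal_mult mult.assoc)
    qed
    also have "\<dots> = ennreal (C powr p * b powr p) * (\<Sum>k\<in>UNIV. \<Sum>m. ennreal_powr (B k m y) p)"
      by (simp add: suminf_sum)
    also have "(\<Sum>k\<in>UNIV. \<Sum>m. ennreal_powr (B k m y) p)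
        = ennreal_powr (T y) p + (\<Sum>S\<in>UNIV. \<Sum>m. ennreal_powr (D S m y) p)"
      by (simp add: UNIV_option_conv sum.reindex B_def T_sum)
    also have "\<dots> \<le> ennreal_powr (T y) p + (\<Sum>S\<in>UNIV. ennreal_powr (SUP m. M S m y) p)"
      by (intro add_left_mono sum_mono D_sum)
    finally have "(\<Sum>m. ennreal_powr (H m y) p) * w y
      \<le> ennreal (C powr p * b powr p) * (ennreal_powr (T y) p + (\<Sum>S\<in>UNIV. ennreal_powr (SUP m. M S m y) p)) * w y"
      by (simp add: mult_left_mono mult_right_mono)
    then show "(\<Sum>m. ennreal_powr (H m y) p * w y) \<le> ennreal (C powr p * b powr p)
      * (ennreal_powr (T y) p * w y + (\<Sum>S\<in>UNIV. ennreal_powr (SUP m. M S m y) p * w y))"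
      by (simp add: mult.assoc distrib_right sum_distrib_right)
  qed
  also have "\<dots> = ennreal (C powr p * b powr p) * ((\<integral>\<^sup>+y. ennreal_powr (T y) p * w y \<partial>lborel)
      + (\<Sum>S\<in>UNIV. \<integral>\<^sup>+y. ennreal_powr (SUP m. M S m y) p * w y \<partial>lborel))"
    by (simp add: nn_integral_cmult nn_integral_add nn_integral_sum)
  also have "\<dots> \<le> ennreal (C powr p * b powr p) * (ennreal (K * 4 powr (?N * p)) * ?E
      + (\<Sum>S\<in>(UNIV :: 'n set set). ennreal (muckenhoupt_const p K) * ?E))"
  proof (intro mult_left_mono add_mono sum_mono)
    have "(\<integral>\<^sup>+y. ennreal_powr (T y) p * w y \<partial>lborel) = ennreal (\<rho> powr - (?N * p))
      * (\<integral>\<^sup>+y. ennreal_powr (\<integral>\<^sup>+z. h z * s z * indicator (iball y (2 * \<rho>)) z \<partial>lborel) p * w y \<partial>lborel)"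
      using p by (subst nn_integral_cmult[symmetric]) (auto simp: T_def ennreal_powr_mult powr_powr mult.assoc)
    also have "\<dots> \<le> ennreal (\<rho> powr - (?N * p)) * (ennreal (K * (2 * (2 * \<rho>)) powr (?N * p)) * ?E)"
      using \<rho> by (intro mult_left_mono ball_average_bound) auto
    also have "\<dots> = ennreal (\<rho> powr - (?N * p) * (K * (2 * (2 * \<rho>)) powr (?N * p))) * ?E"
      using K by (simp add: ennreal_mult mult.assoc)
    also have "\<rho> powr - (?N * p) * (K * (2 * (2 * \<rho>)) powr (?N * p)) = K * 4 powr (?N * p)"
      using \<rho> powr_mult[of 4 \<rho> "?N * p"] by (simp add: powr_minus field_simps)
    finally show "(\<integral>\<^sup>+y. ennreal_powr (T y) p * w y \<partial>lborel) \<le> ennreal (K * 4 powr (?N * p)) * ?E" .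
    show "(\<integral>\<^sup>+y. ennreal_powr (SUP m. M S m y) p * w y \<partial>lborel) \<le> ennreal (muckenhoupt_const p K) * ?E" for S
      unfolding M_def l_def using L by (intro dyadic_maximal_bound) auto
  qed simp
  also have "\<dots> = ennreal (C powr p * (b powr p * (K * 4 powr (?N * p)
      + real (card (UNIV :: 'n set set)) * muckenhoupt_const p K))) * ?E"
    using K by (simp add: ennreal_mult ennreal_plus distrib_right ennreal_of_nat_eq_real_of_nat mult.assoc)
  finally have energy: "borel_energy p \<rho> s (layer \<rho> H) \<le> ennreal (C powr p * (b powr p * (K * 4 powr (?N * p)
      + real (card (UNIV :: 'n set set)) * muckenhoupt_const p K))) * ?E" .
  have pot: "(\<integral>\<^sup>+y. ennreal (riesz_kernel \<alpha> \<rho> (x - y)) * (h y * s y) \<partial>lborel)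
      \<le> borel_potential \<alpha> \<rho> s (layer \<rho> H) x" for x
  proof -
    define V where "V = (\<integral>\<^sup>+y. h y * s y * indicator (iball x \<rho>) y \<partial>lborel)"
    define W where "W = ennreal (\<rho> powr (\<alpha> - ?N)) * V + (\<Sum>S\<in>UNIV. \<Sum>m. ennreal (l m powr (\<alpha> - ?N)) * A S m x)"
    let ?c = "\<lambda>m. ennreal (1 / 2 * (2 * l m) powr (\<alpha> - ?N))"
    let ?J = "\<lambda>k m. \<integral>\<^sup>+y. B k m y * indicator (iball x (l m)) y \<partial>lborel"
    let ?a = "6 powr (?N - \<alpha>)"
    \<comment> \<open>Three ranges of the distance: the kernel vanishes at 0 and from \<rho> on, the
      shifted grids capture distances below L/3, and the single ball captures the rest, where the
      distance is at least \<rho>/6.\<close>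
    have kernel: "ennreal (riesz_kernel \<alpha> \<rho> (x - y)) \<le> ennreal ?a * (ennreal (\<rho> powr (\<alpha> - ?N)) * indicator (iball x \<rho>) y
        + (\<Sum>S\<in>UNIV. \<Sum>m. ennreal (l m powr (\<alpha> - ?N)) * indicator {y. same_cell (c S) (l m) x y} y))"
      (is "_ \<le> ennreal ?a * (?t + ?u)") for y
    proof -
      define e where "e = infnorm (x - y)"
      have six: "(t / 6) powr (\<alpha> - ?N) = ?a * t powr (\<alpha> - ?N)" if "0 < t" for t
        using that by (simp add: powr_divide powr_diff field_simps)
      consider "e = 0 \<or> \<rho> \<le> e" | "0 < e" "e < L / 3" | "L / 3 \<le> e" "e < \<rho>"
        using infnorm_pos_le[of "x - y"] unfolding e_def[symmetric] by linarith
      then show ?thesis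
      proof cases
        case 1
        then have "riesz_kernel \<alpha> \<rho> (x - y) = 0" by (auto simp: riesz_kernel_def e_def)
        then show ?thesis by simp
      next
        case 2
        then have "e \<in> (\<Union>m. shell (L / 3) m)" using L(1) by (subst UN_shell) auto
        then obtain m where "e \<in> shell (L / 3) m" by blast
        \<comment> \<open>Shells of L/3 fit the one-third trick: their upper end is a third of the
          mesh, their lower end a sixth.\<close>
        then have e: "l m / 6 \<le> e" "e < L / 3 / 2 ^ m" by (auto simp: shell_def l_def)
        then obtain S where S: "same_cell (c S) (l m) x y"
          using same_cell_third_shift[OF L(1), of x y m] by (auto simp: c_def l_def e_def)
        have "riesz_kernel \<alpha> \<rho> (x - y) \<le> (l m / 6) powr (\<alpha> - ?N)"
          using e l(1)[of m] \<alpha> unfolding riesz_kernel_def e_def by (auto intro!: powr_mono2')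
        then have "ennreal (riesz_kernel \<alpha> \<rho> (x - y)) \<le> ennreal ?a * ennreal (l m powr (\<alpha> - ?N))"
          unfolding six[OF l(1)] by (simp add: ennreal_leI flip: ennreal_mult)
        also have "ennreal (l m powr (\<alpha> - ?N)) \<le> (\<Sum>m. ennreal (l m powr (\<alpha> - ?N)) * indicator {y. same_cell (c S) (l m) x y} y)"
          using S sum_le_suminf[of "\<lambda>m. ennreal (l m powr (\<alpha> - ?N)) * indicator {y. same_cell (c S) (l m) x y} y" "{m}"]
          by simp
        also have "\<dots> \<le> ?u"
          by (rule member_le_sum[of S UNIV "\<lambda>S. \<Sum>m. ennreal (l m powr (\<alpha> - ?N)) * indicator {y. same_cell (c S) (l m) x y} y"]) auto
        also have "\<dots> \<le> ?t + ?u" by (rule add_increasing) simp_all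
        finally show ?thesis by (simp add: mult_left_mono)
      next
        case 3
        have "riesz_kernel \<alpha> \<rho> (x - y) \<le> (\<rho> / 6) powr (\<alpha> - ?N)"
          using 3 \<rho>(1) \<alpha> unfolding riesz_kernel_def e_def L_def by (auto intro!: powr_mono2')
        then have "ennreal (riesz_kernel \<alpha> \<rho> (x - y)) \<le> ennreal ?a * ennreal (\<rho> powr (\<alpha> - ?N))"
          unfolding six[OF \<rho>(1)] by (simp add: ennreal_leI flip: ennreal_mult)
        also have "ennreal (\<rho> powr (\<alpha> - ?N)) = ?t" using 3 by (simp add: iball_def e_def)
        also have "?t \<le> ?t + ?u" by (rule add_increasing2) simp_all
        finally show ?thesis by (simp add: mult_left_mono)
      qed
    qed
    have "(\<integral>\<^sup>+y. ennreal (riesz_kernel \<alpha> \<rho> (x - y)) * (h y * s y) \<partial>lborel)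
      \<le> (\<integral>\<^sup>+y. ennreal ?a * (ennreal (\<rho> powr (\<alpha> - ?N)) * (h y * s y * indicator (iball x \<rho>) y)
        + (\<Sum>S\<in>UNIV. \<Sum>m. ennreal (l m powr (\<alpha> - ?N)) * (h y * s y * indicator {y. same_cell (c S) (l m) x y} y))) \<partial>lborel)"
    proof (intro nn_integral_mono)
      fix y
      have eq: "ennreal ?a * (ennreal (\<rho> powr (\<alpha> - ?N)) * indicator (iball x \<rho>) y
        + (\<Sum>S\<in>UNIV. \<Sum>m. ennreal (l m powr (\<alpha> - ?N)) * indicator {y. same_cell (c S) (l m) x y} y)) * (h y * s y)
        = ennreal ?a * (ennreal (\<rho> powr (\<alpha> - ?N)) * (h y * s y * indicator (iball x \<rho>) y)
        + (\<Sum>S\<in>UNIV. \<Sum>m. ennreal (l m powr (\<alpha> - ?N)) * (h y * s y * indicator {y. same_cell (c S) (l m) x y} y)))"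
        by (simp only: mult.assoc distrib_right sum_distrib_right ennreal_suminf_multc[symmetric] mult.commute[of "indicator _ _"])
      show "ennreal (riesz_kernel \<alpha> \<rho> (x - y)) * (h y * s y)
        \<le> ennreal ?a * (ennreal (\<rho> powr (\<alpha> - ?N)) * (h y * s y * indicator (iball x \<rho>) y)
        + (\<Sum>S\<in>UNIV. \<Sum>m. ennreal (l m powr (\<alpha> - ?N)) * (h y * s y * indicator {y. same_cell (c S) (l m) x y} y)))"
        using mult_right_mono[OF kernel[of y], of "h y * s y"] unfolding eq by simp
    qed
    also have "\<dots> = ennreal ?a * W"
      unfolding W_def V_def A_def
      by (simp add: nn_integral_cmult nn_integral_add nn_integral_sum nn_integral_suminf)
    finally have upper: "(\<integral>\<^sup>+y. ennreal (riesz_kernel \<alpha> \<rho> (x - y)) * (h y * s y) \<partial>lborel) \<le> ennreal ?a * W" .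
    have T_part: "ennreal \<kappa> * (ennreal (\<rho> powr (\<alpha> - ?N)) * V) \<le> (\<Sum>m. ?c m * ?J None m)"
    proof -
      \<comment> \<open>The ball of radius \<rho>/2 on which this holds has volume exactly \<rho>^n,
        which cancels the normalization.\<close>
      have T_ge: "ennreal (\<rho> powr - ?N) * V \<le> T y" if y: "y \<in> iball x (\<rho> / 2)" for y
      proof -
        have "x \<in> iball y \<rho>" using y \<rho> infnorm_sub[of x y] by (simp add: iball_def)
        then have "iball x \<rho> \<subseteq> iball y (2 * \<rho>)" using iball_triangle[of x y \<rho> _ \<rho>] by auto
        then show ?thesis unfolding T_def V_def
          by (intro mult_left_mono nn_integral_mono) (auto simp: indicator_def)
      qed
      have l0: "2 * l 0 = \<rho>" "l 0 = \<rho> / 2" by (simp_all add: l_def L_def)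
      have "V = ennreal (\<rho> powr - ?N) * V * ennreal (\<rho> ^ CARD('n))"
        using \<rho>(1) by (simp add: powr_minus powr_realpow mult.commute mult.left_commute flip: ennreal_mult mult.assoc)
      also have "\<dots> = (\<integral>\<^sup>+y. ennreal (\<rho> powr - ?N) * V * indicator (iball x (\<rho> / 2)) y \<partial>lborel)"
        using \<rho>(1) by (subst nn_integral_cmult_indicator) (auto simp: emeasure_iball)
      also have "\<dots> \<le> (\<integral>\<^sup>+y. T y * indicator (iball x (\<rho> / 2)) y \<partial>lborel)"
        using T_ge by (intro nn_integral_mono) (auto simp: indicator_def)
      finally have V_le: "V \<le> ?J None 0" by (simp add: B_def l0)
      have "ennreal \<kappa> * (ennreal (\<rho> powr (\<alpha> - ?N)) * V) = ennreal (\<kappa> * \<rho> powr (\<alpha> - ?N)) * V"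
        using \<kappa> by (simp add: ennreal_mult mult.assoc)
      also have "\<dots> \<le> ?c 0 * ?J None 0"
        unfolding l0(1) using \<kappa>_le by (intro mult_mono V_le ennreal_leI mult_right_mono) auto
      also have "\<dots> \<le> (\<Sum>m. ?c m * ?J None m)"
        using sum_le_suminf[of "\<lambda>m. ?c m * ?J None m" "{0}"] by simp
      finally show ?thesis .
    qed
    have S_part: "ennreal \<kappa> * (\<Sum>m. ennreal (l m powr (\<alpha> - ?N)) * A S m x) \<le> (\<Sum>m. ?c m * ?J (Some S) m)" for S
    proof -
      define r where "r = 2 powr - \<alpha>"
      have r: "0 < r" "r < 1" using two by (simp_all add: r_def)
      have \<kappa>_r: "ennreal \<kappa> = ennreal (1 / 2 * 2 powr (\<alpha> - ?N)) * ennreal (1 - r)"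
        using r unfolding \<kappa>_def r_def[symmetric] by (intro ennreal_mult) auto
      have lr: "l m powr \<alpha> = L powr \<alpha> * r ^ m" for m
        using L(1) by (simp add: l_def r_def powr_divide powr_realpow[symmetric] powr_powr powr_minus field_simps)
      have "(\<Sum>m. ennreal (l m powr (\<alpha> - ?N)) * A S m x) = (\<Sum>m. ennreal (L powr \<alpha>) * (ennreal (r ^ m) * M S m x))"
      proof (intro suminf_cong)
        fix m
        have "ennreal (l m powr (\<alpha> - ?N)) * A S m x = ennreal (l m powr (\<alpha> - ?N) * l m powr ?N) * M S m x"
          unfolding A_M by (simp add: ennreal_mult mult.assoc)
        also have "l m powr (\<alpha> - ?N) * l m powr ?N = L powr \<alpha> * r ^ m"
          unfolding lr[symmetric] by (simp flip: powr_add)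
        finally show "ennreal (l m powr (\<alpha> - ?N)) * A S m x = ennreal (L powr \<alpha>) * (ennreal (r ^ m) * M S m x)"
          using r by (simp add: ennreal_mult mult.assoc)
      qed
      also have "\<dots> = ennreal (L powr \<alpha>) * (\<Sum>m. ennreal (r ^ m) * M S m x)" by simp
      also have "\<dots> \<le> ennreal (L powr \<alpha>) * (\<Sum>m. ennreal (r ^ m) * Y S x m)"
        unfolding Y_def by (intro mult_left_mono suminf_le allI summableI running_max_ge) auto
      finally have "ennreal \<kappa> * (\<Sum>m. ennreal (l m powr (\<alpha> - ?N)) * A S m x)
        \<le> ennreal \<kappa> * (ennreal (L powr \<alpha>) * (\<Sum>m. ennreal (r ^ m) * Y S x m))"
        by (rule mult_left_mono) simp
      also have "\<dots> = ennreal (1 / 2 * 2 powr (\<alpha> - ?N)) * ennreal (L powr \<alpha>) * (ennreal (1 - r) * (\<Sum>m. ennreal (r ^ m) * Y S x m))"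
        by (simp only: \<kappa>_r mult_ac)
      also have "\<dots> \<le> ennreal (1 / 2 * 2 powr (\<alpha> - ?N)) * ennreal (L powr \<alpha>) * (\<Sum>m. ennreal (r ^ m) * D S m x)"
        unfolding D_def by (intro mult_left_mono suminf_increment_ge r Y_inc Y_fin) simp
      also have "\<dots> = (\<Sum>m. ennreal (1 / 2 * 2 powr (\<alpha> - ?N)) * ennreal (L powr \<alpha>) * (ennreal (r ^ m) * D S m x))"
        by simp
      also have "\<dots> \<le> (\<Sum>m. ?c m * ?J (Some S) m)"
      proof (intro suminf_le allI summableI)
        fix m
        let ?Q = "{y. same_cell (c S) (l m) x y}"
        \<comment> \<open>The increment of level \<open>m\<close> depends only on levels up to
          \<open>m\<close>, so it is constant on the cell of \<open>x\<close>; integrating it over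
          that cell alone gives the increment at \<open>x\<close> times the volume of the
          cell.\<close>
        have const: "D S m y = D S m x" if "y \<in> ?Q" for y
        proof -
          have "M S k y = M S k x" if "k \<le> m" for k
          proof -
            have "same_cell (c S) (l k) x y"
              using \<open>k \<le> m\<close>
            proof (induction rule: inc_induct)
              case base then show ?case using \<open>y \<in> ?Q\<close> by simp
            next
              case (step j) then show ?case
                using same_cell_double[of "c S" "l j" x y] by (simp add: l_def mult.commute)
            qed
            then show ?thesis unfolding M_def by (rule cell_mean_cong[symmetric])
          qed
          then have "Y S y k = Y S x k" if "k \<le> m" for k
            unfolding Y_def using that by (intro running_max_cong) auto
          then show ?thesis by (simp add: D_def increment_def)
        qed
        have Qsub: "?Q \<subseteq> iball x (l m)" using l by (intro same_cell_subset_iball)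
        have "ennreal (1 / 2 * 2 powr (\<alpha> - ?N)) * ennreal (L powr \<alpha>) * (ennreal (r ^ m) * D S m x)
          = ennreal (1 / 2 * 2 powr (\<alpha> - ?N) * (L powr \<alpha> * r ^ m)) * D S m x"
          using r by (subst ennreal_mult, simp, simp, subst (2) ennreal_mult) (simp_all add: mult.assoc)
        also have "1 / 2 * 2 powr (\<alpha> - ?N) * (L powr \<alpha> * r ^ m) = 1 / 2 * (2 * l m) powr (\<alpha> - ?N) * l m ^ CARD('n)"
          using l(1)[of m] unfolding lr[symmetric] by (simp add: powr_mult powr_diff powr_realpow)
        also have "ennreal (1 / 2 * (2 * l m) powr (\<alpha> - ?N) * l m ^ CARD('n)) * D S m x
          = ?c m * (D S m x * emeasure lborel ?Q)"
          unfolding emeasure_cell[OF l(1)]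
          by (subst ennreal_mult, simp, use l(1)[of m] in simp, simp only: mult_ac)
        also have "D S m x * emeasure lborel ?Q = (\<integral>\<^sup>+y. D S m x * indicator ?Q y \<partial>lborel)"
          by (simp add: nn_integral_cmult)
        also have "\<dots> \<le> ?J (Some S) m"
          using const Qsub by (intro nn_integral_mono) (auto simp: indicator_def B_def)
        finally show "ennreal (1 / 2 * 2 powr (\<alpha> - ?N)) * ennreal (L powr \<alpha>) * (ennreal (r ^ m) * D S m x)
          \<le> ?c m * ?J (Some S) m" by (simp add: mult_left_mono)
      qed
      finally show ?thesis .
    qed
    have "ennreal ?a * W = ennreal C * (ennreal \<kappa> * W)"
      using \<kappa> C_pos unfolding C by (simp flip: ennreal_mult mult.assoc)
    also have "ennreal \<kappa> * W \<le> (\<Sum>m. ?c m * ?J None m) + (\<Sum>S\<in>UNIV. \<Sum>m. ?c m * ?J (Some S) m)"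
      unfolding W_def distrib_left sum_distrib_left by (intro add_mono sum_mono T_part S_part)
    also have "\<dots> = (\<Sum>k\<in>UNIV. \<Sum>m. ?c m * ?J k m)"
      by (simp add: UNIV_option_conv sum.reindex)
    also have "\<dots> = (\<Sum>m. \<Sum>k\<in>UNIV. ?c m * ?J k m)"
      by (simp add: suminf_sum)
    finally have "ennreal ?a * W \<le> (\<Sum>m. ennreal C * (\<Sum>k\<in>UNIV. ?c m * ?J k m))"
      by (simp add: mult_left_mono)
    also have "\<dots> = (\<Sum>m. ?c m * (\<integral>\<^sup>+y. H m y * indicator (iball x (l m)) y \<partial>lborel))"
    proof (intro suminf_cong)
      fix m
      have "(\<integral>\<^sup>+y. H m y * indicator (iball x (l m)) y \<partial>lborel)
        = (\<integral>\<^sup>+y. ennreal C * (\<Sum>k\<in>UNIV. B k m y * indicator (iball x (l m)) y) \<partial>lborel)"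
        by (simp only: H_def mult.assoc sum_distrib_right)
      also have "\<dots> = ennreal C * (\<Sum>k\<in>UNIV. ?J k m)"
        by (subst nn_integral_cmult, measurable) (subst nn_integral_sum, measurable)
      finally show "ennreal C * (\<Sum>k\<in>UNIV. ?c m * ?J k m) = ?c m * (\<integral>\<^sup>+y. H m y * indicator (iball x (l m)) y \<partial>lborel)"
        by (simp only: sum_distrib_left[symmetric] mult.left_commute)
    qed
    also have "\<dots> \<le> borel_potential \<alpha> \<rho> s (layer \<rho> H) x"
      using layer_potential_ge[of H \<rho> \<alpha> x, OF H \<rho>(1) \<alpha>(2)] unfolding l_shell(1) unfolding l_shell(2) .
    finally show ?thesis using upper by (rule order_trans[rotated])
  qed
  \<comment> \<open>Competitors for the variant capacity are real valued, so finiteness is needed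
    for a lossless conversion by \<open>enn2real\<close>.\<close>
  have fin_layer: "layer \<rho> H z < top" for z
  proof (cases "snd z \<in> {0<..<\<rho>}")
    case True
    then obtain m where "snd z \<in> shell \<rho> m" using UN_shell[OF \<rho>(1)] by blast
    then have "layer \<rho> H z = H m (fst z) * inverse (s (fst z))"
      using layer_eq[OF \<rho>(1), of "snd z" m H "fst z"] by simp
    moreover have "inverse (s (fst z)) < top" using s_nz by (simp add: less_top[symmetric])
    ultimately show ?thesis using H_fin by (simp add: ennreal_mult_less_top)
  next
    case False
    then have "snd z \<notin> shell \<rho> m" for m using UN_shell[OF \<rho>(1)] by blast
    then show ?thesis by (simp add: layer_def case_prod_unfold)
  qed
  show thesis
    using that[OF measurable_layer[OF H] fin_layer _ pot] energy unfolding C_def b_def by blast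
qed

end

section \<open>Comparison of the capacities\<close>

context pos_weight
begin

section \<open>Passage to Borel representatives\<close>

lemma Lp_energy_eq:
  assumes "AE x in lborel. \<omega> x = v x" "AE x in lborel. ennreal (f x) = g x" "\<And>x. 0 \<le> f x"
  shows "Lp_energy p \<omega> f = (\<integral>\<^sup>+x. ennreal_powr (g x) p * w x \<partial>lborel)"
  unfolding Lp_energy_def nn_integral_completion
  using assms(1,2)
proof (intro nn_integral_cong_AE, eventually_elim)
  fix x assume "\<omega> x = v x" "ennreal (f x) = g x"
  then show "ennreal (f x powr p * \<omega> x) = ennreal_powr (g x) p * w x"
    using assms(3)[of x] by (simp add: w_def ennreal_mult' flip: \<open>ennreal (f x) = g x\<close>)
qed

lemma riesz_potential_eq:
  assumes "AE x in lborel. ennreal (f x) = g x"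
  shows "riesz_potential \<alpha> \<rho> f x = (\<integral>\<^sup>+y. ennreal (riesz_kernel \<alpha> \<rho> (x - y)) * g y \<partial>lborel)"
  unfolding riesz_potential_def nn_integral_completion
  using assms
proof (intro nn_integral_cong_AE, eventually_elim)
  fix y assume "ennreal (f y) = g y"
  moreover have "0 \<le> riesz_kernel \<alpha> \<rho> (x - y)" by (simp add: riesz_kernel_def)
  ultimately show "ennreal (riesz_kernel \<alpha> \<rho> (x - y) * f y) = ennreal (riesz_kernel \<alpha> \<rho> (x - y)) * g y"
    by (simp add: ennreal_mult')
qed

lemma dual_weight_cong_AE:
  "AE x in lborel. \<omega> x = v x \<Longrightarrow> AE x in lborel. ennreal (dual_weight p \<omega> x) = s x"
  by (erule eventually_mono) (simp add: s_def dual_weight_def)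

lemma layered_energy_eq:
  assumes \<omega>: "AE x in lborel. \<omega> x = v x"
    and F: "AE t in lborel. t \<in> {0<..<\<rho>} \<longrightarrow> (AE y in lborel. ennreal (f (y, t)) = F (y, t))"
    and f: "\<And>y t. t \<in> {0<..<\<rho>} \<Longrightarrow> 0 \<le> f (y, t)"
  shows "layered_energy p \<rho> \<omega> f = borel_energy p \<rho> s F"
  unfolding layered_energy_def borel_energy_def nn_integral_completion
  using F
proof (intro nn_integral_cong_AE, eventually_elim)
  fix t assume t: "t \<in> {0<..<\<rho>} \<longrightarrow> (AE y in lborel. ennreal (f (y, t)) = F (y, t))"
  show "(\<integral>\<^sup>+y. ennreal (f (y, t) powr p * dual_weight p \<omega> y) \<partial>lborel) * ennreal (1 / t) * indicator {0<..<\<rho>} t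
    = (\<integral>\<^sup>+y. ennreal_powr (F (y, t)) p * s y \<partial>lborel) * ennreal (1 / t) * indicator {0<..<\<rho>} t"
  proof (cases "t \<in> {0<..<\<rho>}")
    case True
    then have "AE y in lborel. ennreal (f (y, t)) = F (y, t)" using t by blast
    then have "(\<integral>\<^sup>+y. ennreal (f (y, t) powr p * dual_weight p \<omega> y) \<partial>lborel)
      = (\<integral>\<^sup>+y. ennreal_powr (F (y, t)) p * s y \<partial>lborel)"
      using dual_weight_cong_AE[OF \<omega>]
    proof (intro nn_integral_cong_AE, eventually_elim)
      fix y assume "ennreal (f (y, t)) = F (y, t)" "ennreal (dual_weight p \<omega> y) = s y"
      then show "ennreal (f (y, t) powr p * dual_weight p \<omega> y) = ennreal_powr (F (y, t)) p * s y"
        using f[OF True, of y] by (simp add: ennreal_mult' flip: \<open>ennreal (f (y, t)) = F (y, t)\<close>)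
    qed
    then show ?thesis by simp
  qed simp
qed

lemma layered_potential_eq:
  assumes \<omega>: "AE x in lborel. \<omega> x = v x"
    and F: "AE t in lborel. t \<in> {0<..<\<rho>} \<longrightarrow> (AE y in lborel. ennreal (f (y, t)) = F (y, t))"
    and f: "\<And>y t. t \<in> {0<..<\<rho>} \<Longrightarrow> 0 \<le> f (y, t)"
    and F_measurable [measurable]: "F \<in> borel_measurable (borel \<Otimes>\<^sub>M borel)"
  shows "layered_potential \<alpha> p \<rho> \<omega> f x = borel_potential \<alpha> \<rho> s F x"
  unfolding layered_potential_def borel_potential_def nn_integral_completion
  using F
proof (intro nn_integral_cong_AE, eventually_elim)
  fix t assume t: "t \<in> {0<..<\<rho>} \<longrightarrow> (AE y in lborel. ennreal (f (y, t)) = F (y, t))"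
  show "(\<integral>\<^sup>+y\<in>{y. infnorm (x - y) < t}. ennreal (f (y, t) / t powr (real CARD('n) - \<alpha>) * dual_weight p \<omega> y) \<partial>lborel)
      * ennreal (1 / t) * indicator {0<..<\<rho>} t
    = (\<integral>\<^sup>+y. F (y, t) * s y * indicator (iball x t) y \<partial>lborel)
      * ennreal (t powr (\<alpha> - real CARD('n)) * (1 / t)) * indicator {0<..<\<rho>} t"
  proof (cases "t \<in> {0<..<\<rho>}")
    case True
    let ?c = "t powr (\<alpha> - real CARD('n))"
    have "AE y in lborel. ennreal (f (y, t)) = F (y, t)" using t True by blast
    then have "(\<integral>\<^sup>+y\<in>{y. infnorm (x - y) < t}. ennreal (f (y, t) / t powr (real CARD('n) - \<alpha>) * dual_weight p \<omega> y) \<partial>lborel)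
      = (\<integral>\<^sup>+y. F (y, t) * s y * indicator (iball x t) y * ennreal ?c \<partial>lborel)"
      using dual_weight_cong_AE[OF \<omega>]
    proof (intro nn_integral_cong_AE, eventually_elim)
      fix y assume eq: "ennreal (f (y, t)) = F (y, t)" "ennreal (dual_weight p \<omega> y) = s y"
      have "f (y, t) / t powr (real CARD('n) - \<alpha>) = ?c * f (y, t)"
        using powr_minus_divide[of t "real CARD('n) - \<alpha>"] by simp
      then have "ennreal (f (y, t) / t powr (real CARD('n) - \<alpha>) * dual_weight p \<omega> y) = ennreal ?c * (F (y, t) * s y)"
        using f[OF True, of y] by (simp add: ennreal_mult' mult.assoc flip: eq)
      then show "ennreal (f (y, t) / t powr (real CARD('n) - \<alpha>) * dual_weight p \<omega> y) * indicator {y. infnorm (x - y) < t} y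
        = F (y, t) * s y * indicator (iball x t) y * ennreal ?c"
        by (simp add: iball_def mult_ac)
    qed
    also have "\<dots> = (\<integral>\<^sup>+y. F (y, t) * s y * indicator (iball x t) y \<partial>lborel) * ennreal ?c"
      by (rule nn_integral_multc) measurable
    finally show ?thesis
      using True ennreal_mult'[of ?c "1 / t"] by (simp add: mult.assoc)
  qed simp
qed

end

text \<open>A section of a Lebesgue measurable function need not be measurable, so \<open>f\<close>
  is replaced by a Borel function off a Borel null set \<open>Z\<close>, almost all of whose
  sections are null. The order of the variables is exchanged to match the iterated integrals, with
  \<open>t\<close> outermost.\<close>

lemma layered_borel_version:
  fixes f :: "(real^'n) \<times> real \<Rightarrow> real"
  assumes "f \<in> borel_measurable (lebesgue_on (UNIV \<times> {0<..<\<rho>}))"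
  obtains F where "F \<in> borel_measurable (borel \<Otimes>\<^sub>M borel)"
    "AE t in lborel. t \<in> {0<..<\<rho>} \<longrightarrow> (AE y in lborel. ennreal (f (y, t)) = F (y, t))"
proof -
  let ?\<Omega> = "UNIV \<times> {0<..<\<rho>} :: ((real^'n) \<times> real) set"
  have "open ?\<Omega>" by (intro open_Times) auto
  then have "?\<Omega> \<in> sets lebesgue" by (intro sets_completionI_sets) simp
  then have "(\<lambda>z. if z \<in> ?\<Omega> then f z else 0) \<in> borel_measurable lebesgue"
    using assms by (simp add: borel_measurable_if)
  then obtain g where g: "g \<in> borel_measurable lborel" "AE z in lborel. (if z \<in> ?\<Omega> then f z else 0) = g z"
    using completion_ex_borel_measurable_real by blast
  have [measurable]: "g \<in> borel_measurable (borel \<Otimes>\<^sub>M borel)"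
    using g(1) by (simp add: borel_prod)
  from g(2) obtain Z where sub: "{z \<in> space lborel. (if z \<in> ?\<Omega> then f z else 0) \<noteq> g z} \<subseteq> Z"
    and "emeasure lborel Z = 0" "Z \<in> sets lborel"
    by (rule AE_E)
  then have Z: "Z \<in> null_sets lborel" "{z. (if z \<in> ?\<Omega> then f z else 0) \<noteq> g z} \<subseteq> Z"
    by (auto intro: null_setsI)
  then have Zm: "Z \<in> sets (lborel \<Otimes>\<^sub>M lborel)" and "AE z in lborel \<Otimes>\<^sub>M lborel. z \<notin> Z"
    unfolding lborel_prod by (auto intro: AE_not_in)
  then have "AE y in lborel. AE t in lborel. (y, t) \<notin> Z"
    by (intro lborel_pair.AE_pair)
  moreover have "{z \<in> space (lborel \<Otimes>\<^sub>M lborel). (fst z, snd z) \<notin> Z} \<in> sets (lborel \<Otimes>\<^sub>M lborel)"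
    using sets.compl_sets[OF Zm] by (simp add: set_diff_eq)
  ultimately have "AE t in lborel. AE y in lborel. (y, t) \<notin> Z"
    using lborel_pair.AE_commute[of "\<lambda>y t. (y, t) \<notin> Z"] by simp
  then have "AE t in lborel. t \<in> {0<..<\<rho>} \<longrightarrow> (AE y in lborel. ennreal (f (y, t)) = ennreal (g (y, t)))"
  proof eventually_elim
    case (elim t)
    show ?case
    proof
      assume "t \<in> {0<..<\<rho>}"
      then have "f (y, t) = g (y, t)" if "(y, t) \<notin> Z" for y
        using Z(2) that by (auto split: if_splits)
      with elim show "AE y in lborel. ennreal (f (y, t)) = ennreal (g (y, t))" by auto
    qed
  qed
  then show thesis by (intro that[of "\<lambda>z. ennreal (g z)"]) auto
qed

text \<open>With the constant on the left, an upper bound by a multiple of an infimum can be checked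
  competitor by competitor.\<close>

lemma ennreal_inverse_mult_le_iff:
  assumes "0 < C"
  shows "ennreal (inverse C) * a \<le> b \<longleftrightarrow> a \<le> ennreal C * b"
proof
  have one: "ennreal C * ennreal (inverse C) = 1"
    using assms by (simp flip: ennreal_mult)
  show "a \<le> ennreal C * b" if "ennreal (inverse C) * a \<le> b"
    using mult_left_mono[OF that, of "ennreal C"] one by (simp flip: mult.assoc)
  show "ennreal (inverse C) * a \<le> b" if "a \<le> ennreal C * b"
    using mult_left_mono[OF that, of "ennreal (inverse C)"] one
    by (simp add: mult.commute[of "ennreal (inverse C)"] flip: mult.assoc)
qed

definition lower_const :: "real \<Rightarrow> real \<Rightarrow> real \<Rightarrow> real \<Rightarrow> real" where
  "lower_const n \<alpha> p K = 2 powr ((n - \<alpha>) * p) * K * 4 powr (n * p)"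

text \<open>The type argument carries the dimension, which also determines the number 2^n of grids,
  written as the number of sets of coordinates.\<close>

definition upper_const :: "'n itself \<Rightarrow> real \<Rightarrow> real \<Rightarrow> real \<Rightarrow> real" where
  "upper_const _ \<alpha> p K = layer_const (real CARD('n)) \<alpha> powr p
     * (real (card (UNIV :: 'n set option set)) powr p
       * (K * 4 powr (real CARD('n) * p) + real (card (UNIV :: 'n set set)) * muckenhoupt_const p K))"

context Ap_weight
begin

section \<open>Transfer of competitors between the capacities\<close>

lemma riesz_capacity_le:
  assumes \<omega>: "AE x in lborel. \<omega> x = v x" and \<rho>: "0 < \<rho>" "4 * \<rho> \<le> R"
    and \<alpha>: "0 < \<alpha>" "\<alpha> < real CARD('n)" and C: "0 < C" "lower_const (real CARD('n)) \<alpha> p K \<le> C"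
  shows "ennreal (inverse C) * riesz_capacity \<alpha> p \<rho> \<omega> E \<le> variant_capacity \<alpha> p \<rho> \<omega> E"
  unfolding variant_capacity_def
proof (rule Inf_greatest, clarify)
  fix f assume f: "f \<in> borel_measurable (lebesgue_on (UNIV \<times> {0<..<\<rho>}))"
    "\<forall>y. \<forall>t\<in>{0<..<\<rho>}. 0 \<le> f (y, t)" "layered_energy p \<rho> \<omega> f < \<infinity>" "\<forall>x\<in>E. 1 \<le> layered_potential \<alpha> p \<rho> \<omega> f x"
  obtain F where F: "F \<in> borel_measurable (borel \<Otimes>\<^sub>M borel)"
    "AE t in lborel. t \<in> {0<..<\<rho>} \<longrightarrow> (AE y in lborel. ennreal (f (y, t)) = F (y, t))"
    using layered_borel_version[OF f(1)] .
  have f0: "0 \<le> f (y, t)" if "t \<in> {0<..<\<rho>}" for y t using f(2) that by blast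
  have energy_f: "layered_energy p \<rho> \<omega> f = borel_energy p \<rho> s F"
    using layered_energy_eq[OF \<omega> F(2)] f0 by blast
  have pot_f: "layered_potential \<alpha> p \<rho> \<omega> f x = borel_potential \<alpha> \<rho> s F x" for x
    using layered_potential_eq[OF \<omega> F(2) _ F(1)] f0 by blast
  obtain g where g [measurable]: "g \<in> borel_measurable borel"
    and energy_g: "(\<integral>\<^sup>+y. ennreal_powr (g y) p * w y \<partial>lborel)
      \<le> ennreal (lower_const (real CARD('n)) \<alpha> p K) * borel_energy p \<rho> s F"
    and pot_g: "\<And>x. borel_potential \<alpha> \<rho> s F x \<le> (\<integral>\<^sup>+y. ennreal (riesz_kernel \<alpha> \<rho> (x - y)) * g y \<partial>lborel)"
    using riesz_dominates_layered[OF F(1) \<rho> \<alpha>(2), folded lower_const_def] by blast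
  have le: "(\<integral>\<^sup>+y. ennreal_powr (g y) p * w y \<partial>lborel) \<le> ennreal C * layered_energy p \<rho> \<omega> f"
    unfolding energy_f using energy_g C by (elim order_trans) (intro mult_right_mono ennreal_leI, auto)
  also have "\<dots> < top" using f(3) by (simp add: ennreal_mult_less_top)
  finally have fin: "(\<integral>\<^sup>+y. ennreal_powr (g y) p * w y \<partial>lborel) < top" .
  \<comment> \<open>Finite energy and a positive weight force \<open>g\<close> to be finite almost
    everywhere, so making it real valued changes neither energy nor potential.\<close>
  have "AE y in lborel. ennreal_powr (g y) p * w y \<noteq> \<infinity>"
    using fin by (intro nn_integral_noteq_infinite) auto
  then have ae: "AE y in lborel. ennreal (enn2real (g y)) = g y"
  proof eventually_elim
    fix y assume "ennreal_powr (g y) p * w y \<noteq> \<infinity>"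
    then have "g y \<noteq> top" using w_nz[of y] by (auto simp: ennreal_top_mult)
    then show "ennreal (enn2real (g y)) = g y" by (simp add: ennreal_enn2real_if)
  qed
  let ?g = "\<lambda>y. enn2real (g y)"
  have energy: "Lp_energy p \<omega> ?g = (\<integral>\<^sup>+y. ennreal_powr (g y) p * w y \<partial>lborel)"
    using Lp_energy_eq[OF \<omega> ae] by simp
  have "?g \<in> borel_measurable lebesgue"
    by (intro measurable_completion) simp
  moreover have "\<forall>x\<in>E. 1 \<le> riesz_potential \<alpha> \<rho> ?g x"
    using f(4) pot_g unfolding riesz_potential_eq[OF ae] pot_f by (meson order_trans)
  ultimately have "riesz_capacity \<alpha> p \<rho> \<omega> E \<le> Lp_energy p \<omega> ?g"
    unfolding riesz_capacity_def using fin energy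
    by (intro Inf_lower CollectI exI[of _ ?g] conjI) auto
  also have "\<dots> \<le> ennreal C * layered_energy p \<rho> \<omega> f" unfolding energy by (rule le)
  finally show "ennreal (inverse C) * riesz_capacity \<alpha> p \<rho> \<omega> E \<le> layered_energy p \<rho> \<omega> f"
    using C by (simp add: ennreal_inverse_mult_le_iff)
qed

lemma variant_capacity_le:
  assumes \<omega>: "AE x in lborel. \<omega> x = v x" and \<rho>: "0 < \<rho>" "4 * \<rho> \<le> R"
    and \<alpha>: "0 < \<alpha>" "\<alpha> < real CARD('n)" and C: "0 < C" "upper_const TYPE('n) \<alpha> p K \<le> C"
  shows "variant_capacity \<alpha> p \<rho> \<omega> E \<le> ennreal C * riesz_capacity \<alpha> p \<rho> \<omega> E"
proof -
  have "ennreal (inverse C) * variant_capacity \<alpha> p \<rho> \<omega> E \<le> riesz_capacity \<alpha> p \<rho> \<omega> E"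
    unfolding riesz_capacity_def
  proof (rule Inf_greatest, clarify)
    fix f assume f: "f \<in> borel_measurable lebesgue" "\<forall>x. 0 \<le> f x" "Lp_energy p \<omega> f < \<infinity>"
      "\<forall>x\<in>E. 1 \<le> riesz_potential \<alpha> \<rho> f x"
    obtain g where g: "g \<in> borel_measurable lborel" "AE x in lborel. f x = g x"
      using completion_ex_borel_measurable_real[OF f(1)] by blast
    have [measurable]: "g \<in> borel_measurable borel" using g(1) by simp
    have ae: "AE x in lborel. ennreal (f x) = ennreal (g x)" using g(2) by (rule eventually_mono) simp
    \<comment> \<open>The density of the competitor relative to s dx, the form in which the maximal
      theorem is stated.\<close>
    define h where "h y = ennreal (g y) * inverse (s y)" for y
    have h: "h \<in> borel_measurable borel" unfolding h_def[abs_def] by measurable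
    have hs: "h y * s y = ennreal (g y)" for y by (simp add: h_def mult.assoc inverse_s_mult)
    have energy_f: "Lp_energy p \<omega> f = (\<integral>\<^sup>+y. ennreal_powr (h y) p * s y \<partial>lborel)"
    proof -
      have "ennreal_powr (ennreal (g y)) p * w y = ennreal_powr (h y) p * s y" for y
        using w_mult_ennreal_powr[of "h y" y] by (simp add: hs)
      then show ?thesis using Lp_energy_eq[OF \<omega> ae] f(2) by simp
    qed
    have pot_f: "riesz_potential \<alpha> \<rho> f x = (\<integral>\<^sup>+y. ennreal (riesz_kernel \<alpha> \<rho> (x - y)) * (h y * s y) \<partial>lborel)" for x
      unfolding hs by (rule riesz_potential_eq[OF ae])
    have fin: "(\<integral>\<^sup>+y. ennreal_powr (h y) p * s y \<partial>lborel) < top"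
      using f(3) by (simp add: energy_f)
    obtain F where F: "F \<in> borel_measurable (borel \<Otimes>\<^sub>M borel)" "\<And>z. F z < top"
      and energy_F: "borel_energy p \<rho> s F \<le> ennreal (upper_const TYPE('n) \<alpha> p K) * (\<integral>\<^sup>+y. ennreal_powr (h y) p * s y \<partial>lborel)"
      and pot_F: "\<And>x. (\<integral>\<^sup>+y. ennreal (riesz_kernel \<alpha> \<rho> (x - y)) * (h y * s y) \<partial>lborel) \<le> borel_potential \<alpha> \<rho> s F x"
      using layered_dominates_riesz[OF h fin \<rho> \<alpha>, folded upper_const_def[of "TYPE('n)"]] by blast
    let ?F = "\<lambda>z. enn2real (F z)"
    have aeF: "AE t in lborel. t \<in> {0<..<\<rho>} \<longrightarrow> (AE y in lborel. ennreal (?F (y, t)) = F (y, t))"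
      using F(2) by simp
    have energy: "layered_energy p \<rho> \<omega> ?F = borel_energy p \<rho> s F"
      by (rule layered_energy_eq[OF \<omega> aeF]) simp
    have pot: "layered_potential \<alpha> p \<rho> \<omega> ?F x = borel_potential \<alpha> \<rho> s F x" for x
      by (rule layered_potential_eq[OF \<omega> aeF _ F(1)]) simp
    have le: "borel_energy p \<rho> s F \<le> ennreal C * Lp_energy p \<omega> f"
      unfolding energy_f using energy_F C by (elim order_trans) (intro mult_right_mono ennreal_leI, auto)
    also have "\<dots> < top" using f(3) by (simp add: ennreal_mult_less_top)
    finally have finF: "borel_energy p \<rho> s F < top" .
    have "?F \<in> borel_measurable (borel \<Otimes>\<^sub>M borel)" using F(1) by simp
    then have "?F \<in> borel_measurable (lebesgue_on (UNIV \<times> {0<..<\<rho>}))"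
      by (intro measurable_restrict_space1 measurable_completion) (simp add: borel_prod)
    moreover have "\<forall>x\<in>E. 1 \<le> layered_potential \<alpha> p \<rho> \<omega> ?F x"
      using f(4) pot_F unfolding pot_f pot by (meson order_trans)
    ultimately have "variant_capacity \<alpha> p \<rho> \<omega> E \<le> layered_energy p \<rho> \<omega> ?F"
      unfolding variant_capacity_def using finF energy
      by (intro Inf_lower CollectI exI[of _ ?F] conjI) auto
    also have "\<dots> \<le> ennreal C * Lp_energy p \<omega> f" unfolding energy by (rule le)
    finally show "ennreal (inverse C) * variant_capacity \<alpha> p \<rho> \<omega> E \<le> Lp_energy p \<omega> f"
      using C by (simp add: ennreal_inverse_mult_le_iff)
  qed
  then show ?thesis using C by (simp add: ennreal_inverse_mult_le_iff)
qed

end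

theorem theorem3p5p3:
  fixes \<alpha> p :: real
  assumes "0 < \<alpha>" "\<alpha> < real CARD('n::finite)" and "1 < p"
  shows "\<exists>C :: ennreal \<Rightarrow> real. (\<forall>K. 0 < C K) \<and>
    (\<forall>\<rho>>0. \<forall>\<omega> :: real^'n \<Rightarrow> real. \<omega> \<in> Ap_loc p \<longrightarrow>
      (\<forall>E :: (real^'n) set.
        ennreal (inverse (C (Ap_loc_const p (20 * \<rho>) \<omega>))) * riesz_capacity \<alpha> p \<rho> \<omega> E
          \<le> variant_capacity \<alpha> p \<rho> \<omega> E \<and>
        variant_capacity \<alpha> p \<rho> \<omega> E
          \<le> ennreal (C (Ap_loc_const p (20 * \<rho>) \<omega>)) * riesz_capacity \<alpha> p \<rho> \<omega> E))"
proof -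
  \<comment> \<open>The factor 2^(n p) translates the constant for cubes into that for
    balls.\<close>
  define k where "k K = enn2real K * 2 powr (real CARD('n) * p)" for K
  \<comment> \<open>One constant for both inequalities, chosen before \<open>\<rho>\<close> and
    \<open>\<omega>\<close>; the added 1 makes it positive.\<close>
  define C where "C K = 1 + max (lower_const (real CARD('n)) \<alpha> p (k K)) (upper_const TYPE('n) \<alpha> p (k K))" for K
  have k: "0 \<le> k K" for K by (simp add: k_def)
  have "0 \<le> lower_const (real CARD('n)) \<alpha> p (k K)" for K
    using k by (simp add: lower_const_def)
  then have C_pos: "0 < C K" for K unfolding C_def by (smt (verit))
  have C_ge: "lower_const (real CARD('n)) \<alpha> p (k K) \<le> C K" "upper_const TYPE('n) \<alpha> p (k K) \<le> C K" for K
    unfolding C_def by (smt (verit))+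
  have "ennreal (inverse (C (Ap_loc_const p (20 * \<rho>) \<omega>))) * riesz_capacity \<alpha> p \<rho> \<omega> E
      \<le> variant_capacity \<alpha> p \<rho> \<omega> E \<and>
    variant_capacity \<alpha> p \<rho> \<omega> E
      \<le> ennreal (C (Ap_loc_const p (20 * \<rho>) \<omega>)) * riesz_capacity \<alpha> p \<rho> \<omega> E"
    if \<rho>: "0 < \<rho>" and \<omega>: "\<omega> \<in> Ap_loc p" for \<rho> and \<omega> :: "real^'n \<Rightarrow> real" and E
  proof -
    let ?K = "Ap_loc_const p (20 * \<rho>) \<omega>"
    obtain v where v: "pos_weight p v" "AE x in lborel. \<omega> x = v x" "Ap_balls p v (20 * \<rho> / 2) (k ?K)"
      using Ap_loc_regularize[OF \<omega> assms(3)] unfolding k_def by metis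
    interpret pos_weight p v by (rule v(1))
    \<comment> \<open>Cubes of side 20 \<rho> are balls of radius 10 \<rho>, which leaves room for
      the required 4 \<rho>.\<close>
    interpret Ap_weight p v "10 * \<rho>" "k ?K"
      using v(3) \<rho> k by unfold_locales auto
    show ?thesis
      using riesz_capacity_le[OF v(2) \<rho> _ assms(1,2) C_pos C_ge(1)]
        variant_capacity_le[OF v(2) \<rho> _ assms(1,2) C_pos C_ge(2)] \<rho> by simp
  qed
  then show ?thesis using C_pos by (intro exI[of _ C]) blast
qed

end
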